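(* Let $p\in\mathbb{N}$, let $u\le s+1$ be nonnegative integers, and let $\mathbf{a}\in\mathbb{C}^p$, $\mathbf{b}\in\mathbb{C}^p$ with $-\mathbf{b}\notin\mathbb{N}_0$, $\mathbf{c}\in\mathbb{C}^u$, $\mathbf{d}\in\mathbb{C}^s$ with $-\mathbf{d}\notin\mathbb{N}_0$ be arbitrary. Choose a nonnegative integer $n>-\min(a,\Re(\psi))$ (in the definition of $\mathcal{G}_1$). Then $$\left\langle\mathcal{G}_1(\mathbf{a},\mathbf{b}),\,{}_uF_s(\mathbf{c};\mathbf{d};-zt)\right\rangle={}_{u+p}F_{s+p}\!\left(\begin{matrix}\mathbf{a},\mathbf{c}\\\mathbf{b},\mathbf{d}\end{matrix}\,\Big|-z\right)$$ for all $z\in\mathbb{C}$ if $u\le s$ and for all $z\in\mathbb{C}\setminus(-\infty,-1]$ if $u=s+1$ (the functional acting in the variable $t\in[0,1]$).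
   Context: $\mathbb{N}_0=\mathbb{N}\cup\{0\}$. For a vector $\mathbf{a}=(a_1,\dots,a_p)$: $\Gamma(\mathbf{a})=\prod_i\Gamma(a_i)$, $(\mathbf{a})_j=\prod_i(a_i)_j$, $\mathbf{a}+\mu=(a_1+\mu,\dots,a_p+\mu)$; conditions such as $-\mathbf{a}\notin\mathbb{N}_0$ are element-wise. $a=\min(\Re a_1,\dots,\Re a_p)$, $\psi=\sum_{k=1}^p(b_k-a_k)$. When the numbers of upper and lower parameters of a hypergeometric function differ by one (upper = lower + 1), it denotes the analytic continuation to $\mathbb{C}\setminus[1,\infty)$ in its argument. For $0<t<1$ and $-\mathbf{a}\notin\mathbb{N}_0$, $$\widehat{G}_n(t)=G^{p,1}_{p+1,p+1}\!\left(t\,\Big|\begin{array}{l}n,\mathbf{b}+n-1\\ \mathbf{a}+n-1,0\end{array}\right)=\frac{1}{2\pi i}\int_{\mathcal{L}}\frac{\Gamma(\mathbf{a}+n-1+s)\,\Gamma(1-n-s)}{\Gamma(\mathbf{b}+n-1+s)\,\Gamma(1-s)}\,t^{-s}\,ds,$$ where $\mathcal{L}$ is a left loop (starting and ending at $-\infty$, traversed counterclockwise) that leaves all the points $1-a_j-n-l$, $l\in\mathbb{N}_0$, on its left and all the points $1-n+k$, $k\in\mathbb{N}_0$, on its right. If some components of $\mathbf{a}$ are non-positive integers, $\widehat{G}_n(t)/\Gamma(\mathbf{a})$ denotes its extension by continuity in $\mathbf{a}$, namely $\frac{t^{n-1}}{(n-1)!}\sum_{j=0}^{n-1}\frac{(1-n)_j(\mathbf{a})_j}{\Gamma(\mathbf{b}+j)\,j!}t^{-j}$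 (and $0$ if $n=0$). $\mathcal{CB}^\infty[0,1]$ is the space of functions on $[0,1]$ having derivatives of all orders, all bounded on $[0,1]$. For a nonnegative integer $n>-\min(a,\Re(\psi))$ and $\varphi\in\mathcal{CB}^\infty[0,1]$, $$\langle\mathcal{G}_1(\mathbf{a},\mathbf{b}),\varphi\rangle=\sum_{k=0}^{n-1}\frac{(-1)^k\varphi^{(k)}(1)}{k!}\,{}_{p+1}F_p\!\left(\begin{matrix}\mathbf{a},-k\\\mathbf{b}\end{matrix}\,\Big|\,1\right)+\frac{(-1)^n\Gamma(\mathbf{b})}{\Gamma(\mathbf{a})}\int_0^1\widehat{G}_n(t)\varphi^{(n)}(t)\,dt$$ (the finite sum is empty if $n=0$; the value does not depend on the choice of $n$). *)

theory Defs
  imports "HOL-Complex_Analysis.Complex_Analysis"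
begin

definition Gamma_vec :: "complex list \<Rightarrow> complex" where
  "Gamma_vec a = (\<Prod>x\<leftarrow>a. Gamma x)"

definition poch_vec :: "complex list \<Rightarrow> nat \<Rightarrow> complex" where
  "poch_vec a j = (\<Prod>x\<leftarrow>a. pochhammer x j)"

definition shift_vec :: "complex list \<Rightarrow> complex \<Rightarrow> complex list" where
  "shift_vec a \<mu> = map (\<lambda>x. x + \<mu>) a"


definition hypergeom_series :: "complex list \<Rightarrow> complex list \<Rightarrow> complex \<Rightarrow> complex" where
  "hypergeom_series a b z = (\<Sum>k. poch_vec a k / poch_vec b k * z ^ k / fact k)"

definition cut_plane :: "complex set" where
  "cut_plane = - (complex_of_real ` {1..})"

text \<open>If there is one more upper than lower parameter, the value on the cut plane is that of the
  analytic continuation of the series. On the cut itself the series is kept; this is what gives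
  the terminating sums at the point 1 used below.\<close>

definition hypergeom :: "complex list \<Rightarrow> complex list \<Rightarrow> complex \<Rightarrow> complex" where
  "hypergeom a b z =
     (if length a = length b + 1 \<and> z \<in> cut_plane
      then (SOME f. f holomorphic_on cut_plane \<and> (\<forall>w\<in>ball 0 1. f w = hypergeom_series a b w)) z
      else hypergeom_series a b z)"


text \<open>A left loop is represented by a compact path \<open>g\<close>. It comes in from \<open>-\<infinity>\<close> along the horizontal
  ray ending at the start of \<open>g\<close>, follows \<open>g\<close>, and leaves to \<open>-\<infinity>\<close> along the horizontal ray
  starting at the end of \<open>g\<close>. \<open>loop_trunc g X\<close> is the part with the rays cut off at real part \<open>X\<close>,
  and \<open>loop_closed g X\<close> closes it up by a vertical segment.

  A point is to the left of the (counterclockwise) loop if the closed-up truncations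
  eventually wind around it once, and to the right if they eventually do not wind around it.
  Simplicity of the curve is not needed, as integrals depend on the winding numbers only.\<close>

definition loop_trunc :: "(real \<Rightarrow> complex) \<Rightarrow> real \<Rightarrow> real \<Rightarrow> complex" where
  "loop_trunc g X =
     linepath (Complex X (Im (pathstart g))) (pathstart g) +++ g +++
     linepath (pathfinish g) (Complex X (Im (pathfinish g)))"

definition loop_closed :: "(real \<Rightarrow> complex) \<Rightarrow> real \<Rightarrow> real \<Rightarrow> complex" where
  "loop_closed g X =
     loop_trunc g X +++
     linepath (Complex X (Im (pathfinish g))) (Complex X (Im (pathstart g)))"

definition loop_winds :: "(real \<Rightarrow> complex) \<Rightarrow> complex \<Rightarrow> complex \<Rightarrow> bool" where
  "loop_winds g w m \<longleftrightarrow>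
     (\<forall>\<^sub>F X in at_bot. w \<notin> path_image (loop_closed g X) \<and> winding_number (loop_closed g X) w = m)"

definition left_loop :: "(real \<Rightarrow> complex) \<Rightarrow> complex set \<Rightarrow> complex set \<Rightarrow> bool" where
  "left_loop g L R \<longleftrightarrow>
     valid_path g \<and> Im (pathstart g) < Im (pathfinish g) \<and>
     (\<forall>w\<in>L. loop_winds g w 1) \<and> (\<forall>w\<in>R. loop_winds g w 0)"

definition loop_integral :: "(real \<Rightarrow> complex) \<Rightarrow> (complex \<Rightarrow> complex) \<Rightarrow> complex" where
  "loop_integral g f = Lim at_bot (\<lambda>X. contour_integral (loop_trunc g X) f)"


text \<open>The Meijer function. At a pole of the Gamma function in a denominator the library convention
  (\<open>Gamma\<close> is 0 there, and division by 0 gives 0) yields the correct value 0 of the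
  reciprocal Gamma function.\<close>

definition G_hat :: "complex list \<Rightarrow> complex list \<Rightarrow> nat \<Rightarrow> real \<Rightarrow> complex" where
  "G_hat a b n t =
     1 / (2 * of_real pi * \<i>) *
     loop_integral
       (SOME g. left_loop g {1 - x - of_nat n - of_nat l | x l. x \<in> set a}
                            {1 - of_nat n + of_nat k | k. True})
       (\<lambda>s. Gamma_vec (shift_vec a (of_nat n - 1 + s)) * Gamma (1 - of_nat n - s) /
            (Gamma_vec (shift_vec b (of_nat n - 1 + s)) * Gamma (1 - s)) *
            of_real t powr (- s))"

text \<open>The quotient of \<open>G_hat a b n t\<close> by \<open>Gamma_vec a\<close>, extended by continuity to parameters \<open>a\<close>
  with non-positive integer components.\<close>

definition G_hat_Gamma :: "complex list \<Rightarrow> complex list \<Rightarrow> nat \<Rightarrow> real \<Rightarrow> complex" where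
  "G_hat_Gamma a b n t =
     (if \<forall>x\<in>set a. - x \<notin> \<nat> then G_hat a b n t / Gamma_vec a
      else if n = 0 then 0
      else of_real t ^ (n - 1) / fact (n - 1) *
           (\<Sum>j<n. pochhammer (1 - of_nat n) j * poch_vec a j /
                   (Gamma_vec (shift_vec b (of_nat j)) * fact j) * inverse (of_real t) ^ j))"


text \<open>Derivatives on \<open>[0,1]\<close> are one-sided at the endpoints.\<close>

definition deriv01 :: "nat \<Rightarrow> (real \<Rightarrow> complex) \<Rightarrow> real \<Rightarrow> complex" where
  "deriv01 k \<phi> = ((\<lambda>f t. vector_derivative f (at t within {0..1})) ^^ k) \<phi>"

definition CB_inf :: "(real \<Rightarrow> complex) set" where
  "CB_inf = {\<phi>. \<forall>k. deriv01 k \<phi> differentiable_on {0..1} \<and> bounded (deriv01 k \<phi> ` {0..1})}"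

definition G1 :: "complex list \<Rightarrow> complex list \<Rightarrow> nat \<Rightarrow> (real \<Rightarrow> complex) \<Rightarrow> complex" where
  "G1 a b n \<phi> =
     (\<Sum>k<n. (- 1) ^ k * deriv01 k \<phi> 1 / fact k * hypergeom (a @ [- of_nat k]) b 1) +
     (- 1) ^ n * Gamma_vec b *
       (LINT t:{0<..<1}|lborel. G_hat_Gamma a b n t * deriv01 n \<phi> t)"

end

theory Submission
  imports Defs "HOL-Real_Asymp.Real_Asymp"
begin

text \<open>Write f(m) = (a)_m / (b)_m. The functional multiplies Taylor coefficients by f: it sends
  \<phi>(t) = H(w t), where H(x) is the sum of h_m x^m, to the sum of f(m) h_m w^m. For a hypergeometric H
  with parameters c, d the result has the coefficients of the hypergeometric function with parameters
  a,c and b,d, and this is the theorem, with w = -z.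

  On (0,1) the kernel of the functional is a polynomial in t plus a function v. By Taylor's formula
  at 1 with integral remainder, the finite sum over k and the polynomial together give the sum of
  f(j) \<phi>^(j)(0) / j! for j < n, that is, the first n terms (\<open>taylor_functional\<close>). The integral of v
  against the n-th derivative of \<phi> has to supply the others, so what matters is that v is integrable
  and that its moments are (-1)^n f(n + q) q! / (n + q)! (\<open>G_hat_Gamma_decomposition\<close>).

  Let F(s) t^(-s) be the integrand of the Meijer function. By the residue theorem a left loop
  integral is the sum of the residues at the poles on its left, whatever the loop
  (\<open>loop_integral_left_loop\<close>). Up to a constant factor, v is the sum of the residues at all poles, and
  the polynomial stems from the n poles on the right; only if a nonpositive integer occurs in a, the
  kernel is the polynomial and v = 0. Away from the poles |F(s)| is at most a constant
  times (1 + |s|)^(-\<rho>), where \<rho> = Re \<psi> + n > 0 (\<open>norm_Gamma_ratio_le\<close>, \<open>G_kernel_decay\<close>). Hence the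
  residues in a vertical strip of width 1 at distance k from the origin contribute
  O(k^(-\<rho>) t^(k - x0)) with some x0 < 1, which exists because n > -a. The integrals of these bounds
  over (0,1) are O(k^(-1-\<rho>)), so v is integrable and may be integrated termwise. Its moment of order
  q is then the sum of the residues of F(s) / (q + 1 - s) at the poles of F, which is F(q + 1) by the
  residue theorem on large rectangles (\<open>mellin_density_moment\<close>).

  For small w the power series of the n-th derivative of H can now be integrated termwise. The value
  of the functional is holomorphic in w wherever H is, on the whole plane or on the cut plane, which
  are both star-shaped; so the identity extends by uniqueness of analytic continuation
  (\<open>G1_dilation\<close>). The same integral shows that hypergeometric functions with one more upper than
  lower parameter do continue to the cut plane: starting from (1 - x)^(-c), one adds one pair of
  parameters at a time (\<open>hypergeom_continuation_exists\<close>).\<close>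

section \<open>Growth of quotients of Gamma functions\<close>

text \<open>Compares the summand Y / ((x + k)^2 + Y^2) with the integral of the same function over an interval
  of length 1, which is a difference of values of the arc tangent. Since Y \<ge> 1, the integrand
  changes by at most the factor 3 on such an interval.\<close>

lemma lorentz_le_arctan_diff:
  fixes Y u :: real
  assumes "Y \<ge> 1"
  shows "Y / (u\<^sup>2 + Y\<^sup>2) \<le> 3 * (arctan ((u + 1) / Y) - arctan (u / Y))"
proof -
  have der: "((\<lambda>x. arctan (x / Y)) has_real_derivative Y / (x\<^sup>2 + Y\<^sup>2)) (at x)" for x
    using assms
    by (auto intro!: derivative_eq_intros simp: field_simps power2_eq_square)
  obtain z where z: "u < z" "z < u + 1"
    "arctan ((u + 1) / Y) - arctan (u / Y) = (u + 1 - u) * (Y / (z\<^sup>2 + Y\<^sup>2))"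
    using MVT2[of u "u + 1" "\<lambda>x. arctan (x / Y)" "\<lambda>x. Y / (x\<^sup>2 + Y\<^sup>2)"] der by auto
  have "z\<^sup>2 \<le> (\<bar>u\<bar> + 1)\<^sup>2"
    using z by (intro abs_le_square_iff[THEN iffD1]) auto
  also have "\<dots> \<le> 2 * u\<^sup>2 + 2"
    using sum_squares_ge_zero[of "\<bar>u\<bar> - 1" 0] by (simp add: power2_eq_square algebra_simps)
  finally have "z\<^sup>2 + Y\<^sup>2 \<le> 3 * (u\<^sup>2 + Y\<^sup>2)"
    using one_le_power[OF assms, of 2] zero_le_power2[of u] unfolding distrib_left by linarith
  moreover have "z\<^sup>2 + Y\<^sup>2 > 0" "u\<^sup>2 + Y\<^sup>2 > 0"
    using assms by (auto intro!: add_nonneg_pos)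
  ultimately have "Y / (u\<^sup>2 + Y\<^sup>2) \<le> 3 * (Y / (z\<^sup>2 + Y\<^sup>2))"
    using assms mult_left_mono[of "z\<^sup>2 + Y\<^sup>2" "3 * (u\<^sup>2 + Y\<^sup>2)" Y]
    by (simp add: field_simps)
  thus ?thesis using z by simp
qed

text \<open>The numerator 1 + |Im s| is what makes complex exponents possible below. The sum is still
  dominated by the arc tangent telescope, uniformly in the whole plane, as long as s keeps a fixed
  distance from the nonpositive integers.\<close>

lemma sum_inverse_square_shifts_bounded:
  fixes \<delta> :: real
  assumes "\<delta> > 0"
  obtains C where "C \<ge> 0" and
    "\<And>s N. (\<And>k::nat. \<delta> \<le> norm (s + of_nat k)) \<Longrightarrow>
       (\<Sum>k<N. (1 + \<bar>Im s\<bar>) / (norm (s + of_nat k))\<^sup>2) \<le> C"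
proof
  (* the cost of replacing |s + k|^2 by (Re s + k)^2 + (1 + |Im s|)^2 in a denominator *)
  define D where "D = 3 + 2 / \<delta>\<^sup>2"
  have D: "D > 0" using assms by (auto simp: D_def add_pos_nonneg)
  show "D * (3 * pi) \<ge> 0" using D by simp
  fix s :: complex and N :: nat
  assume s: "\<And>k::nat. \<delta> \<le> norm (s + of_nat k)"
  define Y where "Y = 1 + \<bar>Im s\<bar>"
  have Y: "Y \<ge> 1" by (simp add: Y_def)
  have "Y / (norm (s + of_nat k))\<^sup>2 \<le>
          D * (3 * (arctan ((Re s + k + 1) / Y) - arctan ((Re s + k) / Y)))" for k :: nat
  proof -
    have eq: "(norm (s + of_nat k))\<^sup>2 = (Re s + k)\<^sup>2 + (Im s)\<^sup>2"
      by (simp add: cmod_power2)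
    have d: "\<delta>\<^sup>2 \<le> (norm (s + of_nat k))\<^sup>2" using s[of k] assms by (intro power_mono) auto
    hence pos: "(norm (s + of_nat k))\<^sup>2 > 0" using assms by (smt (verit) zero_less_power)
    have "Y\<^sup>2 \<le> 2 + 2 * (Im s)\<^sup>2"
      using sum_squares_ge_zero[of "\<bar>Im s\<bar> - 1" 0] unfolding Y_def
      by (simp add: power2_eq_square algebra_simps)
    moreover have "2 \<le> 2 / \<delta>\<^sup>2 * (norm (s + of_nat k))\<^sup>2"
      using d assms by (simp add: field_simps)
    ultimately have "Y\<^sup>2 \<le> 2 / \<delta>\<^sup>2 * (norm (s + of_nat k))\<^sup>2 + 2 * (Im s)\<^sup>2" by linarith
    hence le: "(Re s + k)\<^sup>2 + Y\<^sup>2 \<le> D * (norm (s + of_nat k))\<^sup>2"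
      unfolding D_def distrib_right using eq zero_le_power2[of "Re s + k"] zero_le_power2[of "Im s"]
      by linarith
    have pos': "(Re s + k)\<^sup>2 + Y\<^sup>2 > 0" using Y by (auto intro!: add_nonneg_pos)
    have "Y / (norm (s + of_nat k))\<^sup>2 \<le> D * (Y / ((Re s + k)\<^sup>2 + Y\<^sup>2))"
      using mult_left_mono[OF le, of Y] pos pos' Y D by (simp add: field_simps)
    also have "\<dots> \<le> D * (3 * (arctan ((Re s + k + 1) / Y) - arctan ((Re s + k) / Y)))"
      using lorentz_le_arctan_diff[OF Y, of "Re s + k"] D by (intro mult_left_mono) auto
    finally show ?thesis .
  qed
  hence "(\<Sum>k<N. Y / (norm (s + of_nat k))\<^sup>2) \<le>
     (\<Sum>k<N. D * (3 * (arctan ((Re s + k + 1) / Y) - arctan ((Re s + k) / Y))))"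
    by (intro sum_mono)
  also have "\<dots> = D * (3 * (\<Sum>k<N. (arctan ((Re s + Suc k) / Y) - arctan ((Re s + k) / Y))))"
    by (simp add: sum_distrib_left add_ac)
  also have "\<dots> = D * (3 * (arctan ((Re s + N) / Y) - arctan ((Re s) / Y)))"
    using sum_lessThan_telescope[of "\<lambda>k. arctan ((Re s + real k) / Y)" N] by simp
  also have "\<dots> \<le> D * (3 * pi)"
    using arctan_bounded[of "(Re s + N) / Y"] arctan_bounded[of "Re s / Y"] D
    by (intro mult_left_mono) auto
  finally show "(\<Sum>k<N. (1 + \<bar>Im s\<bar>) / (norm (s + of_nat k))\<^sup>2) \<le> D * (3 * pi)"
    by (simp add: Y_def)
qed

text \<open>From |1 + w|^2 = 1 + (2 Re w + |w|^2) and 1 + x \<le> exp x. As this holds for all w, no branch of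
  the logarithm has to be controlled.\<close>

lemma norm_one_plus_le_exp:
  fixes w :: complex
  shows "norm (1 + w) \<le> exp (Re w + (norm w)\<^sup>2 / 2)"
proof -
  have "(norm (1 + w))\<^sup>2 = 1 + (2 * Re w + (norm w)\<^sup>2)"
    unfolding cmod_power2 by (simp add: power2_eq_square algebra_simps)
  also have "\<dots> \<le> exp (2 * Re w + (norm w)\<^sup>2)"
    by (rule exp_ge_add_one_self)
  also have "\<dots> = (exp (Re w + (norm w)\<^sup>2 / 2))\<^sup>2"
    by (simp add: power2_eq_square flip: exp_add)
  finally show ?thesis
    by (rule power2_le_imp_le) simp
qed

text \<open>A first-order expansion of ln |z| under the step from z to z + 1. The upper bound comes from
  |1 + 1/z|, the lower one from |1 - 1/(z + 1)|.\<close>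

lemma ln_norm_step:
  fixes z :: complex and \<delta> :: real
  assumes "\<delta> > 0" "\<delta> \<le> norm z" "\<delta> \<le> norm (z + 1)"
  shows "\<bar>ln (norm (z + 1)) - ln (norm z) - Re (1 / z)\<bar> \<le> (2 + 1/\<delta>)\<^sup>2 / (norm z)\<^sup>2"
proof -
  define E where "E = 1 + 1 / \<delta>"
  have E: "E \<ge> 1" using assms by (simp add: E_def)
  have nz: "z \<noteq> 0" "z + 1 \<noteq> 0" using assms by auto
  define w where "w = 1 / z"
  define w' where "w' = 1 / (z + 1)"
  have nw: "norm w = 1 / norm z" by (simp add: w_def norm_divide)
  have zz: "norm z \<le> E * norm (z + 1)"
  proof -
    have "norm z \<le> norm (z + 1) + 1"
      using norm_triangle_ineq4[of "z + 1" 1] by simp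
    also have "1 \<le> norm (z + 1) / \<delta>" using assms by simp
    finally show ?thesis by (simp add: E_def algebra_simps)
  qed
  have nw': "norm w' \<le> E * norm w"
    using zz nz by (simp add: w_def w'_def norm_divide field_simps)
  have "ln (norm (z + 1)) - ln (norm z) = ln (norm (1 + w))"
  proof -
    have "1 + w = (z + 1) / z" using nz by (simp add: w_def field_simps)
    thus ?thesis using nz by (simp add: norm_divide ln_div)
  qed
  also have up: "\<dots> \<le> Re w + (norm w)\<^sup>2 / 2"
  proof -
    have "norm (1 + w) > 0" using nz by (simp add: w_def field_simps)
    thus ?thesis using norm_one_plus_le_exp[of w] by (metis ln_ge_iff ln_exp ln_le_cancel_iff exp_gt_zero)
  qed
  finally have up: "ln (norm (z + 1)) - ln (norm z) \<le> Re w + (norm w)\<^sup>2 / 2" .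
  have "ln (norm z) - ln (norm (z + 1)) = ln (norm (1 + (- w')))"
  proof -
    have "1 + (- w') = z / (z + 1)" using nz by (simp add: w'_def field_simps)
    thus ?thesis using nz by (simp add: norm_divide ln_div)
  qed
  also have "\<dots> \<le> Re (- w') + (norm (- w'))\<^sup>2 / 2"
  proof -
    have "1 + (- w') = z / (z + 1)" using nz by (simp add: w'_def field_simps)
    hence "norm (1 + (- w')) > 0" using nz by simp
    thus ?thesis using norm_one_plus_le_exp[of "- w'"] by (metis ln_ge_iff ln_exp ln_le_cancel_iff exp_gt_zero)
  qed
  finally have low: "ln (norm (z + 1)) - ln (norm z) \<ge> Re w' - (norm w')\<^sup>2 / 2" by simp
  have "w - w' = w * w'" using nz by (simp add: w_def w'_def field_simps)
  hence "Re w - Re w' \<le> norm w * norm w'"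
    by (metis complex_Re_le_cmod minus_complex.simps(1) norm_mult)
  also have "\<dots> \<le> norm w * (E * norm w)" using nw' by (intro mult_left_mono) auto
  finally have d: "Re w - Re w' \<le> E * (norm w)\<^sup>2" by (simp add: power2_eq_square mult_ac)
  have e: "(norm w')\<^sup>2 \<le> E\<^sup>2 * (norm w)\<^sup>2"
    using power_mono[OF nw', of 2] by (simp add: power_mult_distrib)
  have "E + E\<^sup>2 / 2 \<le> (E + 1)\<^sup>2" "1 / 2 \<le> (E + 1)\<^sup>2"
    using E by (auto simp: power2_eq_square algebra_simps)
  hence f: "E * (norm w)\<^sup>2 + E\<^sup>2 / 2 * (norm w)\<^sup>2 \<le> (E + 1)\<^sup>2 * (norm w)\<^sup>2"
    "1 / 2 * (norm w)\<^sup>2 \<le> (E + 1)\<^sup>2 * (norm w)\<^sup>2"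
    using mult_right_mono[of "E + E\<^sup>2 / 2" "(E + 1)\<^sup>2" "(norm w)\<^sup>2"]
      mult_right_mono[of "1 / 2" "(E + 1)\<^sup>2" "(norm w)\<^sup>2"] by (simp_all add: distrib_right)
  have "\<bar>ln (norm (z + 1)) - ln (norm z) - Re w\<bar> \<le> (E + 1)\<^sup>2 * (norm w)\<^sup>2"
    using up low d e f by (auto simp: abs_le_iff)
  also have "\<dots> = (2 + 1/\<delta>)\<^sup>2 / (norm z)\<^sup>2"
    by (simp add: nw E_def power_divide algebra_simps)
  finally show ?thesis by (simp add: w_def)
qed

text \<open>The upper half of Stirling's formula for a quotient, in the whole plane away from the poles. By
  Gauss' limit the quotient is the limit of N^(-\<beta>) times the product of 1 + \<beta> / (s + k) for k up to
  N, and the logarithm of the modulus of each factor is Re \<beta> (ln |s + k + 1| - ln |s + k|), up to an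
  error that is summable uniformly in s.\<close>

lemma norm_Gamma_ratio_le:
  fixes \<beta> :: complex and \<delta> :: real
  assumes "\<delta> > 0"
  obtains C where "C \<ge> 0" and
    "\<And>s. (\<And>k::nat. \<delta> \<le> norm (s + of_nat k)) \<Longrightarrow>
       norm (Gamma s * rGamma (s + \<beta>)) \<le> C * norm s powr (- Re \<beta>)"
proof -
  obtain C0 where C0: "C0 \<ge> 0"
    "\<And>s N. (\<And>k::nat. \<delta> \<le> norm (s + of_nat k)) \<Longrightarrow>
       (\<Sum>k<N. (1 + \<bar>Im s\<bar>) / (norm (s + of_nat k))\<^sup>2) \<le> C0"
    using sum_inverse_square_shifts_bounded[OF assms] by metis
  define D where "D = \<bar>Re \<beta>\<bar> * (2 + 1/\<delta>)\<^sup>2 + \<bar>Im \<beta>\<bar> + (norm \<beta>)\<^sup>2"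
  have D: "D \<ge> 0" by (simp add: D_def)
  show ?thesis
  proof
    show "exp (D * C0) \<ge> 0" by simp
    fix s :: complex assume s: "\<And>k::nat. \<delta> \<le> norm (s + of_nat k)"
    have s0: "norm s > 0" using s[of 0] assms by (metis add.right_neutral less_le_trans of_nat_0)
    have snz: "s + of_nat k \<noteq> 0" for k using s[of k] assms by auto
    have s_nonpos: "s \<notin> \<int>\<^sub>\<le>\<^sub>0"
    proof
      assume "s \<in> \<int>\<^sub>\<le>\<^sub>0"
      then obtain n where "s = - of_nat n" by (elim nonpos_Ints_cases') auto
      thus False using snz[of n] by simp
    qed
    (* The real part of 1/(s + k) is compared with a difference of logarithms, which
       telescopes; its imaginary part is itself one of the summable error terms. *)
    define f where "f k = ln (norm (s + of_nat k))" for k :: nat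
    have step: "norm (1 + \<beta> / (s + of_nat k)) \<le>
        exp (Re \<beta> * (f (Suc k) - f k) + D * ((1 + \<bar>Im s\<bar>) / (norm (s + of_nat k))\<^sup>2))" for k
    proof -
      define z where "z = s + of_nat k"
      have z1: "z + 1 = s + of_nat (Suc k)" by (simp add: z_def)
      have z: "\<delta> \<le> norm z" "\<delta> \<le> norm (z + 1)" using s[of k] s[of "Suc k"] unfolding z1 unfolding z_def by auto
      have imz: "Im z = Im s" by (simp add: z_def)
      have zp: "norm z > 0" using z assms by linarith
      define R where "R = f (Suc k) - f k - Re (1 / z)"
      have R: "\<bar>R\<bar> \<le> (2 + 1/\<delta>)\<^sup>2 / (norm z)\<^sup>2"
        unfolding R_def f_def z1[symmetric] z_def[symmetric]
        using ln_norm_step[OF assms z] by simp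
      have im: "Im (1 / z) = - Im s / (norm z)\<^sup>2"
        by (simp add: Im_divide cmod_power2 imz)
      have "Re (\<beta> / z) = Re \<beta> * Re (1 / z) - Im \<beta> * Im (1 / z)"
      proof -
        have "\<beta> / z = \<beta> * (1 / z)" by simp
        thus ?thesis by (metis times_complex.sel(1))
      qed
      also have "\<dots> = Re \<beta> * (f (Suc k) - f k) - Re \<beta> * R + Im \<beta> * (Im s / (norm z)\<^sup>2)"
        unfolding R_def im by (simp add: algebra_simps)
      finally have eq: "Re (\<beta> / z) = Re \<beta> * (f (Suc k) - f k) - Re \<beta> * R + Im \<beta> * (Im s / (norm z)\<^sup>2)" .
      have "- Re \<beta> * R \<le> \<bar>Re \<beta>\<bar> * \<bar>R\<bar>" by (metis abs_ge_self abs_mult abs_minus_cancel)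
      also have "\<dots> \<le> \<bar>Re \<beta>\<bar> * ((2 + 1/\<delta>)\<^sup>2 / (norm z)\<^sup>2)"
        using R by (intro mult_left_mono) auto
      also have "\<dots> \<le> \<bar>Re \<beta>\<bar> * (2 + 1/\<delta>)\<^sup>2 * ((1 + \<bar>Im s\<bar>) / (norm z)\<^sup>2)"
      proof -
        have "(2 + 1/\<delta>)\<^sup>2 * 1 \<le> (2 + 1/\<delta>)\<^sup>2 * (1 + \<bar>Im s\<bar>)" by (intro mult_left_mono) auto
        thus ?thesis using zp by (simp add: divide_right_mono mult_left_mono mult.assoc)
      qed
      finally have p1: "- Re \<beta> * R \<le> \<bar>Re \<beta>\<bar> * (2 + 1/\<delta>)\<^sup>2 * ((1 + \<bar>Im s\<bar>) / (norm z)\<^sup>2)" .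
      have "Im \<beta> * Im s \<le> \<bar>Im \<beta>\<bar> * \<bar>Im s\<bar>" using abs_ge_self[of "Im \<beta> * Im s"] by (simp add: abs_mult)
      also have "\<dots> \<le> \<bar>Im \<beta>\<bar> * (1 + \<bar>Im s\<bar>)" by (intro mult_left_mono) auto
      finally have "Im \<beta> * Im s \<le> \<bar>Im \<beta>\<bar> * (1 + \<bar>Im s\<bar>)" .
      hence p2: "Im \<beta> * (Im s / (norm z)\<^sup>2) \<le> \<bar>Im \<beta>\<bar> * ((1 + \<bar>Im s\<bar>) / (norm z)\<^sup>2)"
        using zp by (simp add: divide_right_mono)
      have p3: "(norm (\<beta> / z))\<^sup>2 / 2 \<le> (norm \<beta>)\<^sup>2 * ((1 + \<bar>Im s\<bar>) / (norm z)\<^sup>2)"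
      proof -
        have "(norm \<beta>)\<^sup>2 * 1 \<le> (norm \<beta>)\<^sup>2 * (1 + \<bar>Im s\<bar>)" by (intro mult_left_mono) auto
        hence "(norm \<beta>)\<^sup>2 / 2 \<le> (norm \<beta>)\<^sup>2 * (1 + \<bar>Im s\<bar>)"
          using zero_le_power2[of "norm \<beta>"] by linarith
        hence "(norm \<beta>)\<^sup>2 / 2 / (norm z)\<^sup>2 \<le> (norm \<beta>)\<^sup>2 * (1 + \<bar>Im s\<bar>) / (norm z)\<^sup>2"
          using zp by (intro divide_right_mono) auto
        thus ?thesis by (simp add: norm_divide power_divide mult.commute)
      qed
      have "norm (1 + \<beta> / z) \<le> exp (Re (\<beta> / z) + (norm (\<beta> / z))\<^sup>2 / 2)"
        by (rule norm_one_plus_le_exp)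
      also have "\<dots> \<le> exp (Re \<beta> * (f (Suc k) - f k) + D * ((1 + \<bar>Im s\<bar>) / (norm z)\<^sup>2))"
        unfolding exp_le_cancel_iff eq D_def distrib_right using p1 p2 p3 by linarith
      finally show ?thesis by (simp add: z_def)
    qed
    have bound: "norm (rGamma_series (s + \<beta>) N / rGamma_series s N) \<le>
       exp (D * C0) * norm s powr (- Re \<beta>) * (norm (s + of_nat (Suc N)) / N) powr (Re \<beta>)" if N: "N > 0" for N
    proof -
      have "pochhammer (s + \<beta>) (N+1) / pochhammer s (N+1) = (\<Prod>k<N+1. 1 + \<beta> / (s + of_nat k))"
      proof -
        have "pochhammer (s + \<beta>) (N+1) / pochhammer s (N+1) =
            (\<Prod>k<N+1. (s + \<beta> + of_nat k) / (s + of_nat k))"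
          unfolding pochhammer_prod atLeast0LessThan by (rule prod_dividef[symmetric])
        also have "\<dots> = (\<Prod>k<N+1. 1 + \<beta> / (s + of_nat k))"
          using snz by (intro prod.cong) (auto simp: field_simps)
        finally show ?thesis .
      qed
      hence "norm (pochhammer (s + \<beta>) (N+1) / pochhammer s (N+1)) = (\<Prod>k<N+1. norm (1 + \<beta> / (s + of_nat k)))"
        by (simp add: prod_norm)
      also have "\<dots> \<le> (\<Prod>k<N+1. exp (Re \<beta> * (f (Suc k) - f k) + D * ((1 + \<bar>Im s\<bar>) / (norm (s + of_nat k))\<^sup>2)))"
        by (intro prod_mono conjI step norm_ge_zero)
      also have "\<dots> = exp (Re \<beta> * (f (N+1) - f 0) + D * (\<Sum>k<N+1. (1 + \<bar>Im s\<bar>) / (norm (s + of_nat k))\<^sup>2))"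
        by (subst exp_sum[symmetric], simp,
            simp only: sum.distrib sum_distrib_left[symmetric] sum_lessThan_telescope)
      also have "\<dots> \<le> exp (Re \<beta> * (f (N+1) - f 0) + D * C0)"
        using C0(2)[OF s, of "N+1"] D by (simp add: mult_left_mono)
      also have "\<dots> = exp (D * C0) * norm s powr (- Re \<beta>) * norm (s + of_nat (Suc N)) powr (Re \<beta>)"
        using s0 snz[of "Suc N"] by (simp add: f_def powr_def exp_add exp_diff exp_minus right_diff_distrib field_simps)
      finally have a: "norm (pochhammer (s + \<beta>) (N+1) / pochhammer s (N+1)) \<le>
        exp (D * C0) * norm s powr (- Re \<beta>) * norm (s + of_nat (Suc N)) powr (Re \<beta>)" .
      have "rGamma_series (s + \<beta>) N / rGamma_series s N =
         pochhammer (s + \<beta>) (N+1) / pochhammer s (N+1) * exp (- \<beta> * of_real (ln (of_nat N)))"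
        by (simp add: rGamma_series_def exp_add distrib_right exp_minus field_simps)
      moreover have "norm (exp (- \<beta> * of_real (ln (of_nat N)))) = real N powr (- Re \<beta>)"
        using N by (simp add: powr_def)
      ultimately have "norm (rGamma_series (s + \<beta>) N / rGamma_series s N) =
         norm (pochhammer (s + \<beta>) (N+1) / pochhammer s (N+1)) * real N powr (- Re \<beta>)"
        by (simp only: norm_mult)
      also have "\<dots> \<le> exp (D * C0) * norm s powr (- Re \<beta>) * norm (s + of_nat (Suc N)) powr (Re \<beta>) * real N powr (- Re \<beta>)"
        using a by (intro mult_right_mono) auto
      also have "\<dots> = exp (D * C0) * norm s powr (- Re \<beta>) * (norm (s + of_nat (Suc N)) / N) powr (Re \<beta>)"
        using N by (simp add: powr_divide powr_minus_divide)
      finally show ?thesis .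
    qed
    have lim1: "(\<lambda>N. norm (rGamma_series (s + \<beta>) N / rGamma_series s N)) \<longlonglongrightarrow> norm (rGamma (s + \<beta>) / rGamma s)"
      using s_nonpos by (intro tendsto_intros) (auto simp: rGamma_eq_zero_iff)
    have lim2: "(\<lambda>N. norm (s + of_nat (Suc N)) / real N) \<longlonglongrightarrow> 1"
    proof -
      have "(\<lambda>N. (s + 1) * of_real (1 / real N) + 1) \<longlonglongrightarrow> (s + 1) * of_real 0 + 1"
        by (intro tendsto_intros lim_1_over_n)
      hence "(\<lambda>N. norm ((s + 1) * of_real (1 / real N) + 1)) \<longlonglongrightarrow> 1"
        using tendsto_norm by fastforce
      moreover have "eventually (\<lambda>N. norm ((s + 1) * of_real (1 / real N) + 1) = norm (s + of_nat (Suc N)) / real N) sequentially"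
        using eventually_gt_at_top[of 0]
      proof eventually_elim
        case (elim N)
        have "(s + 1) * of_real (1 / real N) + 1 = (s + of_nat (Suc N)) / of_nat N"
          using elim by (simp add: field_simps)
        thus ?case by (simp add: norm_divide)
      qed
      ultimately show ?thesis by (rule Lim_transform_eventually)
    qed
    have "norm (rGamma (s + \<beta>) / rGamma s) \<le> exp (D * C0) * norm s powr (- Re \<beta>) * 1 powr (Re \<beta>)"
    proof (rule tendsto_le[OF _ _ lim1])
      show "(\<lambda>N. exp (D * C0) * norm s powr (- Re \<beta>) * (norm (s + of_nat (Suc N)) / N) powr (Re \<beta>))
         \<longlonglongrightarrow> exp (D * C0) * norm s powr (- Re \<beta>) * 1 powr (Re \<beta>)"
        by (intro tendsto_intros lim2) auto
      show "eventually (\<lambda>N. norm (rGamma_series (s + \<beta>) N / rGamma_series s N) \<le>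
       exp (D * C0) * norm s powr (- Re \<beta>) * (norm (s + of_nat (Suc N)) / N) powr (Re \<beta>)) sequentially"
        using eventually_gt_at_top[of 0] by eventually_elim (rule bound)
    qed auto
    moreover have "Gamma s * rGamma (s + \<beta>) = rGamma (s + \<beta>) / rGamma s"
      by (simp add: rGamma_inverse_Gamma field_simps)
    ultimately show "norm (Gamma s * rGamma (s + \<beta>)) \<le> exp (D * C0) * norm s powr (- Re \<beta>)"
      by simp
  qed
qed

lemma powr_le_of_comparable:
  fixes x y D e :: real
  assumes "x > 0" "y > 0" "D \<ge> 1" "x \<le> D * y" "y \<le> D * x"
  shows "x powr e \<le> D powr \<bar>e\<bar> * y powr e"
proof (cases "e \<ge> 0")
  case True
  have "x powr e \<le> (D * y) powr e" using assms True by (intro powr_mono2) auto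
  thus ?thesis using assms True by (simp add: powr_mult)
next
  case False
  have "x powr e \<le> (y / D) powr e"
    using assms False by (intro powr_mono2') (auto simp: field_simps)
  also have "\<dots> = D powr \<bar>e\<bar> * y powr e"
    using assms False by (simp add: powr_divide powr_minus_divide)
  finally show ?thesis .
qed

text \<open>The exponent depends only on the difference of the sums of the parameters. This is how \<psi>
  enters.\<close>

lemma norm_Gamma_prod_ratio_le:
  fixes as bs :: "complex list"
  assumes "length as = length bs" and \<delta>: "\<delta> > 0"
  shows "\<exists>C\<ge>0. \<forall>s. (\<forall>x\<in>set as. \<forall>k::nat. \<delta> \<le> norm (s + x + of_nat k)) \<longrightarrow>
    norm ((\<Prod>x\<leftarrow>as. Gamma (s + x)) * (\<Prod>y\<leftarrow>bs. rGamma (s + y)))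
      \<le> C * (1 + norm s) powr (- Re (sum_list bs - sum_list as))"
  using assms(1)
proof (induction as bs rule: list_induct2)
  case Nil
  have "(1 + norm (s::complex)) powr 0 = 1" for s
    by (subst powr_zero_eq_one) (metis add_nonneg_eq_0_iff norm_ge_zero zero_le_one zero_neq_one)
  thus ?case by (intro exI[of _ 1]) auto
next
  case (Cons x as y bs)
  obtain C where C: "C \<ge> 0" "\<And>s. (\<And>x' k. x' \<in> set as \<Longrightarrow> \<delta> \<le> norm (s + x' + of_nat k)) \<Longrightarrow>
    norm ((\<Prod>x\<leftarrow>as. Gamma (s + x)) * (\<Prod>y\<leftarrow>bs. rGamma (s + y)))
      \<le> C * (1 + norm s) powr (- Re (sum_list bs - sum_list as))"
    using Cons.IH by blast
  obtain C1 where C1: "C1 \<ge> 0" "\<And>s. (\<And>k::nat. \<delta> \<le> norm (s + of_nat k)) \<Longrightarrow>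
       norm (Gamma s * rGamma (s + (y - x))) \<le> C1 * norm s powr (- Re (y - x))"
    using norm_Gamma_ratio_le[OF \<delta>] by metis
  define D where "D = 1 + (1 + norm x) * (1 + 1 / \<delta>)"
  define e where "e = - Re (y - x)"
  have D1: "D \<ge> 1" using \<delta> by (simp add: D_def)
  have "norm ((\<Prod>x\<leftarrow>x # as. Gamma (s + x)) * (\<Prod>y\<leftarrow>y # bs. rGamma (s + y)))
      \<le> C1 * D powr \<bar>e\<bar> * C * (1 + norm s) powr (- Re (sum_list (y # bs) - sum_list (x # as)))"
    if s: "\<forall>x'\<in>set (x # as). \<forall>k::nat. \<delta> \<le> norm (s + x' + of_nat k)" for s
  proof -
    have sx: "\<delta> \<le> norm (s + x)" using s[rule_format, of x 0] by simp
    have "norm (Gamma (s + x) * rGamma (s + x + (y - x))) \<le> C1 * norm (s + x) powr e"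
      unfolding e_def using s by (intro C1) auto
    also have "norm (s + x) powr e \<le> D powr \<bar>e\<bar> * (1 + norm s) powr e"
    proof (rule powr_le_of_comparable)
      show "norm (s + x) > 0" using sx \<delta> by linarith
      have "1 + norm s > 0" using norm_ge_zero[of s] by linarith
      thus "1 + norm s > 0" .
      have "norm (s + x) \<le> (1 + norm x) * (1 + norm s)"
      proof -
        have "(1 + norm x) * (1 + norm s) = 1 + norm s + norm x + norm x * norm s" by (simp add: algebra_simps)
        moreover have "norm x * norm s \<ge> 0" by simp
        ultimately show ?thesis using norm_triangle_ineq[of s x] by linarith
      qed
      also have "\<dots> \<le> D * (1 + norm s)"
        using \<delta> unfolding D_def by (intro mult_right_mono) (auto simp: algebra_simps)
      finally show "norm (s + x) \<le> D * (1 + norm s)" .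
      have "1 + norm s \<le> (1 + norm x) * 1 + norm (s + x)"
        using norm_triangle_ineq4[of "s + x" x] by simp
      also have "1 \<le> norm (s + x) / \<delta>" using sx \<delta> by simp
      hence "(1 + norm x) * 1 \<le> (1 + norm x) * (norm (s + x) / \<delta>)" by (intro mult_left_mono) auto
      also have "(1 + norm x) * (norm (s + x) / \<delta>) + norm (s + x) \<le> D * norm (s + x)"
      proof -
        have "D * norm (s + x) = (1 + norm x) * (norm (s + x) / \<delta>) + norm (s + x) + (1 + norm x) * norm (s + x)"
          by (simp add: D_def algebra_simps add_divide_distrib)
        thus ?thesis by simp
      qed
      finally show "1 + norm s \<le> D * norm (s + x)" by simp
    qed (rule D1)
    finally have 1: "norm (Gamma (s + x) * rGamma (s + y)) \<le> C1 * (D powr \<bar>e\<bar> * (1 + norm s) powr e)"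
      using C1(1) by (simp add: mult_left_mono)
    have 2: "norm ((\<Prod>x\<leftarrow>as. Gamma (s + x)) * (\<Prod>y\<leftarrow>bs. rGamma (s + y)))
      \<le> C * (1 + norm s) powr (- Re (sum_list bs - sum_list as))"
      using s by (intro C(2)) auto
    have "(\<Prod>x\<leftarrow>x # as. Gamma (s + x)) * (\<Prod>y\<leftarrow>y # bs. rGamma (s + y)) =
       (Gamma (s + x) * rGamma (s + y)) * ((\<Prod>x\<leftarrow>as. Gamma (s + x)) * (\<Prod>y\<leftarrow>bs. rGamma (s + y)))"
      by simp
    also have "norm \<dots> \<le> (C1 * (D powr \<bar>e\<bar> * (1 + norm s) powr e)) *
        (C * (1 + norm s) powr (- Re (sum_list bs - sum_list as)))"
      unfolding norm_mult[of "Gamma (s + x) * rGamma (s + y)"]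
      using 1 2 C1(1) by (intro mult_mono) auto
    also have "\<dots> = C1 * D powr \<bar>e\<bar> * C * (1 + norm s) powr (e + - Re (sum_list bs - sum_list as))"
      by (subst powr_add) (simp add: mult_ac)
    also have "e + - Re (sum_list bs - sum_list as) = - Re (sum_list (y # bs) - sum_list (x # as))"
      by (simp add: e_def)
    finally show ?thesis .
  qed
  thus ?case using C(1) C1(1) by (intro exI[of _ "C1 * D powr \<bar>e\<bar> * C"]) auto
qed

section \<open>Mellin transforms of contour integrals\<close>

lemma powr_unit_interval_real:
  fixes x :: real
  assumes "x > 0"
  shows "set_integrable lborel {0<..<1} (\<lambda>t. t powr (x - 1))"
    and "(LINT t:{0<..<1}|lborel. t powr (x - 1)) = 1 / x"
proof -
  have "((\<lambda>t. t powr (x - 1)) has_integral 1 / x) {0..1}"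
    using has_integral_powr_from_0[of "x - 1" 1] assms by simp
  hence hi: "((\<lambda>t. t powr (x - 1)) has_integral 1 / x) {0<..<1}"
    by (simp add: has_integral_Icc_iff_Ioo)
  hence "(\<lambda>t. t powr (x - 1)) absolutely_integrable_on {0<..<1}"
    by (subst absolutely_integrable_on_iff_nonneg) auto
  thus *: "set_integrable lborel {0<..<1} (\<lambda>t. t powr (x - 1))"
    unfolding set_integrable_def by (subst (asm) integrable_completion) auto
  show "(LINT t:{0<..<1}|lborel. t powr (x - 1)) = 1 / x"
    using set_borel_integral_eq_integral(2)[OF *] hi by (simp add: integral_unique)
qed

lemma powr_unit_interval_complex:
  fixes z :: complex
  assumes "Re z > 0"
  shows "set_integrable lborel {0<..<1} (\<lambda>t. of_real t powr (z - 1))"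
    and "(LINT t:{0<..<1}|lborel. of_real t powr (z - 1)) = 1 / z"
proof -
  have meas: "(\<lambda>t. indicator {0<..<1} t *\<^sub>R (of_real t powr (z - 1) :: complex)) \<in> borel_measurable lborel"
    by (subst measurable_cong_sets[OF sets_lborel refl],
        rule borel_measurable_continuous_on_indicator) (auto intro!: continuous_intros)
  show *: "set_integrable lborel {0<..<1} (\<lambda>t. of_real t powr (z - 1))"
    unfolding set_integrable_def
  proof (rule Bochner_Integration.integrable_bound[OF powr_unit_interval_real(1)[OF assms, unfolded set_integrable_def] meas])
    show "AE x in lborel. norm (indicator {0<..<1} x *\<^sub>R (complex_of_real x powr (z - 1)))
          \<le> norm (indicator {0<..<1} x *\<^sub>R x powr (Re z - 1))"
      by (auto simp: norm_powr_real_powr indicator_def)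
  qed
  have "((\<lambda>t. of_real t powr (z - 1)) has_integral (of_real 1 powr z / z - of_real 0 powr z / z)) {0..1}"
  proof (rule fundamental_theorem_of_calculus_interior)
    show "continuous_on {0..1} (\<lambda>t. complex_of_real t powr z / z)"
      using assms by (intro continuous_intros continuous_on_powr_complex) auto
    show "((\<lambda>t. complex_of_real t powr z / z) has_vector_derivative complex_of_real x powr (z - 1)) (at x)"
      if "x \<in> {0<..<1}" for x
      using that assms
      by (auto intro!: derivative_eq_intros has_vector_derivative_real_field)
  qed auto
  hence "((\<lambda>t. of_real t powr (z - 1)) has_integral 1 / z) {0..1}" by simp
  hence "((\<lambda>t. complex_of_real t powr (z - 1)) has_integral 1 / z) {0<..<1}"
    by (simp add: has_integral_Icc_iff_Ioo)
  thus "(LINT t:{0<..<1}|lborel. of_real t powr (z - 1)) = 1 / z"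
    using set_borel_integral_eq_integral(2)[OF *] by (simp add: integral_unique)
qed

lemma contour_integral_linepath_lborel:
  fixes f :: "complex \<Rightarrow> complex"
  assumes "continuous_on (closed_segment c d) f"
  shows "contour_integral (linepath c d) f = (LINT u:{0..1}|lborel. f (linepath c d u) * (d - c))"
proof -
  have cont: "continuous_on {0..1} (\<lambda>u. f (linepath c d u) * (d - c))"
    by (intro continuous_intros continuous_on_compose2[OF assms])
       (auto simp: linepath_in_path continuous_on_linepath)
  have "contour_integral (linepath c d) f = integral {0..1} (\<lambda>u. f (linepath c d u) * (d - c))"
    unfolding contour_integral_integral by (simp only: vector_derivative_linepath_at)
  also have "\<dots> = (LINT u:{0..1}|lborel. f (linepath c d u) * (d - c))"
    by (rule set_borel_integral_eq_integral(2)[OF borel_integrable_atLeastAtMost'[OF cont], symmetric])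
  finally show ?thesis .
qed

text \<open>Fubini's theorem. The inner integral over t converges absolutely, to 1 / (q + 1 - s), because the
  segment lies in the half plane Re s < q + 1.\<close>

lemma mellin_linepath:
  fixes f :: "complex \<Rightarrow> complex" and q :: nat
  assumes f: "continuous_on (closed_segment c d) f"
    and Re: "\<And>s. s \<in> closed_segment c d \<Longrightarrow> Re s < real q + 1"
  shows "set_integrable lborel {0<..<1}
           (\<lambda>t. contour_integral (linepath c d) (\<lambda>s. f s * of_real t powr (- s)) * of_real t ^ q)"
    and "(LINT t:{0<..<1}|lborel.
            contour_integral (linepath c d) (\<lambda>s. f s * of_real t powr (- s)) * of_real t ^ q) =
         contour_integral (linepath c d) (\<lambda>s. f s / (of_nat q + 1 - s))"
proof -
  define l where "l = linepath c d"
  have l_seg: "l u \<in> closed_segment c d" if "u \<in> {0..1}" for u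
    using that by (auto simp: l_def linepath_in_path)
  have cl: "continuous_on A l" for A unfolding l_def by (rule continuous_on_linepath)
  have cfl: "continuous_on {0..1} (\<lambda>u. f (l u))"
    by (intro continuous_on_compose2[OF f cl]) (auto intro: l_seg)
  define h where "h u = indicator {0..1} u *\<^sub>R (f (l u) * (d - c))" for u :: real
  define g where "g u t = h u *
       (indicator {0<..<1} t *\<^sub>R exp ((of_nat q - l u) * of_real (ln t)))" for u t :: real
  have g_eq: "g u t = indicator {0..1} u *\<^sub>R (f (l u) * (d - c)) *
       (indicator {0<..<1} t *\<^sub>R of_real t powr ((of_nat q + 1 - l u) - 1))" for u t
    by (auto simp: g_def h_def indicator_def powr_def Ln_of_real)
  have [measurable]: "h \<in> borel_measurable borel"
    unfolding h_def by (intro borel_measurable_continuous_on_indicator continuous_intros cfl) auto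
  have [measurable]: "l \<in> borel_measurable borel"
    by (intro borel_measurable_continuous_onI cl)
  have meas: "case_prod g \<in> borel_measurable (lborel \<Otimes>\<^sub>M lborel)"
    unfolding g_def by measurable
  have Re': "Re (of_nat q + 1 - l u) > 0" if "u \<in> {0..1}" for u
    using Re[OF l_seg[OF that]] by simp
  have int_t: "integrable lborel (\<lambda>t. g u t)" for u
  proof (cases "u \<in> {0..1}")
    case True
    have "(\<lambda>t. g u t) = (\<lambda>t. (f (l u) * (d - c)) *
        (indicator {0<..<1} t *\<^sub>R of_real t powr ((of_nat q + 1 - l u) - 1)))"
      unfolding g_eq using True by simp
    thus ?thesis
      using powr_unit_interval_complex(1)[OF Re'[OF True], unfolded set_integrable_def]
      by (simp only: integrable_mult_right)
  qed (auto simp: g_def h_def)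
  have int_tval: "(\<integral>t. g u t \<partial>lborel) = indicator {0..1} u *\<^sub>R (f (l u) / (of_nat q + 1 - l u) * (d - c))" for u
  proof (cases "u \<in> {0..1}")
    case True
    have "(\<lambda>t. g u t) = (\<lambda>t. (f (l u) * (d - c)) *
        (indicator {0<..<1} t *\<^sub>R of_real t powr ((of_nat q + 1 - l u) - 1)))"
      unfolding g_eq using True by simp
    hence "(\<integral>t. g u t \<partial>lborel) = (f (l u) * (d - c)) * (1 / (of_nat q + 1 - l u))"
      using powr_unit_interval_complex(2)[OF Re'[OF True], unfolded set_lebesgue_integral_def]
      by (simp only: integral_mult_right_zero)
    thus ?thesis using True by simp
  qed (auto simp: g_def h_def)
  have norm_t: "(\<integral>t. norm (g u t) \<partial>lborel) =
      indicator {0..1} u *\<^sub>R (norm (f (l u) * (d - c)) / (real q + 1 - Re (l u)))" for u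
  proof (cases "u \<in> {0..1}")
    case True
    have "(\<integral>t. norm (g u t) \<partial>lborel) =
      (\<integral>t. norm (f (l u) * (d - c)) * (indicator {0<..<1} t *\<^sub>R t powr (Re (of_nat q + 1 - l u) - 1)) \<partial>lborel)"
      unfolding g_eq using True
      by (intro Bochner_Integration.integral_cong) (auto simp: indicator_def norm_mult norm_powr_real_powr)
    also have "\<dots> = norm (f (l u) * (d - c)) * (1 / (Re (of_nat q + 1 - l u)))"
      using powr_unit_interval_real(2)[OF Re'[OF True]]
      by (simp add: set_lebesgue_integral_def)
    finally show ?thesis using True by simp
  qed (auto simp: g_def h_def)
  have integ: "integrable (lborel \<Otimes>\<^sub>M lborel) (case_prod g)"
  proof (rule lborel_pair.Fubini_integrable[OF meas])
    have "continuous_on {0..1} (\<lambda>u. norm (f (l u) * (d - c)) / (real q + 1 - Re (l u)))"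
      using Re' by (intro continuous_intros cfl cl) fastforce
    thus "integrable lborel (\<lambda>u. \<integral>t. norm (case (u, t) of (u, t) \<Rightarrow> g u t) \<partial>lborel)"
      using borel_integrable_atLeastAtMost' unfolding case_prod_conv norm_t set_integrable_def by blast
    show "AE u in lborel. integrable lborel (\<lambda>t. case (u, t) of (u, t) \<Rightarrow> g u t)"
      using int_t by simp
  qed
  have inner: "(\<integral>u. g u t \<partial>lborel) =
     indicator {0<..<1} t *\<^sub>R (contour_integral l (\<lambda>s. f s * of_real t powr (- s)) * of_real t ^ q)" for t
  proof (cases "t \<in> {0<..<1}")
    case True
    have "continuous_on (closed_segment c d) (\<lambda>s. f s * of_real t powr (- s))"
      using True by (intro continuous_intros f) auto
    hence "contour_integral l (\<lambda>s. f s * of_real t powr (- s)) * of_real t ^ q =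
       (LINT u:{0..1}|lborel. f (l u) * of_real t powr (- l u) * (d - c)) * of_real t ^ q"
      unfolding l_def by (subst contour_integral_linepath_lborel) auto
    also have "\<dots> = (\<integral>u. (indicator {0..1} u *\<^sub>R (f (l u) * of_real t powr (- l u) * (d - c))) * of_real t ^ q \<partial>lborel)"
      unfolding set_lebesgue_integral_def by (rule integral_mult_left_zero[symmetric])
    also have "\<dots> = (\<integral>u. g u t \<partial>lborel)"
    proof (intro Bochner_Integration.integral_cong refl)
      fix u
      have "of_real t powr (of_nat q - l u) = of_real t ^ q * (of_real t powr (- l u) :: complex)"
        using True by (simp add: powr_diff powr_nat powr_minus divide_inverse)
      thus "indicator {0..1} u *\<^sub>R (f (l u) * of_real t powr (- l u) * (d - c)) * of_real t ^ q = g u t"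
        using True unfolding g_eq by (auto simp: indicator_def)
    qed
    finally show ?thesis using True by simp
  qed (auto simp: g_def h_def)
  have "integrable lborel (\<lambda>t. \<integral>u. g u t \<partial>lborel)"
    using lborel_pair.integrable_snd[OF integ] .
  thus "set_integrable lborel {0<..<1}
           (\<lambda>t. contour_integral (linepath c d) (\<lambda>s. f s * of_real t powr (- s)) * of_real t ^ q)"
    unfolding inner set_integrable_def l_def .
  have "(\<integral>t. (\<integral>u. g u t \<partial>lborel) \<partial>lborel) = (\<integral>u. (\<integral>t. g u t \<partial>lborel) \<partial>lborel)"
    by (rule lborel_pair.Fubini_integral[OF integ])
  also have "\<dots> = (LINT u:{0..1}|lborel. f (l u) / (of_nat q + 1 - l u) * (d - c))"
    unfolding int_tval set_lebesgue_integral_def ..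
  also have "\<dots> = contour_integral l (\<lambda>s. f s / (of_nat q + 1 - s))"
  proof -
    have "continuous_on (closed_segment c d) (\<lambda>s. f s / (of_nat q + 1 - s))"
      using Re by (intro continuous_intros f) fastforce
    thus ?thesis unfolding l_def by (subst contour_integral_linepath_lborel) auto
  qed
  finally show "(LINT t:{0<..<1}|lborel.
            contour_integral (linepath c d) (\<lambda>s. f s * of_real t powr (- s)) * of_real t ^ q) =
         contour_integral (linepath c d) (\<lambda>s. f s / (of_nat q + 1 - s))"
    unfolding inner set_lebesgue_integral_def l_def .
qed

lemma contour_integral_rectpath_split:
  assumes "continuous_on (path_image (rectpath a b)) f"
  defines "a' \<equiv> Complex (Re b) (Im a)" and "b' \<equiv> Complex (Re a) (Im b)"
  shows "contour_integral (rectpath a b) f =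
    contour_integral (linepath a a') f + contour_integral (linepath a' b) f +
    contour_integral (linepath b b') f + contour_integral (linepath b' a) f"
    and "f contour_integrable_on linepath a a'" "f contour_integrable_on linepath a' b"
        "f contour_integrable_on linepath b b'" "f contour_integrable_on linepath b' a"
proof -
  have img: "path_image (rectpath a b) =
     closed_segment a a' \<union> closed_segment a' b \<union> closed_segment b b' \<union> closed_segment b' a"
    by (simp add: rectpath_def Let_def path_image_join Un_assoc a'_def b'_def)
  show *: "f contour_integrable_on linepath a a'" "f contour_integrable_on linepath a' b"
        "f contour_integrable_on linepath b b'" "f contour_integrable_on linepath b' a"
    using assms(1) unfolding img
    by (auto intro!: contour_integrable_continuous_linepath elim: continuous_on_subset)
  have "rectpath a b = linepath a a' +++ linepath a' b +++ linepath b b' +++ linepath b' a"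
    by (simp add: rectpath_def Let_def a'_def b'_def)
  thus "contour_integral (rectpath a b) f =
    contour_integral (linepath a a') f + contour_integral (linepath a' b) f +
    contour_integral (linepath b b') f + contour_integral (linepath b' a) f"
    using * by (simp add: valid_path_join contour_integrable_join)
qed

lemma norm_contour_integral_rectpath_le:
  assumes f: "continuous_on (path_image (rectpath (Complex x1 y1) (Complex x2 y2))) f"
    and B: "\<And>s. s \<in> path_image (rectpath (Complex x1 y1) (Complex x2 y2)) \<Longrightarrow> norm (f s) \<le> B"
    and le': "x1 \<le> x2" "y1 \<le> y2"
  shows "norm (contour_integral (rectpath (Complex x1 y1) (Complex x2 y2)) f) \<le>
           B * (2 * (x2 - x1) + 2 * (y2 - y1))"
proof -
  define a where "a = Complex x1 y1"
  define b where "b = Complex x2 y2"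
  note f = f[folded a_def b_def] and B = B[folded a_def b_def]
  have le: "Re a \<le> Re b" "Im a \<le> Im b" using le' by (simp_all add: a_def b_def)
  define a' where "a' = Complex (Re b) (Im a)"
  define b' where "b' = Complex (Re a) (Im b)"
  note split = contour_integral_rectpath_split[OF f, folded a'_def b'_def]
  have img: "path_image (rectpath a b) =
     closed_segment a a' \<union> closed_segment a' b \<union> closed_segment b b' \<union> closed_segment b' a"
    by (simp add: rectpath_def Let_def path_image_join Un_assoc a'_def b'_def)
  have "norm (f a) \<le> B"
    using B[of a] pathstart_in_path_image[of "rectpath a b"] by simp
  hence B0: "B \<ge> 0" using norm_ge_zero order_trans by blast
  have 1: "norm (contour_integral (linepath a a') f) \<le> B * norm (a' - a)"
    and 2: "norm (contour_integral (linepath a' b) f) \<le> B * norm (b - a')"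
    and 3: "norm (contour_integral (linepath b b') f) \<le> B * norm (b' - b)"
    and 4: "norm (contour_integral (linepath b' a) f) \<le> B * norm (a - b')"
    using B img by (intro contour_integral_bound_linepath split B0; fastforce)+
  have d: "a' - a = of_real (Re b - Re a)" "b - a' = \<i> * of_real (Im b - Im a)"
    "b' - b = - of_real (Re b - Re a)" "a - b' = - (\<i> * of_real (Im b - Im a))"
    by (auto simp: a'_def b'_def complex_eq_iff)
  have e: "norm (a' - a) = Re b - Re a" "norm (b - a') = Im b - Im a"
    "norm (b' - b) = Re b - Re a" "norm (a - b') = Im b - Im a"
    using le unfolding d norm_minus_cancel norm_mult norm_of_real by auto
  have "norm (contour_integral (rectpath a b) f) \<le>
     norm (contour_integral (linepath a a') f) + norm (contour_integral (linepath a' b) f) +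
     norm (contour_integral (linepath b b') f) + norm (contour_integral (linepath b' a) f)"
    unfolding split(1) by (intro norm_triangle_le add_mono norm_triangle_ineq order.refl)
  also have "\<dots> \<le> B * (Re b - Re a) + B * (Im b - Im a) + B * (Re b - Re a) + B * (Im b - Im a)"
    using 1 2 3 4 unfolding e by linarith
  finally have "norm (contour_integral (rectpath a b) f) \<le>
      B * (2 * (Re b - Re a) + 2 * (Im b - Im a))" by (simp add: algebra_simps)
  thus ?thesis by (simp add: a_def b_def)
qed

text \<open>So integrating t^q against a sum of residues of f(s) t^(-s) gives the sum of the residues of
  f(s) / (q + 1 - s) at the same points.\<close>

lemma mellin_rectpath:
  fixes f :: "complex \<Rightarrow> complex" and q :: nat
  assumes f: "continuous_on (path_image (rectpath a b)) f"
    and Re: "\<And>s. s \<in> path_image (rectpath a b) \<Longrightarrow> Re s < real q + 1"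
  shows "set_integrable lborel {0<..<1}
           (\<lambda>t. contour_integral (rectpath a b) (\<lambda>s. f s * of_real t powr (- s)) * of_real t ^ q)" (is ?I)
    and "(LINT t:{0<..<1}|lborel.
            contour_integral (rectpath a b) (\<lambda>s. f s * of_real t powr (- s)) * of_real t ^ q) =
         contour_integral (rectpath a b) (\<lambda>s. f s / (of_nat q + 1 - s))" (is ?E)
proof -
  define a' where "a' = Complex (Re b) (Im a)"
  define b' where "b' = Complex (Re a) (Im b)"
  have img: "path_image (rectpath a b) =
     closed_segment a a' \<union> closed_segment a' b \<union> closed_segment b b' \<union> closed_segment b' a"
    by (simp add: rectpath_def Let_def path_image_join Un_assoc a'_def b'_def)
  define L where "L c d t = contour_integral (linepath c d) (\<lambda>s. f s * of_real t powr (- s)) * of_real t ^ q"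
    for c d and t :: real
  have sub: "closed_segment a a' \<subseteq> path_image (rectpath a b)" "closed_segment a' b \<subseteq> path_image (rectpath a b)"
    "closed_segment b b' \<subseteq> path_image (rectpath a b)" "closed_segment b' a \<subseteq> path_image (rectpath a b)"
    using img by auto
  have int: "set_integrable lborel {0<..<1} (L c d)"
    and val: "(LINT t:{0<..<1}|lborel. L c d t) = contour_integral (linepath c d) (\<lambda>s. f s / (of_nat q + 1 - s))"
    if "closed_segment c d \<subseteq> path_image (rectpath a b)" for c d
    unfolding L_def using that Re
    by (intro mellin_linepath continuous_on_subset[OF f]; blast)+
  have eq: "contour_integral (rectpath a b) (\<lambda>s. f s * of_real t powr (- s)) * of_real t ^ q =
      L a a' t + L a' b t + L b b' t + L b' a t" if "t \<in> {0<..<1}" for t :: real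
  proof -
    have "continuous_on (path_image (rectpath a b)) (\<lambda>s. f s * of_real t powr (- s))"
      using that by (intro continuous_intros f) auto
    from contour_integral_rectpath_split(1)[OF this, folded a'_def b'_def]
    show ?thesis by (simp add: L_def distrib_right)
  qed
  note ints = sub[THEN int]
  have "set_integrable lborel {0<..<1} (\<lambda>t. L a a' t + L a' b t + L b b' t + L b' a t)"
    by (intro set_integral_add ints)
  thus ?I
    by (rule set_integrable_cong[THEN iffD1, rotated -1]) (auto simp: eq)
  have "(LINT t:{0<..<1}|lborel.
            contour_integral (rectpath a b) (\<lambda>s. f s * of_real t powr (- s)) * of_real t ^ q) =
     (LINT t:{0<..<1}|lborel. L a a' t + L a' b t + L b b' t + L b' a t)"
    by (intro set_lebesgue_integral_cong) (auto simp: eq)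
  also have "\<dots> = (LINT t:{0<..<1}|lborel. L a a' t) + (LINT t:{0<..<1}|lborel. L a' b t) +
     (LINT t:{0<..<1}|lborel. L b b' t) + (LINT t:{0<..<1}|lborel. L b' a t)"
    using ints by (simp add: set_integral_add)
  also have "\<dots> = contour_integral (rectpath a b) (\<lambda>s. f s / (of_nat q + 1 - s))"
  proof -
    have "continuous_on (path_image (rectpath a b)) (\<lambda>s. f s / (of_nat q + 1 - s))"
      using Re by (intro continuous_intros f) fastforce
    from contour_integral_rectpath_split(1)[OF this, folded a'_def b'_def]
    show ?thesis by (simp add: sub[THEN val])
  qed
  finally show ?E .
qed

lemma contour_integral_rectpath_residues:
  fixes G :: "complex \<Rightarrow> complex"
  assumes "open S" "convex S" "cbox a b \<subseteq> S" and lt: "Re a < Re b" "Im a < Im b"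
    and "finite X" and G: "G holomorphic_on S - X" and X: "X \<inter> path_image (rectpath a b) = {}"
  shows "contour_integral (rectpath a b) G = 2 * of_real pi * \<i> * (\<Sum>p\<in>X \<inter> box a b. residue G p)"
proof -
  have img: "path_image (rectpath a b) = cbox a b - box a b"
    using lt by (simp add: path_image_rectpath_cbox_minus_box)
  have "contour_integral (rectpath a b) G =
     complex_of_real (2 * pi) * \<i> * (\<Sum>p\<in>X. winding_number (rectpath a b) p * residue G p)"
  proof (rule Residue_theorem)
    show "path_image (rectpath a b) \<subseteq> S - X"
      using X img assms(3) by auto
    show "\<forall>z. z \<notin> S \<longrightarrow> winding_number (rectpath a b) z = 0"
      using assms(3) lt by (auto intro!: winding_number_rectpath_outside)
  qed (use assms convex_connected in auto)
  also have "(\<Sum>p\<in>X. winding_number (rectpath a b) p * residue G p) =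
      (\<Sum>p\<in>X. if p \<in> box a b then residue G p else 0)"
  proof (intro sum.cong refl)
    fix p assume p: "p \<in> X"
    show "winding_number (rectpath a b) p * residue G p = (if p \<in> box a b then residue G p else 0)"
    proof (cases "p \<in> box a b")
      case True
      thus ?thesis by (simp add: winding_number_rectpath)
    next
      case False
      hence "p \<notin> cbox a b" using X p img by auto
      thus ?thesis using False lt by (simp add: winding_number_rectpath_outside)
    qed
  qed
  also have "\<dots> = (\<Sum>p\<in>X \<inter> box a b. residue G p)"
    using assms by (simp add: sum.inter_restrict)
  finally show ?thesis by simp
qed

section \<open>Meromorphic functions with descending chains of poles\<close>

lemma closed_if_locally_finite:
  fixes S :: "complex set"
  assumes "\<And>r. finite (S \<inter> cball 0 r)"
  shows "closed S"
  unfolding closed_def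
proof (subst open_subopen, intro ballI)
  fix s assume s: "s \<in> - S"
  define X where "X = S \<inter> cball 0 (norm s + 1)"
  have "open (ball s 1 - X)"
    by (intro open_Diff finite_imp_closed) (auto simp: X_def intro: assms)
  moreover have "s \<in> ball s 1 - X" using s by (auto simp: X_def)
  moreover have "ball s 1 - X \<subseteq> - S"
  proof
    fix w assume w: "w \<in> ball s 1 - X"
    have "norm w \<le> norm s + norm (w - s)" using norm_triangle_ineq[of s "w - s"] by simp
    also have "norm (w - s) < 1" using w by (simp add: dist_norm norm_minus_commute)
    finally show "w \<in> - S" using w by (auto simp: X_def)
  qed
  ultimately show "\<exists>T. open T \<and> s \<in> T \<and> T \<subseteq> - S" by blast
qed

text \<open>The shape of the set of poles of a product of Gamma functions.\<close>

definition descending :: "complex set \<Rightarrow> complex set" where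
  "descending A = {x - of_nat l | x l. x \<in> A}"

text \<open>The hypotheses under which a left loop integral of F(s) t^(-s) is, up to the factor
  2 pi i and the residues at B, an integrable function on (0,1) whose moments are values of F. The poles form finitely many chains
  descending from A, together with a finite set B; away from them F decays at least like |s|^(-\<rho>),
  where \<rho> > 0 may be smaller than 1. The abscissa \<open>x0\<close> and the height \<open>T\<close> serve to cut the plane
  into strips: all poles lie to the left of \<open>x0\<close> and at heights below \<open>T\<close>, and none of them lies on
  a line Re s = x0 - k.\<close>

locale decaying_meromorphic =
  fixes F :: "complex \<Rightarrow> complex" and A B :: "complex set" and \<rho> x0 T :: real
  assumes finA: "finite A" and finB: "finite B"
    and hol: "F holomorphic_on - (descending A \<union> B)"
    and decay: "\<And>\<delta>. \<delta> > 0 \<Longrightarrow> \<exists>C. \<forall>s. (\<forall>p\<in>descending A \<union> B. \<delta> \<le> dist s p) \<longrightarrow>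
                  norm (F s) \<le> C * (1 + norm s) powr (- \<rho>)"
    and rho_pos: "\<rho> > 0" and x0: "0 < x0" "x0 < 1" and T_pos: "T > 0"
    and Im_poles: "\<And>p. p \<in> A \<union> B \<Longrightarrow> \<bar>Im p\<bar> < T"
    and Re_poles: "\<And>p. p \<in> A \<union> B \<Longrightarrow> Re p < x0"
    and off_lines: "\<And>p. p \<in> A \<union> B \<Longrightarrow> Re p - x0 \<notin> \<int>"
begin

definition poles where "poles = descending A \<union> B"

lemma pole_base:
  assumes "p \<in> poles"
  obtains x l where "x \<in> A \<union> B" "p = x - of_nat l"
proof (cases "p \<in> B")
  case True
  thus ?thesis using that[of p 0] by simp
next
  case False
  then obtain x l where "x \<in> A" "p = x - of_nat l"
    using assms unfolding poles_def descending_def by blast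
  thus ?thesis using that[of x l] by simp
qed

lemma Im_less_T: "p \<in> poles \<Longrightarrow> \<bar>Im p\<bar> < T"
proof -
  assume "p \<in> poles"
  then obtain x l where "x \<in> A \<union> B" "p = x - of_nat l" by (rule pole_base)
  thus ?thesis using Im_poles[of x] by simp
qed

lemma Re_less_x0: "p \<in> poles \<Longrightarrow> Re p < x0"
proof -
  assume "p \<in> poles"
  then obtain x l where x: "x \<in> A \<union> B" "p = x - of_nat l" by (rule pole_base)
  have "Re p \<le> Re x" using x by simp
  thus ?thesis using Re_poles[OF x(1)] by linarith
qed

lemma Re_off_lines:
  assumes "p \<in> poles"
  shows "Re p - x0 \<notin> \<int>"
proof
  obtain x l where x: "x \<in> A \<union> B" "p = x - of_nat l" using assms by (rule pole_base)
  assume "Re p - x0 \<in> \<int>"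
  hence "Re p - x0 + of_nat l \<in> \<int>" by (intro Ints_add) auto
  moreover have "Re p - x0 + of_nat l = Re x - x0" using x(2) by simp
  ultimately show False using off_lines[OF x(1)] by simp
qed

lemma finite_poles_right: "finite {p \<in> poles. x < Re p}"
proof -
  have "{p \<in> poles. x < Re p} \<subseteq> (\<lambda>(a, l). a - of_nat l) ` ((A \<union> B) \<times> {..nat \<lceil>x0 - x\<rceil>})"
  proof
    fix p assume "p \<in> {p \<in> poles. x < Re p}"
    hence p: "p \<in> poles" "x < Re p" by auto
    obtain a l where a: "a \<in> A \<union> B" "p = a - of_nat l" using p(1) by (rule pole_base)
    have "real l \<le> x0 - x" using Re_poles[OF a(1)] p(2) a(2) by simp
    hence "l \<le> nat \<lceil>x0 - x\<rceil>" by linarith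
    thus "p \<in> (\<lambda>(a, l). a - of_nat l) ` ((A \<union> B) \<times> {..nat \<lceil>x0 - x\<rceil>})"
      using a by force
  qed
  thus ?thesis by (rule finite_subset) (use finA finB in auto)
qed

lemma open_non_poles: "open (- poles)"
proof -
  have "finite (poles \<inter> cball 0 r)" for r
  proof (rule finite_subset[OF _ finite_poles_right[of "- r - 1"]])
    have "- r - 1 < Re p" if "p \<in> cball 0 r" for p
      using abs_Re_le_cmod[of p] that by auto
    thus "poles \<inter> cball 0 r \<subseteq> {p \<in> poles. - r - 1 < Re p}" by blast
  qed
  thus ?thesis by (intro open_Compl closed_if_locally_finite)
qed

lemma hol': "F holomorphic_on - poles"
  using hol by (simp add: poles_def)

text \<open>The contours on which F is estimated run in this set, which keeps a positive distance from the
  poles.\<close>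

definition grid where "grid = {s. Re s - x0 \<in> \<int> \<or> T \<le> \<bar>Im s\<bar>}"

lemma grid_disjoint_poles: "s \<in> grid \<Longrightarrow> s \<notin> poles"
  using Im_less_T[of s] Re_off_lines[of s] by (auto simp: grid_def)

text \<open>Translation by integers changes neither the distance to the vertical lines nor the heights, so
  the finitely many base points of the chains decide.\<close>

lemma grid_clearance: "\<exists>\<delta>>0. \<forall>s\<in>grid. \<forall>p\<in>poles. \<delta> \<le> dist s p"
proof -
  define h where "h p = min (T - \<bar>Im p\<bar>) (infdist (Re p - x0) \<int>)" for p
  have h: "h p > 0" if "p \<in> A \<union> B" for p
  proof -
    have "infdist (Re p - x0) \<int> \<noteq> 0"
    proof -
      have "(\<int> :: real set) \<noteq> {}" using Ints_0 by blast
      thus ?thesis using off_lines[OF that] in_closed_iff_infdist_zero[OF closed_Ints] by blast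
    qed
    thus ?thesis using Im_poles[OF that] infdist_nonneg[of "Re p - x0" \<int>] by (auto simp: h_def)
  qed
  define \<delta> where "\<delta> = Min (insert 1 (h ` (A \<union> B)))"
  have fin: "finite (insert 1 (h ` (A \<union> B)))" using finA finB by simp
  have "\<delta> > 0" unfolding \<delta>_def using fin h by (subst Min_gr_iff) auto
  moreover have "\<delta> \<le> dist s p" if s: "s \<in> grid" and p: "p \<in> poles" for s p
  proof -
    obtain x l where x: "x \<in> A \<union> B" "p = x - of_nat l" using p by (rule pole_base)
    have "\<delta> \<le> h x" unfolding \<delta>_def using fin x(1) by (intro Min_le) auto
    also have "h x \<le> dist s p"
    proof (cases "T \<le> \<bar>Im s\<bar>")
      case True
      have "h x \<le> T - \<bar>Im p\<bar>" by (simp add: h_def x)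
      also have "\<dots> \<le> \<bar>Im (s - p)\<bar>" using True by simp
      also have "\<dots> \<le> norm (s - p)" by (rule abs_Im_le_cmod)
      finally show ?thesis by (simp add: dist_norm)
    next
      case False
      hence "Re s - x0 \<in> \<int>" using s by (auto simp: grid_def)
      hence "Re s - x0 + of_nat l \<in> \<int>" by (intro Ints_add) auto
      hence "infdist (Re x - x0) \<int> \<le> dist (Re x - x0) (Re s - x0 + of_nat l)"
        by (rule infdist_le)
      also have "\<dots> = \<bar>Re (s - p)\<bar>" by (simp add: x(2) dist_real_def)
      also have "\<dots> \<le> norm (s - p)" by (rule abs_Re_le_cmod)
      finally show ?thesis by (simp add: dist_norm h_def)
    qed
    finally show ?thesis .
  qed
  ultimately show ?thesis by blast
qed

lemma grid_bound: "\<exists>C\<ge>0. \<forall>s\<in>grid. norm (F s) \<le> C * (1 + norm s) powr (- \<rho>)"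
proof -
  obtain \<delta> where \<delta>: "\<delta> > 0" "\<forall>s\<in>grid. \<forall>p\<in>poles. \<delta> \<le> dist s p" using grid_clearance by blast
  obtain C where C: "\<forall>s. (\<forall>p\<in>poles. \<delta> \<le> dist s p) \<longrightarrow> norm (F s) \<le> C * (1 + norm s) powr (- \<rho>)"
    using decay[OF \<delta>(1)] unfolding poles_def by blast
  have "norm (F s) \<le> \<bar>C\<bar> * (1 + norm s) powr (- \<rho>)" if "s \<in> grid" for s
  proof -
    have "norm (F s) \<le> C * (1 + norm s) powr (- \<rho>)" using C \<delta>(2) that by blast
    also have "\<dots> \<le> \<bar>C\<bar> * (1 + norm s) powr (- \<rho>)" by (intro mult_right_mono) auto
    finally show ?thesis .
  qed
  thus ?thesis by (intro exI[of _ "\<bar>C\<bar>"]) auto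
qed

definition strip_poles :: "nat \<Rightarrow> complex set" where
  "strip_poles k = {p \<in> poles. x0 - real (Suc k) < Re p \<and> Re p < x0 - real k}"

definition strip_rect :: "nat \<Rightarrow> real \<Rightarrow> complex" where
  "strip_rect k = rectpath (Complex (x0 - real (Suc k)) (- T)) (Complex (x0 - real k) T)"

definition strip_sum :: "nat \<Rightarrow> real \<Rightarrow> complex" where
  "strip_sum k t = (\<Sum>p\<in>strip_poles k. residue (\<lambda>s. F s * of_real t powr (- s)) p)"

lemma finite_strip_poles: "finite (strip_poles k)"
  by (rule finite_subset[OF _ finite_poles_right[of "x0 - real (Suc k)"]]) (auto simp: strip_poles_def)

lemma path_image_strip_rect:
  "path_image (strip_rect k) = 
     {s. x0 - real (Suc k) \<le> Re s \<and> Re s \<le> x0 - real k \<and> \<bar>Im s\<bar> \<le> T \<and>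
         (Re s = x0 - real (Suc k) \<or> Re s = x0 - real k \<or> \<bar>Im s\<bar> = T)}"
  using T_pos unfolding strip_rect_def
  by (auto simp: path_image_rectpath_cbox_minus_box in_cbox_complex_iff in_box_complex_iff)

lemma strip_rect_grid: "path_image (strip_rect k) \<subseteq> grid"
proof
  fix s assume "s \<in> path_image (strip_rect k)"
  hence "Re s - x0 = of_int (- int (Suc k)) \<or> Re s - x0 = of_int (- int k) \<or> T \<le> \<bar>Im s\<bar>"
    unfolding path_image_strip_rect by auto
  thus "s \<in> grid" unfolding grid_def using Ints_of_int by (metis mem_Collect_eq)
qed

text \<open>Only finitely many poles lie to the right of a given vertical line, so the residue theorem
  applies in a half plane.\<close>

lemma residues_rect:
  assumes G: "G holomorphic_on - (poles \<union> Q)" and Q: "finite Q"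
    and lt: "x1 < x2" "0 < Y"
    and avoid: "(poles \<union> Q) \<inter> path_image (rectpath (Complex x1 (- Y)) (Complex x2 Y)) = {}"
  shows "contour_integral (rectpath (Complex x1 (- Y)) (Complex x2 Y)) G =
     2 * of_real pi * \<i> * (\<Sum>p\<in>{p \<in> poles \<union> Q. x1 < Re p \<and> Re p < x2 \<and> \<bar>Im p\<bar> < Y}. residue G p)"
proof -
  define S where "S = {s. x1 - 1 < Re s}"
  define X where "X = {p \<in> poles \<union> Q. x1 - 1 < Re p}"
  have finX: "finite X"
    by (rule finite_subset[of _ "{p \<in> poles. x1 - 1 < Re p} \<union> Q"])
       (use Q finite_poles_right in \<open>auto simp: X_def\<close>)
  have "contour_integral (rectpath (Complex x1 (- Y)) (Complex x2 Y)) G =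
    2 * of_real pi * \<i> * (\<Sum>p\<in>X \<inter> box (Complex x1 (- Y)) (Complex x2 Y). residue G p)"
  proof (rule contour_integral_rectpath_residues)
    show "open S" unfolding S_def by (rule open_halfspace_Re_gt)
    show "convex S" unfolding S_def by (rule convex_halfspace_Re_gt)
    show "cbox (Complex x1 (- Y)) (Complex x2 Y) \<subseteq> S"
      by (auto simp: S_def in_cbox_complex_iff)
    show "G holomorphic_on S - X"
      by (rule holomorphic_on_subset[OF G]) (auto simp: S_def X_def)
  qed (use lt finX avoid in \<open>auto simp: X_def\<close>)
  also have "X \<inter> box (Complex x1 (- Y)) (Complex x2 Y) =
      {p \<in> poles \<union> Q. x1 < Re p \<and> Re p < x2 \<and> \<bar>Im p\<bar> < Y}"
    by (auto simp: X_def in_box_complex_iff)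
  finally show ?thesis .
qed

lemma contour_integral_strip_rect:
  assumes G: "G holomorphic_on - (poles \<union> Q)" and Q: "finite Q" "\<And>w. w \<in> Q \<Longrightarrow> x0 < Re w"
  shows "contour_integral (strip_rect k) G = 2 * of_real pi * \<i> * (\<Sum>p\<in>strip_poles k. residue G p)"
proof -
  have "poles \<inter> path_image (strip_rect k) = {}"
    using strip_rect_grid grid_disjoint_poles by blast
  moreover have "Q \<inter> path_image (strip_rect k) = {}"
    using Q(2) by (fastforce simp: path_image_strip_rect)
  ultimately have "(poles \<union> Q) \<inter> path_image (strip_rect k) = {}" by blast
  hence "contour_integral (strip_rect k) G = 2 * of_real pi * \<i> *
     (\<Sum>p\<in>{p \<in> poles \<union> Q. x0 - real (Suc k) < Re p \<and> Re p < x0 - real k \<and> \<bar>Im p\<bar> < T}. residue G p)"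
    unfolding strip_rect_def using T_pos by (intro residues_rect G Q) auto
  also have "{p \<in> poles \<union> Q. x0 - real (Suc k) < Re p \<and> Re p < x0 - real k \<and> \<bar>Im p\<bar> < T} = strip_poles k"
    using Q(2) Im_less_T by (fastforce simp: strip_poles_def)
  finally show ?thesis .
qed

lemma holomorphic_kernel: "t > 0 \<Longrightarrow> (\<lambda>s. F s * of_real t powr (- s)) holomorphic_on - poles"
  by (intro holomorphic_intros hol') auto

lemma strip_sum_eq:
  assumes "t > 0"
  shows "contour_integral (strip_rect k) (\<lambda>s. F s * of_real t powr (- s)) = 2 * of_real pi * \<i> * strip_sum k t"
  unfolding strip_sum_def using contour_integral_strip_rect[of _ "{}" k] holomorphic_kernel[OF assms] by simp

lemma continuous_on_grid:
  assumes "S \<subseteq> grid" shows "continuous_on S F"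
proof -
  have "S \<subseteq> - poles" using assms grid_disjoint_poles by blast
  thus ?thesis using hol' holomorphic_on_imp_continuous_on continuous_on_subset by blast
qed

text \<open>The contour of the k-th strip has a fixed length. It lies at distance about k from the origin,
  where |F| is at most a constant times k^(-\<rho>), and to the left of the line Re s = x0 - k, where
  |t^(-s)| is at most t^(k - x0). Multiple poles, and poles close to each other, are covered at once
  because only their total contribution is estimated.\<close>

lemma norm_strip_sum_le:
  "\<exists>C\<ge>0. \<forall>k. \<forall>t\<in>{0<..<1}. norm (strip_sum k t) \<le> C * real (Suc k) powr (- \<rho>) * t powr (real k - x0)"
proof -
  obtain C where C: "C \<ge> 0" "\<forall>s\<in>grid. norm (F s) \<le> C * (1 + norm s) powr (- \<rho>)"
    using grid_bound by blast
  define C' where "C' = C * 2 powr \<rho> * (2 + 4 * T) / (2 * pi)"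
  have "norm (strip_sum k t) \<le> C' * real (Suc k) powr (- \<rho>) * t powr (real k - x0)"
    if t: "t \<in> {0<..<1}" for k t
  proof -
    define D where "D = C * (2 powr \<rho> * real (Suc k) powr (- \<rho>)) * t powr (real k - x0)"
    have "norm (contour_integral (strip_rect k) (\<lambda>s. F s * of_real t powr (- s))) \<le> D * (2 * 1 + 2 * (2 * T))"
    proof -
      have "continuous_on (path_image (strip_rect k)) (\<lambda>s. F s * of_real t powr (- s))"
        using t by (intro continuous_intros continuous_on_grid strip_rect_grid) auto
      moreover have "norm (F s * of_real t powr (- s)) \<le> D" if s: "s \<in> path_image (strip_rect k)" for s
      proof -
        have "real k - x0 \<le> - Re s" using s by (auto simp: path_image_strip_rect)
        hence "t powr (- Re s) \<le> t powr (real k - x0)" using t by (intro powr_mono') auto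
        hence 1: "norm (of_real t powr (- s) :: complex) \<le> t powr (real k - x0)"
          using t by (simp add: norm_powr_real_powr)
        (* the rectangle is only known to lie in Re s < 1 - k, hence the factor 2 *)
        have "real (Suc k) / 2 \<le> 1 + norm s"
        proof (cases "k = 0")
          case False
          have "real k - x0 \<le> \<bar>Re s\<bar>" using s by (auto simp: path_image_strip_rect)
          also have "\<dots> \<le> norm s" by (rule abs_Re_le_cmod)
          finally show ?thesis using x0 False by simp
        qed (auto intro: add_increasing2)
        hence "(1 + norm s) powr (- \<rho>) \<le> (real (Suc k) / 2) powr (- \<rho>)"
          using rho_pos by (intro powr_mono2') auto
        also have "\<dots> = 2 powr \<rho> * real (Suc k) powr (- \<rho>)"
          by (simp add: powr_divide powr_minus_divide)
        finally have 2: "(1 + norm s) powr (- \<rho>) \<le> 2 powr \<rho> * real (Suc k) powr (- \<rho>)" .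
        have "norm (F s) \<le> C * (1 + norm s) powr (- \<rho>)" using C s strip_rect_grid by blast
        also have "\<dots> \<le> C * (2 powr \<rho> * real (Suc k) powr (- \<rho>))"
          using 2 C by (intro mult_left_mono) auto
        finally show ?thesis unfolding D_def norm_mult using 1 C by (intro mult_mono) auto
      qed
      ultimately have "norm (contour_integral (strip_rect k) (\<lambda>s. F s * of_real t powr (- s))) \<le>
         D * (2 * (x0 - real k - (x0 - real (Suc k))) + 2 * (T - (- T)))"
        unfolding strip_rect_def using T_pos
        by (intro norm_contour_integral_rectpath_le) auto
      thus ?thesis by simp
    qed
    hence "2 * pi * norm (strip_sum k t) \<le> D * (2 + 4 * T)"
      using t by (simp add: strip_sum_eq norm_mult)
    hence "norm (strip_sum k t) \<le> D * (2 + 4 * T) / (2 * pi)" by (simp add: field_simps)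
    thus ?thesis by (simp add: D_def C'_def mult_ac)
  qed
  moreover have "C' \<ge> 0" using C T_pos by (simp add: C'_def)
  ultimately show ?thesis by blast
qed

lemma moment_strip_sum:
  shows "set_integrable lborel {0<..<1} (\<lambda>t. strip_sum k t * of_real t ^ q)"
    and "2 * of_real pi * \<i> * (LINT t:{0<..<1}|lborel. strip_sum k t * of_real t ^ q) =
         contour_integral (strip_rect k) (\<lambda>s. F s / (of_nat q + 1 - s))"
proof -
  define c :: complex where "c = 2 * of_real pi * \<i>"
  have c: "c \<noteq> 0" by (simp add: c_def)
  have Re: "Re s < real q + 1" if "s \<in> path_image (strip_rect k)" for s
    using that x0 by (auto simp: path_image_strip_rect)
  note m = mellin_rectpath[of "Complex (x0 - real (Suc k)) (- T)" "Complex (x0 - real k) T" F q, folded strip_rect_def,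
      OF continuous_on_grid[OF strip_rect_grid] Re]
  have eq: "contour_integral (strip_rect k) (\<lambda>s. F s * of_real t powr (- s)) * of_real t ^ q
     = c * (strip_sum k t * of_real t ^ q)" if "t \<in> {0<..<1}" for t
    using that by (simp add: strip_sum_eq c_def)
  have "set_integrable lborel {0<..<1} (\<lambda>t. c * (strip_sum k t * of_real t ^ q))"
    by (rule set_integrable_cong[THEN iffD1, OF _ _ _ m(1)]) (use eq in auto)
  thus "set_integrable lborel {0<..<1} (\<lambda>t. strip_sum k t * of_real t ^ q)"
    using c by simp
  have "(LINT t:{0<..<1}|lborel. contour_integral (strip_rect k) (\<lambda>s. F s * of_real t powr (- s)) * of_real t ^ q)
      = (LINT t:{0<..<1}|lborel. c * (strip_sum k t * of_real t ^ q))"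
    by (intro set_lebesgue_integral_cong) (use eq in auto)
  also have "\<dots> = c * (LINT t:{0<..<1}|lborel. strip_sum k t * of_real t ^ q)"
    by simp
  finally show "2 * of_real pi * \<i> * (LINT t:{0<..<1}|lborel. strip_sum k t * of_real t ^ q) =
         contour_integral (strip_rect k) (\<lambda>s. F s / (of_nat q + 1 - s))"
    using m(2) unfolding c_def by simp
qed

text \<open>The sum of the residues of F(s) t^(-s) at all poles, grouped by strips.\<close>

definition mellin_density :: "real \<Rightarrow> complex" where
  "mellin_density t = (\<Sum>k. strip_sum k t)"

lemma summable_norm_strip_sum:
  assumes t: "t \<in> {0<..<1}"
  shows "summable (\<lambda>k. norm (strip_sum k t))"
proof -
  obtain C where C: "C \<ge> 0" "\<And>k t. t \<in> {0<..<1} \<Longrightarrow> norm (strip_sum k t) \<le> C * real (Suc k) powr (- \<rho>) * t powr (real k - x0)"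
    using norm_strip_sum_le by blast
  show ?thesis
  proof (rule summable_comparison_test')
    show "summable (\<lambda>k. C * t powr (- x0) * t ^ k)"
      using t by (intro summable_mult summable_geometric) auto
    fix k :: nat
    have "real (Suc k) powr (- \<rho>) \<le> real (Suc k) powr 0" using rho_pos by (intro powr_mono) auto
    hence "C * real (Suc k) powr (- \<rho>) * t powr (real k - x0) \<le> C * 1 * t powr (real k - x0)"
      using C by (intro mult_right_mono mult_left_mono) auto
    also have "\<dots> = C * t powr (- x0) * t ^ k"
      using t by (simp add: powr_diff powr_minus_divide powr_realpow)
    finally show "norm (norm (strip_sum k t)) \<le> C * t powr (- x0) * t ^ k"
      using C(2)[OF t, of k] by simp
  qed
qed

text \<open>Integrating the bound of the strip sums over (0,1) turns k^(-\<rho>) t^(k - x0) into a constant times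
  k^(-1-\<rho>), and \<rho> > 0 suffices for convergence.\<close>

lemma mellin_density_moment_sums:
  shows "set_integrable lborel {0<..<1} (\<lambda>t. mellin_density t * of_real t ^ q)"
    and "(\<lambda>k. LINT t:{0<..<1}|lborel. strip_sum k t * of_real t ^ q) sums
           (LINT t:{0<..<1}|lborel. mellin_density t * of_real t ^ q)"
proof -
  obtain C where C: "C \<ge> 0" "\<And>k t. t \<in> {0<..<1} \<Longrightarrow> norm (strip_sum k t) \<le> C * real (Suc k) powr (- \<rho>) * t powr (real k - x0)"
    using norm_strip_sum_le by blast
  define f where "f k t = indicator {0<..<1} t *\<^sub>R (strip_sum k t * of_real t ^ q)" for k and t :: real
  have int: "integrable lborel (f k)" for k
    using moment_strip_sum(1)[of k q] unfolding set_integrable_def f_def .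
  have norm_f: "(\<integral>t. norm (f k t) \<partial>lborel) \<le> C / (1 - x0) * real (Suc k) powr (- 1 - \<rho>)" for k
  proof -
    have pos: "0 < 1 + real k - x0" using x0 by simp
    have "(\<integral>t. norm (f k t) \<partial>lborel) \<le>
       (\<integral>t. C * real (Suc k) powr (- \<rho>) * (indicator {0<..<1} t *\<^sub>R t powr ((1 + real k - x0) - 1)) \<partial>lborel)"
    proof (rule integral_mono)
      show "integrable lborel (\<lambda>t. C * real (Suc k) powr (- \<rho>) * (indicator {0<..<1} t *\<^sub>R t powr ((1 + real k - x0) - 1)))"
        using powr_unit_interval_real(1)[OF pos] unfolding set_integrable_def by (rule integrable_mult_right)
      show "norm (f k t) \<le> C * real (Suc k) powr (- \<rho>) * (indicator {0<..<1} t *\<^sub>R t powr ((1 + real k - x0) - 1))" for t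
      proof (cases "t \<in> {0<..<1}")
        case True
        have "norm (f k t) = norm (strip_sum k t) * t ^ q" using True by (simp add: f_def norm_mult norm_power)
        also have "\<dots> \<le> norm (strip_sum k t) * 1" using True by (intro mult_left_mono power_le_one) auto
        also have "\<dots> \<le> C * real (Suc k) powr (- \<rho>) * t powr (real k - x0)" using C(2)[OF True] by simp
        finally show ?thesis using True by simp
      qed (simp add: f_def)
    qed (use int in auto)
    also have "\<dots> = C * real (Suc k) powr (- \<rho>) * (1 / (1 + real k - x0))"
      using powr_unit_interval_real(2)[OF pos, unfolded set_lebesgue_integral_def]
      by (simp only: integral_mult_right_zero)
    also have "\<dots> \<le> C * real (Suc k) powr (- \<rho>) * (1 / ((1 - x0) * real (Suc k)))"
    proof (intro mult_left_mono frac_le)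
      show "(1 - x0) * real (Suc k) \<le> 1 + real k - x0"
        using mult_nonneg_nonneg[of x0 "real k"] x0 by (simp add: algebra_simps)
    qed (use C x0 in auto)
    also have "\<dots> = C / (1 - x0) * real (Suc k) powr (- 1 - \<rho>)"
      by (simp add: powr_diff powr_minus_divide)
    finally show ?thesis .
  qed
  have sum2: "summable (\<lambda>k. \<integral>t. norm (f k t) \<partial>lborel)"
  proof (rule summable_comparison_test')
    have "summable (\<lambda>k. real k powr (- 1 - \<rho>))" using rho_pos by (simp add: summable_real_powr_iff)
    hence "summable (\<lambda>k. real (Suc k) powr (- 1 - \<rho>))" by (subst summable_Suc_iff)
    thus "summable (\<lambda>k. C / (1 - x0) * real (Suc k) powr (- 1 - \<rho>))" by (rule summable_mult)
    show "norm (\<integral>t. norm (f k t) \<partial>lborel) \<le> C / (1 - x0) * real (Suc k) powr (- 1 - \<rho>)" for k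
      using norm_f[of k] by simp
  qed
  have sum1: "AE t in lborel. summable (\<lambda>k. norm (f k t))"
  proof (rule AE_I2)
    fix t show "summable (\<lambda>k. norm (f k t))"
    proof (cases "t \<in> {0<..<1}")
      case True
      have "summable (\<lambda>k. norm (strip_sum k t) * t ^ q)"
        by (intro summable_mult2 summable_norm_strip_sum True)
      thus ?thesis using True by (simp add: f_def norm_mult norm_power)
    qed (simp add: f_def)
  qed
  have eq: "(\<Sum>k. f k t) = indicator {0<..<1} t *\<^sub>R (mellin_density t * of_real t ^ q)" for t
  proof (cases "t \<in> {0<..<1}")
    case True
    have "summable (\<lambda>k. strip_sum k t)" using summable_norm_strip_sum[OF True] by (rule summable_norm_cancel)
    thus ?thesis using True by (simp add: f_def mellin_density_def suminf_mult2)
  qed (simp add: f_def)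
  show "set_integrable lborel {0<..<1} (\<lambda>t. mellin_density t * of_real t ^ q)"
    using integrable_suminf[OF int sum1 sum2] unfolding eq set_integrable_def .
  show "(\<lambda>k. LINT t:{0<..<1}|lborel. strip_sum k t * of_real t ^ q) sums
           (LINT t:{0<..<1}|lborel. mellin_density t * of_real t ^ q)"
    using sums_integral[OF int sum1 sum2] unfolding eq unfolding set_lebesgue_integral_def f_def .
qed

lemma sum_over_strips:
  "(\<Sum>k<K. \<Sum>p\<in>strip_poles k. h p) = (\<Sum>p\<in>{p \<in> poles. x0 - real K < Re p}. h p)"
proof (induction K)
  case 0
  have "{p \<in> poles. x0 - real 0 < Re p} = {}" using Re_less_x0 by force
  thus ?case by (simp only: sum.empty lessThan_0)
next
  case (Suc K)
  have "{p \<in> poles. x0 - real (Suc K) < Re p} = {p \<in> poles. x0 - real K < Re p} \<union> strip_poles K"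
  proof -
    have "Re p \<noteq> x0 - real K" if "p \<in> poles" for p
      using Re_off_lines[OF that] by (metis Ints_minus Ints_of_nat add_diff_cancel_left' diff_diff_eq2 minus_diff_eq)
    thus ?thesis by (force simp: strip_poles_def)
  qed
  moreover have "{p \<in> poles. x0 - real K < Re p} \<inter> strip_poles K = {}"
    by (auto simp: strip_poles_def)
  ultimately show ?case
    using Suc finite_poles_right finite_strip_poles by (simp add: sum.union_disjoint)
qed

text \<open>After termwise integration the moment is the sum of the residues of F(s) / (q + 1 - s) at the poles
  of F. The integral of this function over growing rectangles tends to 0, as it is O(|s|^(-1-\<rho>)) on
  them; hence the sum is the negative of the residue at the remaining pole q + 1, which is
  -F(q + 1).\<close>

lemma mellin_density_moment:
  "(LINT t:{0<..<1}|lborel. mellin_density t * of_real t ^ q) = F (of_nat (Suc q))"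
proof -
  define w :: complex where "w = of_nat (Suc q)"
  define G where "G s = F s / (of_nat q + 1 - s)" for s
  have Gw: "G = (\<lambda>s. - F s / (s - w))"
    by (auto simp: G_def w_def fun_eq_iff) (metis minus_diff_eq minus_divide_right add.commute)
  have w: "x0 < Re w" using x0 by (simp add: w_def)
  have w_np: "w \<notin> poles" using Re_less_x0[of w] w by auto
  have G: "G holomorphic_on - (poles \<union> {w})"
    unfolding Gw using hol' by (auto intro!: holomorphic_intros elim: holomorphic_on_subset)
  have res_w: "residue G w = - F w"
    unfolding Gw using hol' w_np by (intro residue_simple[of "- poles"] open_non_poles) (auto intro!: holomorphic_intros)
  define R where "R K = (\<Sum>p\<in>{p \<in> poles. x0 - real K < Re p}. residue G p)" for K
  have partial: "(\<Sum>k<K. LINT t:{0<..<1}|lborel. strip_sum k t * of_real t ^ q) = R K" for K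
  proof -
    have "2 * of_real pi * \<i> * (LINT t:{0<..<1}|lborel. strip_sum k t * of_real t ^ q) =
         2 * of_real pi * \<i> * (\<Sum>p\<in>strip_poles k. residue G p)" for k
      using moment_strip_sum(2)[of k q] contour_integral_strip_rect[OF G, of k] w unfolding G_def by simp
    hence "(LINT t:{0<..<1}|lborel. strip_sum k t * of_real t ^ q) = (\<Sum>p\<in>strip_poles k. residue G p)" for k
      by simp
    thus ?thesis unfolding R_def by (simp add: sum_over_strips)
  qed
  obtain C where C: "C \<ge> 0" "\<forall>s\<in>grid. norm (F s) \<le> C * (1 + norm s) powr (- \<rho>)"
    using grid_bound by blast
  have bound: "norm (R K - F w) \<le> C / (2 * pi) * (real K powr (- \<rho>) * ((8 * real K + 4 * T) / (real K - real q - 2)))"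
    if K: "K > q + 2" for K :: nat
  proof -
    (* All four sides are at distance about K from 0, and the right one is beyond w. *)
    define r where "r = rectpath (Complex (x0 - real K) (- (T + real K))) (Complex (x0 + real K) (T + real K))"
    have K0: "real K > 0" "real K > real q + 2" using K by linarith+
    have img: "path_image r = {s. x0 - real K \<le> Re s \<and> Re s \<le> x0 + real K \<and> \<bar>Im s\<bar> \<le> T + real K \<and>
         (Re s = x0 - real K \<or> Re s = x0 + real K \<or> \<bar>Im s\<bar> = T + real K)}"
      unfolding r_def using T_pos K0 
      by (auto simp: path_image_rectpath_cbox_minus_box in_cbox_complex_iff in_box_complex_iff)
    have r_grid: "path_image r \<subseteq> grid"
    proof
      fix s assume "s \<in> path_image r"
      hence "Re s - x0 = of_int (- int K) \<or> Re s - x0 = of_int (int K) \<or> T \<le> \<bar>Im s\<bar>"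
        unfolding img by auto
      thus "s \<in> grid" unfolding grid_def using Ints_of_int by (metis mem_Collect_eq)
    qed
    have large: "real K \<le> 1 + norm s" if "s \<in> path_image r" for s
    proof -
      have "real K \<le> 1 + \<bar>Re s\<bar> \<or> real K \<le> \<bar>Im s\<bar>" using that T_pos x0 unfolding img by auto
      thus ?thesis using abs_Re_le_cmod[of s] abs_Im_le_cmod[of s] by linarith
    qed
    have far: "real K - real q - 2 \<le> norm (of_nat q + 1 - s)" if "s \<in> path_image r" for s
    proof -
      have "norm s \<le> norm (of_nat q + 1 - s) + norm (of_nat (Suc q) :: complex)"
        using norm_triangle_ineq4[of "of_nat (Suc q)" "of_nat q + 1 - s"] by (simp add: algebra_simps)
      thus ?thesis using large[OF that] unfolding norm_of_nat by simp
    qed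
    have avoid: "(poles \<union> {w}) \<inter> path_image r = {}"
    proof -
      have "w \<notin> path_image r" using far[of w] K0 by (auto simp: w_def)
      thus ?thesis using r_grid grid_disjoint_poles by blast
    qed
    have "contour_integral r G = 2 * of_real pi * \<i> *
       (\<Sum>p\<in>{p \<in> poles \<union> {w}. x0 - real K < Re p \<and> Re p < x0 + real K \<and> \<bar>Im p\<bar> < T + real K}. residue G p)"
      unfolding r_def using G avoid T_pos K0 by (intro residues_rect) (auto simp: r_def)
    also have "{p \<in> poles \<union> {w}. x0 - real K < Re p \<and> Re p < x0 + real K \<and> \<bar>Im p\<bar> < T + real K}
       = insert w {p \<in> poles. x0 - real K < Re p}"
      using Re_less_x0 Im_less_T K0 x0 T_pos by (fastforce simp: w_def)
    also have "(\<Sum>p\<in>\<dots>. residue G p) = R K - F w"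
      using w_np finite_poles_right by (simp add: R_def res_w)
    finally have I: "contour_integral r G = 2 * of_real pi * \<i> * (R K - F w)" .
    define E where "E = C * real K powr (- \<rho>) / (real K - real q - 2)"
    have "norm (contour_integral r G) \<le> E * (2 * (x0 + real K - (x0 - real K)) + 2 * (T + real K - - (T + real K)))"
    proof -
      have "continuous_on (path_image r) G"
        by (rule continuous_on_subset[OF holomorphic_on_imp_continuous_on[OF G]]) (use avoid in blast)
      moreover have "norm (G s) \<le> E" if s: "s \<in> path_image r" for s
      proof -
        have "norm (F s) \<le> C * (1 + norm s) powr (- \<rho>)" using C s r_grid by blast
        also have "\<dots> \<le> C * real K powr (- \<rho>)"
          using large[OF s] rho_pos K0 C by (intro mult_left_mono powr_mono2') auto
        finally show ?thesis unfolding G_def E_def norm_divide using far[OF s] K0 C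
          by (intro frac_le) auto
      qed
      ultimately show ?thesis
        unfolding r_def using T_pos K0
        by (intro norm_contour_integral_rectpath_le) auto
    qed
    moreover have "2 * (x0 + real K - (x0 - real K)) + 2 * (T + real K - - (T + real K)) = 8 * real K + 4 * T"
      by simp
    ultimately have "2 * pi * norm (R K - F w) \<le> E * (8 * real K + 4 * T)"
      unfolding I by (simp only: norm_mult) simp
    hence "norm (R K - F w) \<le> E * (8 * real K + 4 * T) / (2 * pi)" by (simp add: field_simps)
    thus ?thesis unfolding E_def by (simp add: mult_ac)
  qed
  have "(\<lambda>K. C / (2 * pi) * (real K powr (- \<rho>) * ((8 * real K + 4 * T) / (real K - real q - 2)))) \<longlonglongrightarrow> C / (2 * pi) * (0 * 8)"
  proof (intro tendsto_intros)
    show "(\<lambda>K. real K powr (- \<rho>)) \<longlonglongrightarrow> 0"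
      using rho_pos by (intro tendsto_neg_powr filterlim_real_sequentially) auto
    show "(\<lambda>K. (8 * real K + 4 * T) / (real K - real q - 2)) \<longlonglongrightarrow> 8"
      by real_asymp
  qed
  hence lim0: "(\<lambda>K. C / (2 * pi) * (real K powr (- \<rho>) * ((8 * real K + 4 * T) / (real K - real q - 2)))) \<longlonglongrightarrow> 0"
    by simp
  have "\<forall>\<^sub>F K in sequentially. norm (R K - F w) \<le>
      C / (2 * pi) * (real K powr (- \<rho>) * ((8 * real K + 4 * T) / (real K - real q - 2)))"
    using eventually_gt_at_top[of "q + 2"] by eventually_elim (rule bound)
  hence "(\<lambda>K. R K - F w) \<longlonglongrightarrow> 0"
    by (rule Lim_null_comparison[OF _ lim0])
  hence "R \<longlonglongrightarrow> F w" by (simp add: LIM_zero_iff)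
  moreover have "R \<longlonglongrightarrow> (LINT t:{0<..<1}|lborel. mellin_density t * of_real t ^ q)"
    using mellin_density_moment_sums(2)[of q] unfolding sums_def partial .
  ultimately show ?thesis using LIMSEQ_unique unfolding w_def by blast
qed

end

section \<open>Left loops\<close>

text \<open>Travel from q to a small circle about w on a path avoiding U, which exists because the complement
  of a countable set is connected, go round the circle clockwise, and return the same way. The two
  journeys cancel in every winding number.\<close>

lemma excursion_around_point:
  fixes U :: "complex set"
  assumes U: "countable U" "\<And>w. closed (U - {w})" and q: "q \<notin> U" and w: "w \<in> U"
  obtains E where "valid_path E" "pathstart E = q" "pathfinish E = q" "path_image E \<subseteq> - U"
    "winding_number E w = - 1" "\<And>v. v \<in> U - {w} \<Longrightarrow> winding_number E v = 0"
proof -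
  have "open (- (U - {w}))" using U(2) by (simp add: closed_def)
  then obtain \<epsilon> where \<epsilon>: "\<epsilon> > 0" "cball w \<epsilon> \<subseteq> - (U - {w})"
    by (metis ComplI Diff_iff insertI1 open_contains_cball)
  define c where "c = circlepath w \<epsilon>"
  have "U - {q} = U" using q by auto
  hence opn: "open (- U)" using U(2)[of q] by (simp add: closed_def)
  have conn: "connected (- U)"
    using path_connected_complement_countable[OF _ U(1)] path_connected_imp_connected by simp
  have e: "w + of_real \<epsilon> \<in> - U"
  proof -
    have "w + of_real \<epsilon> \<in> cball w \<epsilon>" "w + of_real \<epsilon> \<noteq> w"
      using \<epsilon> by (auto simp: dist_norm)
    thus ?thesis using \<epsilon>(2) by blast
  qed
  obtain \<gamma> where \<gamma>: "polynomial_function \<gamma>" "path_image \<gamma> \<subseteq> - U" "pathstart \<gamma> = q" "pathfinish \<gamma> = w + of_real \<epsilon>"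
    using connected_open_polynomial_connected[OF opn conn _ e, of q] q by auto
  have v\<gamma>: "valid_path \<gamma>" using \<gamma>(1) by (rule valid_path_polynomial_function)
  have c_img: "path_image c \<subseteq> - U"
  proof -
    have "path_image c \<subseteq> cball w \<epsilon> - {w}" using \<epsilon>(1) by (auto simp: c_def)
    thus ?thesis using \<epsilon>(2) by blast
  qed
  have c_ends: "pathstart c = w + of_real \<epsilon>" "pathfinish c = w + of_real \<epsilon>" by (auto simp: c_def)
  have vc: "valid_path c" by (simp add: c_def)
  have paths: "path \<gamma>" "path c" using v\<gamma> vc valid_path_imp_path by auto
  define E where "E = \<gamma> +++ (reversepath c +++ reversepath \<gamma>)"
  have wE: "winding_number E v = - winding_number c v" if v: "v \<in> U" for v
  proof -
    have nv: "v \<notin> path_image \<gamma>" "v \<notin> path_image c" using v \<gamma>(2) c_img by auto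
    have "winding_number E v = winding_number \<gamma> v +
        (winding_number (reversepath c) v + winding_number (reversepath \<gamma>) v)"
      unfolding E_def using nv paths c_ends \<gamma>
      by (subst winding_number_join; (subst winding_number_join)?) (auto simp: path_image_join)
    thus ?thesis using nv paths by (simp add: winding_number_reversepath)
  qed
  show thesis
  proof
    show "valid_path E" unfolding E_def using v\<gamma> vc c_ends \<gamma>
      by (intro valid_path_join) auto
    show "pathstart E = q" "pathfinish E = q" using \<gamma> by (auto simp: E_def)
    show "path_image E \<subseteq> - U" unfolding E_def using \<gamma>(2) c_img c_ends \<gamma>
      by (subst path_image_join; (subst path_image_join)?) auto
    show "winding_number E w = - 1"
      using wE[OF w] \<epsilon>(1) by (simp add: c_def winding_number_circlepath_centre)
    show "winding_number E v = 0" if v: "v \<in> U - {w}" for v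
    proof -
      have "v \<notin> cball w \<epsilon>" using v \<epsilon>(2) by blast
      moreover have "path_image c \<subseteq> cball w \<epsilon>" using \<epsilon>(1) by (auto simp: c_def)
      ultimately have "winding_number c v = 0"
        using paths(2) c_ends by (intro winding_number_zero_outside[of c "cball w \<epsilon>"]) auto
      thus ?thesis using wE[of v] v by simp
    qed
  qed
qed

lemma excursion_around_finite_set:
  fixes U :: "complex set"
  assumes U: "countable U" "\<And>w. closed (U - {w})" and q: "q \<notin> U" and W: "finite W" "W \<subseteq> U"
  shows "\<exists>E. valid_path E \<and> pathstart E = q \<and> pathfinish E = q \<and> path_image E \<subseteq> - U \<and>
    (\<forall>v\<in>W. winding_number E v = - 1) \<and> (\<forall>v\<in>U - W. winding_number E v = 0)"
  using W
proof (induction W rule: finite_induct)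
  case empty
  have "winding_number (linepath q q) v = 0" if "v \<in> U" for v
    using that q by (metis winding_number_trivial)
  moreover have "path_image (linepath q q) \<subseteq> - U" using q by simp
  ultimately show ?case
    using valid_path_linepath[of q q] pathstart_linepath[of q q] pathfinish_linepath[of q q] by blast
next
  case (insert w W)
  then obtain E where E: "valid_path E" "pathstart E = q" "pathfinish E = q" "path_image E \<subseteq> - U"
    "\<forall>v\<in>W. winding_number E v = - 1" "\<forall>v\<in>U - W. winding_number E v = 0" by auto
  have "w \<in> U" using insert by simp
  then obtain E' where E': "valid_path E'" "pathstart E' = q" "pathfinish E' = q" "path_image E' \<subseteq> - U"
    "winding_number E' w = - 1" "\<And>v. v \<in> U - {w} \<Longrightarrow> winding_number E' v = 0"
    using excursion_around_point[OF U q] by metis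
  have "winding_number (E' +++ E) v = winding_number E' v + winding_number E v" if "v \<in> U" for v
    using that E E' valid_path_imp_path by (intro winding_number_join) auto
  moreover have "winding_number E w = 0" using E(6) \<open>w \<in> U\<close> insert.hyps by auto
  moreover have "v \<in> U" "winding_number E' v = 0" if "v \<in> W" for v
    using that insert.hyps insert.prems E'(6)[of v] by auto
  ultimately have "\<forall>v\<in>insert w W. winding_number (E' +++ E) v = - 1"
      "\<forall>v\<in>U - insert w W. winding_number (E' +++ E) v = 0"
    using E(5,6) E'(5,6) \<open>w \<in> U\<close> by auto
  thus ?case using E(1-4) E'(1-4)
    by (intro exI[of _ "E' +++ E"]) (auto simp: path_image_join valid_path_join)
qed

text \<open>A hook that runs at height -T to the abscissa \<open>xr\<close>, up to the height T and back surrounds all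
  points of L, but also the finitely many points of R to the left of its vertical part. Clockwise
  excursions around those, made from the lower corner, bring their winding numbers back to 0.\<close>

lemma left_loop_exists:
  fixes L R :: "complex set" and T xr :: real
  assumes U: "countable (L \<union> R)" "\<And>w. closed (L \<union> R - {w})" and disj: "L \<inter> R = {}"
    and T: "T > 0" "\<And>w. w \<in> L \<union> R \<Longrightarrow> \<bar>Im w\<bar> < T"
    and L: "\<And>w. w \<in> L \<Longrightarrow> Re w < xr" and R: "\<And>w. w \<in> R \<Longrightarrow> Re w \<noteq> xr" "finite {w \<in> R. Re w < xr}"
  shows "\<exists>g. left_loop g L R"
proof -
  define q where "q = Complex xr (- T)"
  define q' where "q' = Complex xr T"
  have q: "q \<notin> L \<union> R" using T(2)[of q] T(1) by (auto simp: q_def)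
  obtain E where E: "valid_path E" "pathstart E = q" "pathfinish E = q" "path_image E \<subseteq> - (L \<union> R)"
    "\<forall>v\<in>{w \<in> R. Re w < xr}. winding_number E v = - 1"
    "\<forall>v\<in>(L \<union> R) - {w \<in> R. Re w < xr}. winding_number E v = 0"
    using excursion_around_finite_set[OF U q R(2)] by blast
  define g where "g = E +++ linepath q q'"
  have ends: "pathstart g = q" "pathfinish g = q'" using E by (auto simp: g_def)
  have vg: "valid_path g" unfolding g_def using E by (intro valid_path_join) auto
  have main: "w \<notin> path_image (loop_closed g X) \<and>
      winding_number (loop_closed g X) w = winding_number E w + (if Re w < xr then 1 else 0)"
    if w: "w \<in> L \<union> R" and X: "X < Re w" "X < xr" for w X
  proof -
    define p where "p = Complex X (- T)"
    define p' where "p' = Complex X T"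
    have rect: "rectpath p q' = linepath p q +++ linepath q q' +++ linepath q' p' +++ linepath p' p"
      by (simp add: rectpath_def Let_def p_def p'_def q_def q'_def)
    have img: "path_image (rectpath p q') =
        closed_segment p q \<union> closed_segment q q' \<union> closed_segment q' p' \<union> closed_segment p' p"
      unfolding rect by (simp add: path_image_join Un_assoc)
    have lc: "loop_closed g X =
       (linepath p q +++ (E +++ linepath q q') +++ linepath q' p') +++ linepath p' p"
      by (simp add: loop_closed_def loop_trunc_def ends p_def p'_def q_def q'_def g_def E(2))
    have "\<bar>Im w\<bar> < T" "Re w \<noteq> xr" using T(2)[OF w] w L R(1) by auto
    hence nw: "w \<notin> path_image (rectpath p q')"
      using X T(1) by (auto simp: p_def q'_def path_image_rectpath_cbox_minus_box in_cbox_complex_iff in_box_complex_iff)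
    hence n: "w \<notin> closed_segment p q" "w \<notin> closed_segment q q'" "w \<notin> closed_segment q' p'"
      "w \<notin> closed_segment p' p" unfolding img by auto
    have nE: "w \<notin> path_image E" using E(4) w by auto
    have pE: "path E" using E(1) by (rule valid_path_imp_path)
    have 1: "winding_number (E +++ linepath q q') w = winding_number E w + winding_number (linepath q q') w"
      using n nE pE E by (intro winding_number_join) auto
    have 2: "winding_number ((E +++ linepath q q') +++ linepath q' p') w =
        winding_number (E +++ linepath q q') w + winding_number (linepath q' p') w"
      using n nE pE E by (intro winding_number_join) (auto simp: path_image_join)
    have 3: "winding_number (linepath p q +++ (E +++ linepath q q') +++ linepath q' p') w =
        winding_number (linepath p q) w + winding_number ((E +++ linepath q q') +++ linepath q' p') w"
      using n nE pE E by (intro winding_number_join) (auto simp: path_image_join)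
    have 4: "winding_number (loop_closed g X) w =
        winding_number (linepath p q +++ (E +++ linepath q q') +++ linepath q' p') w + winding_number (linepath p' p) w"
      unfolding lc using n nE pE E by (intro winding_number_join) (auto simp: path_image_join)
    have 5: "winding_number (rectpath p q') w = winding_number (linepath p q) w +
       (winding_number (linepath q q') w + (winding_number (linepath q' p') w + winding_number (linepath p' p) w))"
      unfolding rect using n by (simp add: winding_number_join path_image_join)
    have 6: "winding_number (rectpath p q') w = (if Re w < xr then 1 else 0)"
    proof (cases "Re w < xr")
      case True
      hence "w \<in> box p q'" using X \<open>\<bar>Im w\<bar> < T\<close> by (auto simp: p_def q'_def in_box_complex_iff)
      thus ?thesis using True by (simp add: winding_number_rectpath)
    next
      case False
      hence "w \<notin> cbox p q'" using \<open>Re w \<noteq> xr\<close> by (auto simp: p_def q'_def in_cbox_complex_iff)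
      thus ?thesis using False X T(1)
        by (subst winding_number_rectpath_outside) (auto simp: p_def q'_def)
    qed
    have "w \<notin> path_image (loop_closed g X)"
      unfolding lc using n nE E by (auto simp: path_image_join)
    thus ?thesis using 1 2 3 4 5 6 by (simp add: algebra_simps)
  qed
  have ev: "eventually (\<lambda>X. X < Re w \<and> X < xr) at_bot" for w :: complex
    using eventually_conj[OF eventually_gt_at_bot[of "Re w"] eventually_gt_at_bot[of xr]] by simp
  have "loop_winds g w 1" if w: "w \<in> L" for w
  proof -
    have "winding_number E w = 0" using E(6) w disj by auto
    hence "w \<notin> path_image (loop_closed g X) \<and> winding_number (loop_closed g X) w = 1"
      if "X < Re w \<and> X < xr" for X using main[of w X] that w L[OF w] by auto
    thus ?thesis unfolding loop_winds_def using ev[of w] by (auto elim: eventually_mono)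
  qed
  moreover have "loop_winds g w 0" if w: "w \<in> R" for w
  proof -
    have "winding_number E w = (if Re w < xr then - 1 else 0)" using E(5,6) w by auto
    hence "w \<notin> path_image (loop_closed g X) \<and> winding_number (loop_closed g X) w = 0"
      if "X < Re w \<and> X < xr" for X using main[of w X] that w by auto
    thus ?thesis unfolding loop_winds_def using ev[of w] by (auto elim: eventually_mono)
  qed
  ultimately have "left_loop g L R"
    unfolding left_loop_def using vg ends T(1) by (auto simp: q_def q'_def)
  thus ?thesis by blast
qed

text \<open>A point on the curve or on one of its two infinite rays lies on all closed-up truncations from
  some cut on.\<close>

lemma left_loop_avoids:
  assumes g: "left_loop g L R" and w: "w \<in> L \<union> R"
  shows "w \<notin> path_image g"
    and "\<And>x. x \<le> Re (pathstart g) \<Longrightarrow> w \<noteq> Complex x (Im (pathstart g))"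
    and "\<And>x. x \<le> Re (pathfinish g) \<Longrightarrow> w \<noteq> Complex x (Im (pathfinish g))"
proof -
  have "eventually (\<lambda>X. w \<notin> path_image (loop_closed g X)) at_bot"
    using g w unfolding left_loop_def loop_winds_def by (auto elim!: eventually_mono)
  then obtain X0 where X0: "\<And>X. X \<le> X0 \<Longrightarrow> w \<notin> path_image (loop_closed g X)"
    unfolding eventually_at_bot_linorder by blast
  have img: "path_image (loop_closed g X) =
      closed_segment (Complex X (Im (pathstart g))) (pathstart g) \<union> path_image g \<union>
      closed_segment (pathfinish g) (Complex X (Im (pathfinish g))) \<union>
      closed_segment (Complex X (Im (pathfinish g))) (Complex X (Im (pathstart g)))" for X
    by (simp add: loop_closed_def loop_trunc_def path_image_join Un_assoc)
  show "w \<notin> path_image g" using X0[of X0] unfolding img by auto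
  show "w \<noteq> Complex x (Im (pathstart g))" if "x \<le> Re (pathstart g)" for x
  proof -
    have "Complex x (Im (pathstart g)) \<in> closed_segment (Complex (min x X0) (Im (pathstart g))) (pathstart g)"
      using that by (subst closed_segment_same_Im) (auto simp: closed_segment_eq_real_ivl)
    thus ?thesis using X0[of "min x X0"] unfolding img by auto
  qed
  show "w \<noteq> Complex x (Im (pathfinish g))" if "x \<le> Re (pathfinish g)" for x
  proof -
    have "Complex x (Im (pathfinish g)) \<in> closed_segment (pathfinish g) (Complex (min x X0) (Im (pathfinish g)))"
      using that by (subst closed_segment_same_Im) (auto simp: closed_segment_eq_real_ivl)
    thus ?thesis using X0[of "min x X0"] unfolding img by auto
  qed
qed

text \<open>Moving the cut from X to X' adds the boundary of a rectangle, which does not wind around points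
  to the right of X. So the winding numbers of these points can be read off at X, while the
  definition of a left loop speaks only about cuts that are far enough to the left, depending on the
  point.\<close>

lemma loop_closed_winding_stable:
  assumes g: "left_loop g L R" and w: "w \<in> L \<union> R" and X: "X' \<le> X" "X < Re w"
    and start: "X \<le> Re (pathstart g)" "X \<le> Re (pathfinish g)"
  shows "winding_number (loop_closed g X') w = winding_number (loop_closed g X) w"
proof -
  define h1 where "h1 = Im (pathstart g)"
  define h2 where "h2 = Im (pathfinish g)"
  have h: "h1 < h2" and vg: "valid_path g" using g by (auto simp: left_loop_def h1_def h2_def)
  have pg: "path g" using vg by (rule valid_path_imp_path)
  note avoid = left_loop_avoids[OF g w, folded h1_def h2_def]
  have seg1: "w \<notin> closed_segment (Complex Y h1) (pathstart g)" if "Y \<le> X" for Y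
  proof
    assume "w \<in> closed_segment (Complex Y h1) (pathstart g)"
    hence "Im w = h1 \<and> Re w \<le> Re (pathstart g)"
      using that start by (subst (asm) closed_segment_same_Im) (auto simp: h1_def closed_segment_eq_real_ivl split: if_splits)
    thus False using avoid(2)[of "Re w"] by (metis complex.collapse)
  qed
  have seg2: "w \<notin> closed_segment (pathfinish g) (Complex Y h2)" if "Y \<le> X" for Y
  proof
    assume "w \<in> closed_segment (pathfinish g) (Complex Y h2)"
    hence "Im w = h2 \<and> Re w \<le> Re (pathfinish g)"
      using that start by (subst (asm) closed_segment_same_Im) (auto simp: h2_def closed_segment_eq_real_ivl split: if_splits)
    thus False using avoid(3)[of "Re w"] by (metis complex.collapse)
  qed
  have seg3: "w \<notin> closed_segment (Complex Y h2) (Complex Y h1)" if "Y \<le> X" for Y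
    using that X by (subst closed_segment_same_Re) auto
  have wind: "winding_number (loop_closed g Y) w =
     winding_number (linepath (Complex Y h1) (pathstart g)) w + winding_number g w +
     winding_number (linepath (pathfinish g) (Complex Y h2)) w +
     winding_number (linepath (Complex Y h2) (Complex Y h1)) w" if Y: "Y \<le> X" for Y
    unfolding loop_closed_def loop_trunc_def h1_def[symmetric] h2_def[symmetric]
    using seg1[OF Y] seg2[OF Y] seg3[OF Y] avoid(1) pg
    by (simp add: winding_number_join path_image_join)
  have in1: "Complex X h1 \<in> closed_segment (Complex X' h1) (pathstart g)"
    using X start by (subst closed_segment_same_Im) (auto simp: h1_def closed_segment_eq_real_ivl)
  have in2: "Complex X h2 \<in> closed_segment (pathfinish g) (Complex X' h2)"
    using X start by (subst closed_segment_same_Im) (auto simp: h2_def closed_segment_eq_real_ivl)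
  have s1: "winding_number (linepath (Complex X' h1) (pathstart g)) w =
     winding_number (linepath (Complex X' h1) (Complex X h1)) w + winding_number (linepath (Complex X h1) (pathstart g)) w"
    using winding_number_split_linepath[OF in1 seg1[OF X(1)]] .
  have s2: "winding_number (linepath (pathfinish g) (Complex X' h2)) w =
     winding_number (linepath (pathfinish g) (Complex X h2)) w + winding_number (linepath (Complex X h2) (Complex X' h2)) w"
    using winding_number_split_linepath[OF in2 seg2[OF X(1)]] .
  have n1: "w \<notin> closed_segment (Complex X' h1) (Complex X h1)"
    using X by (subst closed_segment_same_Im) (auto simp: closed_segment_eq_real_ivl)
  have n2: "w \<notin> closed_segment (Complex X h2) (Complex X' h2)"
    using X by (subst closed_segment_same_Im) (auto simp: closed_segment_eq_real_ivl)
  have n3: "w \<notin> closed_segment (Complex X h1) (Complex X h2)"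
    using X by (subst closed_segment_same_Re) auto
  have rev: "winding_number (linepath (Complex X h1) (Complex X h2)) w = - winding_number (linepath (Complex X h2) (Complex X h1)) w"
    using winding_number_reversepath[of "linepath (Complex X h2) (Complex X h1)" w] seg3[of X] by simp
  have "winding_number (rectpath (Complex X' h1) (Complex X h2)) w = 0"
    using X h by (intro winding_number_rectpath_outside) (auto simp: in_cbox_complex_iff)
  moreover have "winding_number (rectpath (Complex X' h1) (Complex X h2)) w =
     winding_number (linepath (Complex X' h1) (Complex X h1)) w + winding_number (linepath (Complex X h1) (Complex X h2)) w +
     winding_number (linepath (Complex X h2) (Complex X' h2)) w + winding_number (linepath (Complex X' h2) (Complex X' h1)) w"
    unfolding rectpath_def Let_def using n1 n2 n3 seg3[OF X(1)]
    by (simp add: winding_number_join path_image_join)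
  ultimately show ?thesis
    unfolding wind[OF X(1)] wind[OF order.refl] s1 s2 rev by (simp add: algebra_simps)
qed

section \<open>Left loop integrals as sums of residues\<close>

context decaying_meromorphic
begin

lemma loop_trunc_integral_pieces:
  assumes f: "f holomorphic_on - poles"
    and g: "left_loop g (descending A) R" and BR: "B \<subseteq> R"
    and X: "X \<le> Re (pathstart g)" "X \<le> Re (pathfinish g)"
  shows "contour_integral (loop_trunc g X) f =
      contour_integral (linepath (Complex X (Im (pathstart g))) (pathstart g)) f + contour_integral g f +
      contour_integral (linepath (pathfinish g) (Complex X (Im (pathfinish g)))) f"
    and "f contour_integrable_on loop_trunc g X"
    and "path_image (loop_trunc g X) \<inter> (descending A \<union> R) = {}"
proof -
  have vg: "valid_path g" using g by (simp add: left_loop_def)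
  note avoid = left_loop_avoids[OF g]
  have 1: "closed_segment (Complex X (Im (pathstart g))) (pathstart g) \<inter> (descending A \<union> R) = {}"
  proof -
    have "w = Complex (Re w) (Im (pathstart g)) \<and> Re w \<le> Re (pathstart g)"
      if "w \<in> closed_segment (Complex X (Im (pathstart g))) (pathstart g)" for w
      using that X by (subst (asm) closed_segment_same_Im) (auto simp: closed_segment_eq_real_ivl complex_eq_iff split: if_splits)
    thus ?thesis using avoid(2) by blast
  qed
  have 2: "closed_segment (pathfinish g) (Complex X (Im (pathfinish g))) \<inter> (descending A \<union> R) = {}"
  proof -
    have "w = Complex (Re w) (Im (pathfinish g)) \<and> Re w \<le> Re (pathfinish g)"
      if "w \<in> closed_segment (pathfinish g) (Complex X (Im (pathfinish g)))" for w
      using that X by (subst (asm) closed_segment_same_Im) (auto simp: closed_segment_eq_real_ivl complex_eq_iff split: if_splits)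
    thus ?thesis using avoid(3) by blast
  qed
  have 3: "path_image g \<inter> (descending A \<union> R) = {}" using avoid(1) by blast
  have sub: "poles \<subseteq> descending A \<union> R" using BR by (auto simp: poles_def)
  have i1: "f contour_integrable_on linepath (Complex X (Im (pathstart g))) (pathstart g)"
    using 1 sub by (intro contour_integrable_holomorphic_simple[OF f open_non_poles]) auto
  have i2: "f contour_integrable_on linepath (pathfinish g) (Complex X (Im (pathfinish g)))"
    using 2 sub by (intro contour_integrable_holomorphic_simple[OF f open_non_poles]) auto
  have i3: "f contour_integrable_on g"
    using 3 sub vg by (intro contour_integrable_holomorphic_simple[OF f open_non_poles]) auto
  show "contour_integral (loop_trunc g X) f =
      contour_integral (linepath (Complex X (Im (pathstart g))) (pathstart g)) f + contour_integral g f +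
      contour_integral (linepath (pathfinish g) (Complex X (Im (pathfinish g)))) f"
    "f contour_integrable_on loop_trunc g X"
    unfolding loop_trunc_def using i1 i2 i3 vg
    by (simp_all add: valid_path_join contour_integrable_join)
  show "path_image (loop_trunc g X) \<inter> (descending A \<union> R) = {}"
    unfolding loop_trunc_def using 1 2 3 by (auto simp: path_image_join)
qed

text \<open>At a cut X on one of the lines Re s = x0 - K, the closed-up loop winds once around the points of
  the descending chains to the right of the cut, and around no other pole.\<close>

lemma left_loop_residues:
  assumes f: "f holomorphic_on - poles"
    and g: "left_loop g (descending A) R" and BR: "B \<subseteq> R"
    and X: "X = x0 - real K" "\<And>s. s \<in> path_image g \<Longrightarrow> X < Re s"
  shows "contour_integral (loop_trunc g X) f +
      contour_integral (linepath (Complex X (Im (pathfinish g))) (Complex X (Im (pathstart g)))) f =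
      2 * of_real pi * \<i> * (\<Sum>p\<in>{p \<in> descending A. X < Re p}. residue f p)"
proof -
  have vg: "valid_path g" using g by (simp add: left_loop_def)
  have start: "X < Re (pathstart g)" "X < Re (pathfinish g)"
    using X(2) pathstart_in_path_image pathfinish_in_path_image by auto
  note pieces = loop_trunc_integral_pieces[OF f g BR less_imp_le[OF start(1)] less_imp_le[OF start(2)]]
  define c where "c = linepath (Complex X (Im (pathfinish g))) (Complex X (Im (pathstart g)))"
  have c_Re: "Re s = X" if "s \<in> path_image c" for s
    using that unfolding c_def path_image_linepath by (subst (asm) closed_segment_same_Re) auto
  have nX: "Re p \<noteq> X" if "p \<in> poles" for p
  proof
    assume "Re p = X"
    hence "Re p - x0 = of_int (- int K)" using X(1) by simp
    thus False using Re_off_lines[OF that] Ints_of_int by metis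
  qed
  have c_poles: "path_image c \<inter> poles = {}" using c_Re nX by blast
  have vt: "valid_path (loop_trunc g X)"
    unfolding loop_trunc_def using vg by (intro valid_path_join) auto
  have lc: "loop_closed g X = loop_trunc g X +++ c" by (simp add: loop_closed_def c_def)
  have ends: "pathstart (loop_trunc g X) = Complex X (Im (pathstart g))" 
     "pathfinish (loop_trunc g X) = Complex X (Im (pathfinish g))"
    by (simp_all add: loop_trunc_def)
  have sub: "poles \<subseteq> descending A \<union> R" using BR by (auto simp: poles_def)
  have ic: "f contour_integrable_on c"
    using c_poles by (intro contour_integrable_holomorphic_simple[OF f open_non_poles]) (auto simp: c_def)
  have eq: "contour_integral (loop_closed g X) f = contour_integral (loop_trunc g X) f + contour_integral c f"
    unfolding lc using pieces(2) ic vt ends by (intro contour_integral_join) (auto simp: c_def)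
  have trunc_Re: "X \<le> Re s" if "s \<in> path_image (loop_trunc g X)" for s
  proof -
    have "s \<in> closed_segment (Complex X (Im (pathstart g))) (pathstart g) \<or> s \<in> path_image g \<or>
       s \<in> closed_segment (pathfinish g) (Complex X (Im (pathfinish g)))"
      using that unfolding loop_trunc_def by (auto simp: path_image_join)
    moreover have "X \<le> Re s" if "s \<in> closed_segment (Complex X (Im (pathstart g))) (pathstart g)"
      using that start by (subst (asm) closed_segment_same_Im) (auto simp: closed_segment_eq_real_ivl)
    moreover have "X \<le> Re s" if "s \<in> closed_segment (pathfinish g) (Complex X (Im (pathfinish g)))"
      using that start by (subst (asm) closed_segment_same_Im) (auto simp: closed_segment_eq_real_ivl)
    ultimately show ?thesis using X(2)[of s] by auto
  qed
  have img: "path_image (loop_closed g X) = path_image (loop_trunc g X) \<union> path_image c"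
    unfolding lc using ends by (simp add: path_image_join c_def)
  have vl: "valid_path (loop_closed g X)"
    unfolding lc using vt ends by (intro valid_path_join) (auto simp: c_def)
  have closed: "pathfinish (loop_closed g X) = pathstart (loop_closed g X)"
    unfolding lc by (simp add: ends c_def)
  have outside: "winding_number (loop_closed g X) w = 0" if "Re w < X" for w
  proof (rule winding_number_zero_outside)
    show "path_image (loop_closed g X) \<subseteq> {s. X \<le> Re s}" using trunc_Re c_Re unfolding img by force
    show "convex {s. X \<le> Re s}" using convex_halfspace_Re_ge[of X] by simp
  qed (use that vl closed valid_path_imp_path in auto)
  have wind: "winding_number (loop_closed g X) w = m"
    if w: "w \<in> descending A \<union> R" "X < Re w" "loop_winds g w m" for w m
  proof -
    obtain X1 where X1: "\<And>Y. Y \<le> X1 \<Longrightarrow> winding_number (loop_closed g Y) w = m"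
      using w(3) unfolding loop_winds_def eventually_at_bot_linorder by blast
    have "winding_number (loop_closed g (min X X1)) w = winding_number (loop_closed g X) w"
      using w start by (intro loop_closed_winding_stable[OF g]) auto
    thus ?thesis using X1[of "min X X1"] by simp
  qed
  define S where "S = {s. X - 1 < Re s}"
  define Q where "Q = {p \<in> poles. X - 1 < Re p}"
  have "contour_integral (loop_closed g X) f =
      complex_of_real (2 * pi) * \<i> * (\<Sum>p\<in>Q. winding_number (loop_closed g X) p * residue f p)"
  proof (rule Residue_theorem)
    show "open S" unfolding S_def by (rule open_halfspace_Re_gt)
    show "connected S" unfolding S_def by (intro convex_connected convex_halfspace_Re_gt)
    show "finite Q" unfolding Q_def by (rule finite_poles_right)
    show "f holomorphic_on S - Q" by (rule holomorphic_on_subset[OF f]) (auto simp: S_def Q_def)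
    show "path_image (loop_closed g X) \<subseteq> S - Q"
    proof -
      have "path_image (loop_closed g X) \<subseteq> S"
        using trunc_Re c_Re unfolding img S_def by force
      moreover have "path_image (loop_closed g X) \<inter> poles = {}"
        using c_poles pieces(3) sub unfolding img by blast
      ultimately show ?thesis by (auto simp: Q_def)
    qed
    show "\<forall>z. z \<notin> S \<longrightarrow> winding_number (loop_closed g X) z = 0"
      using outside by (auto simp: S_def)
  qed (use vl closed in auto)
  also have "(\<Sum>p\<in>Q. winding_number (loop_closed g X) p * residue f p) =
      (\<Sum>p\<in>{p \<in> descending A. X < Re p}. residue f p)"
  proof (rule sum.mono_neutral_cong_right)
    show "finite Q" unfolding Q_def by (rule finite_poles_right)
    show "{p \<in> descending A. X < Re p} \<subseteq> Q" by (auto simp: Q_def poles_def)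
    show "\<forall>i\<in>Q - {p \<in> descending A. X < Re p}. winding_number (loop_closed g X) i * residue f i = 0"
    proof
      fix p assume p: "p \<in> Q - {p \<in> descending A. X < Re p}"
      hence pp: "p \<in> poles" by (auto simp: Q_def)
      have "winding_number (loop_closed g X) p = 0"
      proof (cases "Re p < X")
        case False
        hence "X < Re p" using nX[OF pp] by auto
        moreover from this have "p \<in> R" using p pp BR by (auto simp: poles_def)
        moreover from this have "loop_winds g p 0" using g by (auto simp: left_loop_def)
        ultimately show ?thesis by (intro wind) auto
      qed (rule outside)
      thus "winding_number (loop_closed g X) p * residue f p = 0" by simp
    qed
    fix p assume p: "p \<in> {p \<in> descending A. X < Re p}"
    hence "loop_winds g p 1" using g by (auto simp: left_loop_def)
    thus "winding_number (loop_closed g X) p * residue f p = residue f p" using p wind[of p 1] by simp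
  qed
  finally show ?thesis using eq by (simp add: c_def)
qed

lemma decay_factor_le_1: "(1 + norm s) powr (- \<rho>) \<le> 1" for s :: complex
proof -
  have "(1 + norm s) powr (- \<rho>) \<le> (1 + norm s) powr 0" using rho_pos by (intro powr_mono) auto
  also have "1 + norm s \<noteq> 0" using norm_ge_zero[of s] by linarith
  hence "(1 + norm s) powr 0 = 1" by simp
  finally show ?thesis .
qed

text \<open>The rays of a left loop may run between the heights of the poles, outside the set of contours used
  so far. Far enough to the left they keep a positive distance from the finitely many chains, unless
  one of these has the same height.\<close>

lemma ray_bound:
  assumes h: "\<And>p. p \<in> A \<Longrightarrow> Im p \<noteq> h" and X0: "\<And>p. p \<in> B \<Longrightarrow> X0 < Re p - 1"
  shows "\<exists>C\<ge>0. \<forall>x\<le>X0. norm (F (Complex x h)) \<le> C"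
proof -
  define \<delta> where "\<delta> = Min (insert 1 ((\<lambda>p. \<bar>Im p - h\<bar>) ` A))"
  have fin: "finite (insert 1 ((\<lambda>p. \<bar>Im p - h\<bar>) ` A))" using finA by simp
  have \<delta>: "\<delta> > 0" unfolding \<delta>_def using fin h by (subst Min_gr_iff) auto
  have \<delta>1: "\<delta> \<le> 1" unfolding \<delta>_def using fin by (intro Min_le) auto
  obtain C where C: "\<forall>s. (\<forall>p\<in>descending A \<union> B. \<delta> \<le> dist s p) \<longrightarrow> norm (F s) \<le> C * (1 + norm s) powr (- \<rho>)"
    using decay[OF \<delta>] by blast
  have "norm (F (Complex x h)) \<le> \<bar>C\<bar>" if x: "x \<le> X0" for x
  proof -
    have "\<delta> \<le> dist (Complex x h) p" if p: "p \<in> descending A \<union> B" for p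
    proof (cases "p \<in> B")
      case True
      have "\<delta> \<le> \<bar>Re (Complex x h - p)\<bar>" using \<delta>1 X0[OF True] x by simp
      also have "\<dots> \<le> dist (Complex x h) p" unfolding dist_norm by (rule abs_Re_le_cmod)
      finally show ?thesis .
    next
      case False
      then obtain a l where a: "a \<in> A" "p = a - of_nat l" using p by (auto simp: descending_def)
      have "\<delta> \<le> \<bar>Im a - h\<bar>" unfolding \<delta>_def using fin a by (intro Min_le) auto
      also have "\<dots> = \<bar>Im (Complex x h - p)\<bar>" using a by simp
      also have "\<dots> \<le> dist (Complex x h) p" unfolding dist_norm by (rule abs_Im_le_cmod)
      finally show ?thesis .
    qed
    hence "norm (F (Complex x h)) \<le> C * (1 + norm (Complex x h)) powr (- \<rho>)" using C by blast
    also have "\<dots> \<le> \<bar>C\<bar> * 1"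
      by (intro mult_mono decay_factor_le_1) auto
    finally show ?thesis by simp
  qed
  thus ?thesis by (intro exI[of _ "\<bar>C\<bar>"]) auto
qed

text \<open>A chain at the height of a ray would run into it.\<close>

lemma height_avoids_poles:
  assumes "\<And>w x. w \<in> descending A \<Longrightarrow> x \<le> X \<Longrightarrow> w \<noteq> Complex x h" and p: "p \<in> A"
  shows "Im p \<noteq> h"
proof
  assume "Im p = h"
  define l where "l = nat \<lceil>Re p - X\<rceil>"
  have "Re p - real l \<le> X" unfolding l_def by linarith
  moreover have "p - of_nat l = Complex (Re p - real l) h" using \<open>Im p = h\<close> by (simp add: complex_eq_iff)
  moreover have "p - of_nat l \<in> descending A" using p by (auto simp: descending_def)
  ultimately show False using assms(1) by blast
qed

lemma norm_kernel_segment_le: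
  fixes t :: real
  assumes t: "t \<in> {0<..<1}" and C: "C \<ge> 0"
    and seg: "\<And>s. s \<in> closed_segment p q \<Longrightarrow> s \<notin> poles \<and> norm (F s) \<le> C \<and> Re s \<le> x0 - real K"
  shows "norm (contour_integral (linepath p q) (\<lambda>s. F s * of_real t powr (- s))) \<le>
           C * (t powr (- x0) * t ^ K) * norm (q - p)"
proof (rule contour_integral_bound_linepath)
  have "(\<lambda>s. F s * of_real t powr (- s)) holomorphic_on - poles" using t by (intro holomorphic_kernel) auto
  thus "(\<lambda>s. F s * of_real t powr (- s)) contour_integrable_on linepath p q"
    using seg by (intro contour_integrable_holomorphic_simple[OF _ open_non_poles]) auto
  show "norm (F s * of_real t powr (- s)) \<le> C * (t powr (- x0) * t ^ K)" if s: "s \<in> closed_segment p q" for s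
  proof -
    have "t powr (- Re s) \<le> t powr (real K - x0)" using seg[OF s] t by (intro powr_mono') auto
    also have "\<dots> = t powr (- x0) * t ^ K" using t by (simp add: powr_diff powr_minus_divide powr_realpow)
    finally have "norm (of_real t powr (- s) :: complex) \<le> t powr (- x0) * t ^ K"
      using t by (simp add: norm_powr_real_powr)
    thus ?thesis unfolding norm_mult using seg[OF s] C by (intro mult_mono) auto
  qed
qed (use t C in auto)

text \<open>The truncation at X differs from the one at the next grid line by two horizontal segments of
  length at most 1, and the latter from the sum of residues by a vertical segment of fixed length. On
  all three |t^(-s)| is at most a constant times t^K, whereas F is bounded.\<close>

lemma left_loop_estimate:
  fixes t :: real
  assumes t: "t \<in> {0<..<1}" and g: "left_loop g (descending A) R" and BR: "B \<subseteq> R"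
  defines "f \<equiv> (\<lambda>s. F s * of_real t powr (- s))"
  shows "\<exists>M X1. \<forall>X\<le>X1. norm (contour_integral (loop_trunc g X) f -
      2 * of_real pi * \<i> * (\<Sum>p\<in>{p \<in> descending A. x0 - real (nat \<lfloor>x0 - X\<rfloor>) < Re p}. residue f p))
      \<le> M * t ^ nat \<lfloor>x0 - X\<rfloor>"
proof -
  define h1 where "h1 = Im (pathstart g)"
  define h2 where "h2 = Im (pathfinish g)"
  have f: "f holomorphic_on - poles" unfolding f_def using t by (intro holomorphic_kernel) auto
  have vg: "valid_path g" using g by (simp add: left_loop_def)
  have "bounded (path_image g)" using vg valid_path_imp_path bounded_path_image by blast
  then obtain D where D: "\<And>s. s \<in> path_image g \<Longrightarrow> norm s \<le> D" unfolding bounded_iff by blast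
  (* To the left of X0 the loop consists of its two rays, and no point of B is closer than 1. *)
  define X0 where "X0 = Min (insert (- D - 1) ((\<lambda>p. Re p - 2) ` B))"
  have finX: "finite (insert (- D - 1) ((\<lambda>p. Re p - 2) ` B))" using finB by simp
  have X0B: "X0 < Re p - 1" if "p \<in> B" for p
  proof -
    have "X0 \<le> Re p - 2" unfolding X0_def using finX that by (intro Min_le) auto
    thus ?thesis by simp
  qed
  have X0g: "X0 < Re s" if "s \<in> path_image g" for s
  proof -
    have "X0 \<le> - D - 1" unfolding X0_def using finX by (intro Min_le) auto
    thus ?thesis using D[OF that] abs_Re_le_cmod[of s] by linarith
  qed
  have start: "X0 < Re (pathstart g)" "X0 < Re (pathfinish g)"
    using X0g pathstart_in_path_image pathfinish_in_path_image by auto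
  note avoid = left_loop_avoids[OF g, folded h1_def h2_def]
  have h1A: "Im p \<noteq> h1" if "p \<in> A" for p
    using height_avoids_poles[of "Re (pathstart g)" h1 p] avoid(2) that by blast
  have h2A: "Im p \<noteq> h2" if "p \<in> A" for p
    using height_avoids_poles[of "Re (pathfinish g)" h2 p] avoid(3) that by blast
  obtain C1 where C1: "C1 \<ge> 0" "\<And>x. x \<le> X0 \<Longrightarrow> norm (F (Complex x h1)) \<le> C1"
    using ray_bound[OF h1A X0B] by blast
  obtain C2 where C2: "C2 \<ge> 0" "\<And>x. x \<le> X0 \<Longrightarrow> norm (F (Complex x h2)) \<le> C2"
    using ray_bound[OF h2A X0B] by blast
  obtain C3 where C3: "C3 \<ge> 0" "\<forall>s\<in>grid. norm (F s) \<le> C3 * (1 + norm s) powr (- \<rho>)"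
    using grid_bound by blast
  define M where "M = t powr (- x0) * (C1 + C2 + C3 * \<bar>h2 - h1\<bar>)"
  have main: "norm (contour_integral (loop_trunc g X) f -
      2 * of_real pi * \<i> * (\<Sum>p\<in>{p \<in> descending A. x0 - real (nat \<lfloor>x0 - X\<rfloor>) < Re p}. residue f p))
      \<le> M * t ^ nat \<lfloor>x0 - X\<rfloor>" if X: "X \<le> min X0 x0 - 1" for X
  proof -
    define K where "K = nat \<lfloor>x0 - X\<rfloor>"
    (* the first grid line at or to the right of X; the residues are counted there *)
    define Y where "Y = x0 - real K"
    have K: "real K \<le> x0 - X" "x0 - X < real K + 1" using X unfolding K_def by linarith+
    have Y: "X \<le> Y" "Y < X + 1" "Y \<le> X0" using K X unfolding Y_def by linarith+
    define e where "e = t powr (- x0) * t ^ K"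
    have e0: "e \<ge> 0" using t by (simp add: e_def)
    define r1 where "r1 = contour_integral (linepath (Complex X h1) (Complex Y h1)) f"
    define r2 where "r2 = contour_integral (linepath (Complex Y h2) (Complex X h2)) f"
    define r3 where "r3 = contour_integral (linepath (Complex Y h2) (Complex Y h1)) f"
    have XY: "X \<le> Re (pathstart g)" "X \<le> Re (pathfinish g)" "Y \<le> Re (pathstart g)" "Y \<le> Re (pathfinish g)"
      using start Y X by auto
    note pX = loop_trunc_integral_pieces[OF f g BR XY(1,2), folded h1_def h2_def]
    note pY = loop_trunc_integral_pieces[OF f g BR XY(3,4), folded h1_def h2_def]
    have in1: "Complex Y h1 \<in> closed_segment (Complex X h1) (pathstart g)"
      using XY Y by (subst closed_segment_same_Im) (auto simp: h1_def closed_segment_eq_real_ivl)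
    have in2: "Complex Y h2 \<in> closed_segment (pathfinish g) (Complex X h2)"
      using XY Y by (subst closed_segment_same_Im) (auto simp: h2_def closed_segment_eq_real_ivl)
    have sub: "poles \<subseteq> descending A \<union> R" using BR by (auto simp: poles_def)
    have segs: "path_image (loop_trunc g X) = closed_segment (Complex X h1) (pathstart g) \<union> path_image g \<union>
        closed_segment (pathfinish g) (Complex X h2)"
      by (simp add: loop_trunc_def path_image_join h1_def h2_def Un_assoc)
    have np: "closed_segment (Complex X h1) (pathstart g) \<subseteq> - poles" "closed_segment (pathfinish g) (Complex X h2) \<subseteq> - poles"
      using pX(3) sub unfolding segs by auto
    have cont: "continuous_on (closed_segment (Complex X h1) (pathstart g)) f"
      "continuous_on (closed_segment (pathfinish g) (Complex X h2)) f"
      using continuous_on_subset[OF holomorphic_on_imp_continuous_on[OF f]] np by auto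
    have s1: "contour_integral (linepath (Complex X h1) (pathstart g)) f = r1 + contour_integral (linepath (Complex Y h1) (pathstart g)) f"
      unfolding r1_def using contour_integral_split_linepath[OF cont(1) in1] .
    have s2: "contour_integral (linepath (pathfinish g) (Complex X h2)) f = contour_integral (linepath (pathfinish g) (Complex Y h2)) f + r2"
      unfolding r2_def using contour_integral_split_linepath[OF cont(2) in2] .
    have eq: "contour_integral (loop_trunc g X) f = contour_integral (loop_trunc g Y) f + r1 + r2"
      unfolding pX(1) pY(1) s1 s2 by simp
    have res: "contour_integral (loop_trunc g Y) f + r3 =
       2 * of_real pi * \<i> * (\<Sum>p\<in>{p \<in> descending A. Y < Re p}. residue f p)"
      unfolding r3_def h1_def h2_def
      by (rule left_loop_residues[OF f g BR Y_def]) (use X0g Y in force)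
    have b1: "norm r1 \<le> C1 * e * norm (Complex Y h1 - Complex X h1)"
      unfolding r1_def f_def e_def
    proof (rule norm_kernel_segment_le[OF t C1(1)])
      fix s assume s: "s \<in> closed_segment (Complex X h1) (Complex Y h1)"
      have h: "s = Complex (Re s) h1" "Re s \<le> Y"
        using s Y by (subst (asm) closed_segment_same_Im; force simp: closed_segment_eq_real_ivl complex_eq_iff split: if_splits)+
      have "s \<in> closed_segment (Complex X h1) (pathstart g)"
        using s in1 subset_closed_segment ends_in_segment(1) by blast
      thus "s \<notin> poles \<and> norm (F s) \<le> C1 \<and> Re s \<le> x0 - real K"
        using np(1) h C1(2)[of "Re s"] Y unfolding Y_def by auto
    qed
    have b2: "norm r2 \<le> C2 * e * norm (Complex X h2 - Complex Y h2)"
      unfolding r2_def f_def e_def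
    proof (rule norm_kernel_segment_le[OF t C2(1)])
      fix s assume s: "s \<in> closed_segment (Complex Y h2) (Complex X h2)"
      have h: "s = Complex (Re s) h2" "Re s \<le> Y"
        using s Y by (subst (asm) closed_segment_same_Im; force simp: closed_segment_eq_real_ivl complex_eq_iff split: if_splits)+
      have "s \<in> closed_segment (pathfinish g) (Complex X h2)"
        using s in2 subset_closed_segment ends_in_segment(2) by blast
      thus "s \<notin> poles \<and> norm (F s) \<le> C2 \<and> Re s \<le> x0 - real K"
        using np(2) h C2(2)[of "Re s"] Y unfolding Y_def by auto
    qed
    have b3: "norm r3 \<le> C3 * e * norm (Complex Y h1 - Complex Y h2)"
      unfolding r3_def f_def e_def
    proof (rule norm_kernel_segment_le[OF t C3(1)])
      fix s assume "s \<in> closed_segment (Complex Y h2) (Complex Y h1)"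
      hence s: "Re s = Y" by (subst (asm) closed_segment_same_Re) auto
      hence "Re s - x0 = of_int (- int K)" by (simp add: Y_def)
      hence "s \<in> grid" unfolding grid_def using Ints_of_int by (metis mem_Collect_eq)
      moreover from this have "norm (F s) \<le> C3 * (1 + norm s) powr (- \<rho>)" using C3 by blast
      moreover have "\<dots> \<le> C3 * 1" by (intro mult_left_mono C3 decay_factor_le_1)
      ultimately show "s \<notin> poles \<and> norm (F s) \<le> C3 \<and> Re s \<le> x0 - real K"
        using s grid_disjoint_poles by (auto simp: Y_def)
    qed
    have n1: "norm (Complex Y h1 - Complex X h1) \<le> 1" "norm (Complex X h2 - Complex Y h2) \<le> 1"
      using Y by (simp_all add: cmod_def)
    have n3: "norm (Complex Y h1 - Complex Y h2) = \<bar>h2 - h1\<bar>" by (simp add: cmod_def)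
    have "contour_integral (loop_trunc g X) f - 2 * of_real pi * \<i> * (\<Sum>p\<in>{p \<in> descending A. Y < Re p}. residue f p)
        = r1 + r2 - r3"
      unfolding eq res[symmetric] by simp
    also have "norm \<dots> \<le> norm r1 + norm r2 + norm r3"
      by (intro norm_triangle_le_diff add_mono norm_triangle_ineq order.refl)
    also have "\<dots> \<le> C1 * e * 1 + C2 * e * 1 + C3 * e * \<bar>h2 - h1\<bar>"
    proof (intro add_mono)
      show "norm r1 \<le> C1 * e * 1" using b1 n1 C1 e0 by (elim order_trans) (intro mult_left_mono, auto)
      show "norm r2 \<le> C2 * e * 1" using b2 n1 C2 e0 by (elim order_trans) (intro mult_left_mono, auto)
      show "norm r3 \<le> C3 * e * \<bar>h2 - h1\<bar>" using b3 n3 by simp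
    qed
    also have "\<dots> = M * t ^ K" by (simp add: M_def e_def algebra_simps)
    finally show ?thesis unfolding Y_def K_def .
  qed
  show ?thesis using main by blast
qed

text \<open>The value is the same for all left loops: the sum of all residues except those at B, which a left
  loop leaves on its right.\<close>

lemma loop_integral_left_loop:
  fixes t :: real
  assumes t: "t \<in> {0<..<1}" and g: "left_loop g (descending A) R" and BR: "B \<subseteq> R"
    and I: "\<And>s. s \<notin> descending A \<union> R \<Longrightarrow> I s = F s * of_real t powr (- s)"
  shows "loop_integral g I = 2 * of_real pi * \<i> *
     (mellin_density t - (\<Sum>p\<in>B. residue (\<lambda>s. F s * of_real t powr (- s)) p))"
proof -
  define f where "f s = F s * of_real t powr (- s)" for s
  have f: "f holomorphic_on - poles" unfolding f_def using t by (intro holomorphic_kernel) auto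
  have disj: "descending A \<inter> B = {}"
  proof (rule ccontr)
    assume "descending A \<inter> B \<noteq> {}"
    then obtain w where "w \<in> descending A" "w \<in> R" using BR by auto
    hence "loop_winds g w 1" "loop_winds g w 0" using g by (auto simp: left_loop_def)
    hence "eventually (\<lambda>X. winding_number (loop_closed g X) w = 1 \<and>
        winding_number (loop_closed g X) w = 0) at_bot"
      unfolding loop_winds_def by eventually_elim simp
    hence "eventually (\<lambda>X::real. False) at_bot" by eventually_elim (metis zero_neq_one)
    thus False by (metis eventually_False trivial_limit_at_bot_linorder)
  qed
  define N where "N X = nat \<lfloor>x0 - X\<rfloor>" for X
  have N_lim: "filterlim N at_top at_bot"
    unfolding filterlim_at_top
  proof
    fix Z
    show "eventually (\<lambda>X. Z \<le> N X) at_bot"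
      using eventually_le_at_bot[of "x0 - real Z"]
      by eventually_elim (auto simp: N_def le_nat_floor le_nat_iff le_floor_iff)
  qed
  define R' where "R' K = 2 * of_real pi * \<i> * (\<Sum>p\<in>{p \<in> descending A. x0 - real K < Re p}. residue f p)" for K
  obtain M X1 where M: "\<And>X. X \<le> X1 \<Longrightarrow> norm (contour_integral (loop_trunc g X) f - R' (N X)) \<le> M * t ^ N X"
    using left_loop_estimate[OF t g BR] unfolding R'_def N_def f_def by blast
  have "(\<lambda>K. M * t ^ K) \<longlonglongrightarrow> M * 0" using t by (intro tendsto_intros LIMSEQ_realpow_zero) auto
  hence "((\<lambda>X. M * t ^ N X) \<longlongrightarrow> M * 0) at_bot" using N_lim by (rule filterlim_compose)
  hence lim0: "((\<lambda>X. M * t ^ N X) \<longlongrightarrow> 0) at_bot" by simp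
  have "eventually (\<lambda>X. norm (contour_integral (loop_trunc g X) f - R' (N X)) \<le> M * t ^ N X) at_bot"
    using eventually_le_at_bot[of X1] by eventually_elim (rule M)
  hence diff: "((\<lambda>X. contour_integral (loop_trunc g X) f - R' (N X)) \<longlongrightarrow> 0) at_bot"
    by (rule Lim_null_comparison[OF _ lim0])
  have sums: "(\<lambda>K. \<Sum>k<K. strip_sum k t) \<longlonglongrightarrow> mellin_density t"
    using summable_norm_cancel[OF summable_norm_strip_sum[OF t]] unfolding mellin_density_def
    by (simp add: summable_LIMSEQ)
  define BS where "BS = (\<Sum>p\<in>B. residue f p)"
  have R'_lim: "R' \<longlonglongrightarrow> 2 * of_real pi * \<i> * (mellin_density t - BS)"
  proof (rule Lim_transform_eventually)
    show "(\<lambda>K. 2 * of_real pi * \<i> * ((\<Sum>k<K. strip_sum k t) - BS)) \<longlonglongrightarrow> 2 * of_real pi * \<i> * (mellin_density t - BS)"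
      by (intro tendsto_intros sums)
    define K0 where "K0 = Max (insert 0 ((\<lambda>p. x0 - Re p) ` B))"
    have "eventually (\<lambda>K. K0 < real K) sequentially"
      using filterlim_real_sequentially unfolding filterlim_at_top_dense by blast
    thus "eventually (\<lambda>K. 2 * of_real pi * \<i> * ((\<Sum>k<K. strip_sum k t) - BS) = R' K) sequentially"
    proof eventually_elim
      case (elim K)
      have B: "x0 - real K < Re p" if "p \<in> B" for p
      proof -
        have "x0 - Re p \<le> K0" unfolding K0_def using finB that by (intro Max_ge) auto
        thus ?thesis using elim by simp
      qed
      have "(\<Sum>k<K. strip_sum k t) = (\<Sum>p\<in>{p \<in> poles. x0 - real K < Re p}. residue f p)"
        unfolding strip_sum_def f_def sum_over_strips ..
      also have "{p \<in> poles. x0 - real K < Re p} = {p \<in> descending A. x0 - real K < Re p} \<union> B"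
        using B by (auto simp: poles_def)
      also have "(\<Sum>p\<in>\<dots>. residue f p) = (\<Sum>p\<in>{p \<in> descending A. x0 - real K < Re p}. residue f p) + BS"
        unfolding BS_def
      proof (rule sum.union_disjoint)
        show "finite {p \<in> descending A. x0 - real K < Re p}"
          by (rule finite_subset[OF _ finite_poles_right[of "x0 - real K"]]) (auto simp: poles_def)
      qed (use disj finB in auto)
      finally show ?case by (simp add: R'_def)
    qed
  qed
  have "((\<lambda>X. R' (N X)) \<longlongrightarrow> 2 * of_real pi * \<i> * (mellin_density t - BS)) at_bot"
    using R'_lim N_lim by (rule filterlim_compose)
  from tendsto_add[OF diff this]
  have limf: "((\<lambda>X. contour_integral (loop_trunc g X) f) \<longlongrightarrow> 2 * of_real pi * \<i> * (mellin_density t - BS)) at_bot"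
    by simp
  have "eventually (\<lambda>X. contour_integral (loop_trunc g X) f = contour_integral (loop_trunc g X) I) at_bot"
    using eventually_conj[OF eventually_le_at_bot[of "Re (pathstart g)"] eventually_le_at_bot[of "Re (pathfinish g)"]]
  proof eventually_elim
    case (elim X)
    have "path_image (loop_trunc g X) \<inter> (descending A \<union> R) = {}"
      using loop_trunc_integral_pieces(3)[OF f g BR] elim by blast
    hence "f s = I s" if "s \<in> path_image (loop_trunc g X)" for s
      using I[of s] that unfolding f_def by (metis disjoint_iff)
    thus ?case by (rule contour_integral_eq)
  qed
  with limf have "((\<lambda>X. contour_integral (loop_trunc g X) I) \<longlongrightarrow> 2 * of_real pi * \<i> * (mellin_density t - BS)) at_bot"
    by (rule Lim_transform_eventually)
  thus ?thesis unfolding loop_integral_def BS_def f_def by (intro tendsto_Lim) auto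
qed

end

section \<open>The kernel of the functional\<close>

lemma minus_one_power_cancel: "(- 1) ^ n * ((- 1) ^ n * x) = (x :: complex)"
  by (cases "even n") auto

lemma finite_descending_cball:
  assumes "finite A"
  shows "finite (descending A \<inter> cball 0 r)"
proof -
  have "descending A \<inter> cball 0 r \<subseteq> (\<Union>x\<in>A. (\<lambda>l. x - of_nat l) ` {..nat \<lceil>norm x + r\<rceil>})"
  proof
    fix w assume "w \<in> descending A \<inter> cball 0 r"
    then obtain x l where x: "x \<in> A" "w = x - of_nat l" "norm w \<le> r" by (auto simp: descending_def)
    have "real l = norm (x - w)" by (simp add: x(2))
    also have "\<dots> \<le> norm x + r" using norm_triangle_ineq4[of x w] x(3) by linarith
    finally have "l \<le> nat \<lceil>norm x + r\<rceil>" by linarith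
    thus "w \<in> (\<Union>x\<in>A. (\<lambda>l. x - of_nat l) ` {..nat \<lceil>norm x + r\<rceil>})" using x by auto
  qed
  thus ?thesis by (rule finite_subset) (use assms in auto)
qed

lemma finite_ascending_cball:
  fixes x :: complex
  shows "finite ({x + of_nat k | k. True} \<inter> cball 0 r)"
proof -
  have "{x + of_nat k | k. True} \<inter> cball 0 r \<subseteq> (\<lambda>l. x + of_nat l) ` {..nat \<lceil>norm x + r\<rceil>}"
  proof
    fix w assume "w \<in> {x + of_nat k | k. True} \<inter> cball 0 r"
    then obtain l where x: "w = x + of_nat l" "norm w \<le> r" by auto
    have "real l = norm (w - x)" by (simp add: x)
    also have "\<dots> \<le> norm x + r" using norm_triangle_ineq4[of w x] x(2) by linarith
    finally have "l \<le> nat \<lceil>norm x + r\<rceil>" by linarith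
    thus "w \<in> (\<lambda>l. x + of_nat l) ` {..nat \<lceil>norm x + r\<rceil>}" using x by auto
  qed
  thus ?thesis by (rule finite_subset) auto
qed

lemma pochhammer_neg_of_nat:
  assumes "j \<le> m"
  shows "pochhammer (- of_nat m :: complex) j = (- 1) ^ j * fact m / fact (m - j)"
  using assms
proof (induction j)
  case (Suc j)
  define c :: complex where "c = of_nat (m - j)"
  have "m - j = Suc (m - Suc j)" using Suc.prems by simp
  hence f: "fact (m - j) = c * fact (m - Suc j)" unfolding c_def by (metis fact_Suc of_nat_fact of_nat_mult)
  have c: "- of_nat m + of_nat j = - c" using Suc.prems by (simp add: of_nat_diff c_def)
  have c0: "c \<noteq> 0" using Suc.prems by (simp add: c_def)
  have "pochhammer (- of_nat m) (Suc j) = (- 1) ^ j * fact m / fact (m - j) * (- c)"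
    using Suc by (simp only: pochhammer_Suc c)
  also have "\<dots> = (- 1) ^ Suc j * fact m / fact (m - Suc j)"
    unfolding f using c0 by simp
  finally show ?case .
qed simp

lemma prod_nonzero_shifts:
  assumes "k < n"
  shows "(\<Prod>i\<in>{..<n} - {k}. of_nat i - of_nat k :: complex) = (- 1) ^ k * fact k * fact (n - 1 - k)"
proof -
  have "{..<n} - {k} = {..<k} \<union> {k<..<n}" using assms by auto
  moreover have "{..<k} \<inter> {k<..<n} = {}" by auto
  ultimately have "(\<Prod>i\<in>{..<n} - {k}. of_nat i - of_nat k :: complex) =
     (\<Prod>i<k. of_nat i - of_nat k) * (\<Prod>i\<in>{k<..<n}. of_nat i - of_nat k)"
    using prod.union_disjoint[of "{..<k}" "{k<..<n}" "\<lambda>i. of_nat i - of_nat k :: complex"] by simp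
  also have "(\<Prod>i<k. of_nat i - of_nat k :: complex) = pochhammer (- of_nat k) k"
    by (simp add: pochhammer_prod atLeast0LessThan)
  also have "\<dots> = (- 1) ^ k * fact k" by (simp add: pochhammer_same)
  also have "(\<Prod>i\<in>{k<..<n}. of_nat i - of_nat k :: complex) = (\<Prod>j<n - 1 - k. 1 + of_nat j)"
  proof (rule prod.reindex_bij_witness[of _ "\<lambda>j. j + k + 1" "\<lambda>i. i - k - 1"])
    fix i assume "i \<in> {k<..<n}"
    hence "i = (i - k - 1) + k + 1" by auto
    hence "(of_nat i :: complex) = of_nat (i - k - 1) + of_nat k + 1" by (metis of_nat_1 of_nat_add)
    thus "1 + of_nat (i - k - 1) = (of_nat i - of_nat k :: complex)" by simp
  qed auto
  also have "\<dots> = fact (n - 1 - k)"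
    by (simp add: pochhammer_fact pochhammer_prod atLeast0LessThan)
  finally show ?thesis .
qed

text \<open>The integrand of the Meijer function is this product, divided by the Pochhammer symbol
  (1 - n - s)_n = \<Gamma>(1 - s) / \<Gamma>(1 - n - s), times t^(-s). Reciprocal Gamma functions have the correct
  zeros at the poles of \<Gamma>(b + n - 1 + s), and of the poles on the right of the loop only the n zeros of
  the Pochhammer symbol remain.\<close>

definition kernel_num :: "complex list \<Rightarrow> complex list \<Rightarrow> nat \<Rightarrow> complex \<Rightarrow> complex" where
  "kernel_num a b n s = (\<Prod>x\<leftarrow>a. Gamma (s + (x + of_nat n - 1))) * (\<Prod>y\<leftarrow>b. rGamma (s + (y + of_nat n - 1)))"

definition G_kernel :: "complex list \<Rightarrow> complex list \<Rightarrow> nat \<Rightarrow> complex \<Rightarrow> complex" where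
  "G_kernel a b n s = kernel_num a b n s / pochhammer (1 - of_nat n - s) n"

definition left_tops :: "complex list \<Rightarrow> nat \<Rightarrow> complex set" where
  "left_tops a n = (\<lambda>x. 1 - x - of_nat n) ` set a"

definition right_poles :: "nat \<Rightarrow> complex set" where
  "right_poles n = (\<lambda>k. 1 - of_nat n + of_nat k) ` {..<n}"

lemma prod_list_rGamma_eq: "(\<Prod>y\<leftarrow>b. rGamma (f y)) = inverse (\<Prod>y\<leftarrow>b. Gamma (f y :: complex))"
  by (induction b) (auto simp: rGamma_inverse_Gamma)

lemma kernel_num_eq:
  "kernel_num a b n s = Gamma_vec (shift_vec a (of_nat n - 1 + s)) / Gamma_vec (shift_vec b (of_nat n - 1 + s))"
  unfolding kernel_num_def Gamma_vec_def shift_vec_def prod_list_rGamma_eq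
  by (simp add: o_def divide_inverse algebra_simps)

lemma holomorphic_on_prod_list:
  "(\<And>x. x \<in> set xs \<Longrightarrow> f x holomorphic_on S) \<Longrightarrow> (\<lambda>s. \<Prod>x\<leftarrow>xs. f x s) holomorphic_on S"
  by (induction xs) (auto intro!: holomorphic_intros)

lemma kernel_num_holomorphic: "kernel_num a b n holomorphic_on - descending (left_tops a n)"
proof -
  have "s + (x + of_nat n - 1) \<notin> \<int>\<^sub>\<le>\<^sub>0" if "x \<in> set a" "s \<notin> descending (left_tops a n)" for x s
  proof
    assume "s + (x + of_nat n - 1) \<in> \<int>\<^sub>\<le>\<^sub>0"
    then obtain l where "s + (x + of_nat n - 1) = - of_nat l" by (elim nonpos_Ints_cases') auto
    hence "s = (1 - x - of_nat n) - of_nat l" by (simp add: algebra_simps)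
    thus False using that unfolding descending_def left_tops_def by blast
  qed
  thus ?thesis unfolding kernel_num_def
    by (intro holomorphic_intros holomorphic_on_prod_list) auto
qed

lemma right_poles_iff: "s \<in> right_poles n \<longleftrightarrow> pochhammer (1 - of_nat n - s) n = 0"
proof -
  have "pochhammer (1 - of_nat n - s) n = 0 \<longleftrightarrow> (\<exists>k<n. 1 - of_nat n - s = - of_nat k)"
    by (rule pochhammer_eq_0_iff)
  also have "\<dots> \<longleftrightarrow> s \<in> right_poles n"
    unfolding right_poles_def image_iff Bex_def lessThan_iff
    by (intro ex_cong1 conj_cong refl) (auto simp: algebra_simps)
  finally show ?thesis by simp
qed

lemma G_kernel_holomorphic: "G_kernel a b n holomorphic_on - (descending (left_tops a n) \<union> right_poles n)"
proof -
  have "(\<lambda>s. pochhammer (1 - of_nat n - s) n) holomorphic_on UNIV"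
    unfolding pochhammer_prod by (intro holomorphic_intros)
  thus ?thesis unfolding G_kernel_def
    by (intro holomorphic_on_divide holomorphic_on_subset[OF kernel_num_holomorphic])
       (auto simp: right_poles_iff elim: holomorphic_on_subset)
qed

text \<open>The quotients of Gamma functions contribute |s|^(- Re \<psi>) and the rational factor |s|^(-n), so the
  condition n > - Re \<psi> says that the total exponent is negative.\<close>

lemma G_kernel_decay:
  assumes "length a = length b" and \<delta>: "\<delta> > 0"
  shows "\<exists>C. \<forall>s. (\<forall>p\<in>descending (left_tops a n) \<union> right_poles n. \<delta> \<le> dist s p) \<longrightarrow>
     norm (G_kernel a b n s) \<le> C * (1 + norm s) powr (- (Re (sum_list b - sum_list a) + real n))"
proof -
  define a' where "a' = map (\<lambda>x. x + of_nat n - 1) a"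
  define b' where "b' = map (\<lambda>x. x + of_nat n - 1) b"
  have len: "length a' = length b'" using assms by (simp add: a'_def b'_def)
  have sums: "sum_list b' - sum_list a' = sum_list b - sum_list a"
  proof -
    have "sum_list (map (\<lambda>x. x + of_nat n - 1) xs) = sum_list xs + of_nat (length xs) * (of_nat n - 1 :: complex)" for xs
      by (induction xs) (auto simp: algebra_simps)
    thus ?thesis using assms by (simp add: a'_def b'_def)
  qed
  obtain C where C: "C \<ge> 0" "\<And>s. (\<And>x k. x \<in> set a' \<Longrightarrow> \<delta> \<le> norm (s + x + of_nat k)) \<Longrightarrow>
    norm ((\<Prod>x\<leftarrow>a'. Gamma (s + x)) * (\<Prod>y\<leftarrow>b'. rGamma (s + y)))
      \<le> C * (1 + norm s) powr (- Re (sum_list b' - sum_list a'))"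
    using norm_Gamma_prod_ratio_le[OF len \<delta>] by blast
  define D where "D = 1 + (1 + real n) / \<delta>"
  have D: "D > 0" using \<delta> by (simp add: D_def add_pos_nonneg)
  have "norm (G_kernel a b n s) \<le> C * D ^ n * (1 + norm s) powr (- (Re (sum_list b - sum_list a) + real n))"
    if s: "\<forall>p\<in>descending (left_tops a n) \<union> right_poles n. \<delta> \<le> dist s p" for s
  proof -
    define S where "S = 1 + norm s"
    have S: "S > 0" using norm_ge_zero[of s] unfolding S_def by linarith
    have "\<delta> \<le> norm (s + x' + of_nat k)" if x': "x' \<in> set a'" for x' k
    proof -
      obtain x where x: "x \<in> set a" "x' = x + of_nat n - 1" using x' by (auto simp: a'_def)
      have "(1 - x - of_nat n) - of_nat k \<in> descending (left_tops a n)"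
        using x unfolding descending_def left_tops_def by blast
      hence "\<delta> \<le> dist s ((1 - x - of_nat n) - of_nat k)" using s by blast
      thus ?thesis by (simp add: x dist_norm algebra_simps)
    qed
    from C(2)[OF this] have 1: "norm (kernel_num a b n s) \<le> C * S powr (- Re (sum_list b - sum_list a))"
      unfolding sums by (simp add: kernel_num_def a'_def b'_def o_def S_def)
    have "(S / D) ^ n = (\<Prod>k<n. S / D)" by simp
    also have "\<dots> \<le> (\<Prod>k<n. norm (1 - of_nat n - s + of_nat k))"
    proof (intro prod_mono conjI)
      fix k assume k: "k \<in> {..<n}"
      define p :: complex where "p = 1 - of_nat n + of_nat k"
      have "p \<in> right_poles n" using k by (auto simp: p_def right_poles_def)
      hence sp: "\<delta> \<le> norm (s - p)" using s by (auto simp: dist_norm)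
      have "p = - of_nat (n - 1 - k)" using k by (auto simp: p_def of_nat_diff)
      hence np: "norm p \<le> real n" by (simp only: norm_minus_cancel norm_of_nat)
      have "S \<le> (1 + real n) * 1 + norm (s - p)"
        using norm_triangle_ineq[of "s - p" p] np unfolding S_def by simp
      also have "(1 + real n) * 1 \<le> (1 + real n) * (norm (s - p) / \<delta>)"
        using sp \<delta> by (intro mult_left_mono) auto
      finally have "S \<le> D * norm (s - p)" by (simp add: D_def algebra_simps)
      hence "S / D \<le> norm (s - p)" using D by (simp add: field_simps)
      also have "norm (s - p) = norm (1 - of_nat n - s + of_nat k)"
      proof -
        have "1 - of_nat n - s + of_nat k = p - s" by (simp add: p_def)
        thus ?thesis by (simp only: norm_minus_commute)
      qed
      finally show "S / D \<le> norm (1 - of_nat n - s + of_nat k)" .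
    qed (use S D in auto)
    also have "\<dots> = norm (pochhammer (1 - of_nat n - s) n)"
      by (simp add: pochhammer_prod atLeast0LessThan prod_norm)
    finally have 2: "(S / D) ^ n \<le> norm (pochhammer (1 - of_nat n - s) n)" .
    have "norm (G_kernel a b n s) \<le> (C * S powr (- Re (sum_list b - sum_list a))) / (S / D) ^ n"
      unfolding G_kernel_def norm_divide using 1 2 S D C(1) by (intro frac_le) auto
    also have "\<dots> = C * D ^ n * (S powr (- Re (sum_list b - sum_list a)) * S powr (- real n))"
      using S D by (simp add: power_divide powr_minus_divide powr_realpow field_simps)
    also have "\<dots> = C * D ^ n * S powr (- (Re (sum_list b - sum_list a) + real n))"
      by (simp flip: powr_add)
    finally show ?thesis unfolding S_def .
  qed
  thus ?thesis by blast
qed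

text \<open>The condition n > -a leaves room for a vertical line to the right of all poles and to the left of
  1.\<close>

lemma G_kernel_line_exists:
  fixes a :: "complex list" and n :: nat
  assumes "\<And>x. x \<in> set a \<Longrightarrow> - real n < Re x"
  obtains x0 where "0 < x0" "x0 < 1" "\<And>p. p \<in> left_tops a n \<union> right_poles n \<Longrightarrow> Re p < x0"
    "\<And>p. p \<in> left_tops a n \<union> right_poles n \<Longrightarrow> Re p - x0 \<notin> \<int>"
proof -
  define S where "S = left_tops a n \<union> right_poles n"
  have fin: "finite S" by (simp add: S_def left_tops_def right_poles_def)
  define lo where "lo = Max (insert 0 (Re ` S))"
  have lt1: "Re p < 1" if "p \<in> S" for p
    using that assms unfolding S_def left_tops_def right_poles_def by fastforce
  have lo: "0 \<le> lo" "lo < 1" "\<And>p. p \<in> S \<Longrightarrow> Re p \<le> lo"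
    using fin lt1 by (auto simp: lo_def)
  (* An abscissa is unsuitable if it is an integer translate of the real part of one of the
     finitely many base points, so only countably many are excluded. *)
  define bad where "bad = (\<Union>p\<in>S. (\<lambda>k::int. Re p - of_int k) ` UNIV)"
  have "countable bad" unfolding bad_def using fin by (intro countable_UN countable_image) (auto intro: countable_finite)
  moreover have "uncountable {lo<..<1}" using lo by (simp add: uncountable_open_interval)
  ultimately obtain x0 where x0: "x0 \<in> {lo<..<1}" "x0 \<notin> bad"
    by (metis countable_subset subsetI)
  show thesis
  proof
    show "0 < x0" "x0 < 1" using x0 lo by auto
    fix p assume "p \<in> left_tops a n \<union> right_poles n"
    hence p: "p \<in> S" by (simp add: S_def)
    show "Re p < x0" using lo(3)[OF p] x0 by simp
    show "Re p - x0 \<notin> \<int>"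
    proof
      assume "Re p - x0 \<in> \<int>"
      then obtain k where "Re p - x0 = of_int k" by (elim Ints_cases)
      hence "x0 = Re p - of_int k" by simp
      thus False using x0(2) p unfolding bad_def by blast
    qed
  qed
qed

text \<open>These residues produce the polynomial part of the kernel: at the pole, s + n - 1 = k, so the
  quotient of Gamma functions is \<Gamma>(a + k) / \<Gamma>(b + k) there.\<close>

lemma residue_right_pole:
  fixes t :: real
  assumes k: "k < n" and t: "t > 0"
    and np: "1 - of_nat n + of_nat k \<notin> descending (left_tops a n)"
  shows "residue (\<lambda>s. G_kernel a b n s * of_real t powr (- s)) (1 - of_nat n + of_nat k) =
     - (Gamma_vec (shift_vec a (of_nat k)) / Gamma_vec (shift_vec b (of_nat k)) *
        ((- 1) ^ k / (fact k * fact (n - 1 - k))) * of_real t ^ (n - 1 - k))"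
proof -
  define p :: complex where "p = 1 - of_nat n + of_nat k"
  define Q where "Q s = (\<Prod>i\<in>{..<n} - {k}. 1 - of_nat n - s + of_nat i)" for s :: complex
  (* the factor p - s of the Pochhammer symbol is split off; its sign goes into g *)
  define g where "g s = - (kernel_num a b n s / Q s) * of_real t powr (- s)" for s
  define B' where "B' = (\<lambda>i. 1 - of_nat n + of_nat i :: complex) ` ({..<n} - {k})"
  define S where "S = - (descending (left_tops a n) \<union> B')"
  have poch: "pochhammer (1 - of_nat n - s) n = (p - s) * Q s" for s
  proof -
    have "pochhammer (1 - of_nat n - s) n = (\<Prod>i<n. 1 - of_nat n - s + of_nat i)"
      by (simp add: pochhammer_prod atLeast0LessThan)
    also have "\<dots> = (1 - of_nat n - s + of_nat k) * Q s"
      unfolding Q_def using k by (intro prod.remove) auto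
    finally show ?thesis by (simp add: p_def algebra_simps)
  qed
  have eq: "G_kernel a b n s * of_real t powr (- s) = g s / (s - p)" for s
  proof -
    have "inverse (p - s) = - inverse (s - p)" by (metis inverse_minus_eq minus_diff_eq)
    thus ?thesis unfolding G_kernel_def poch g_def divide_inverse inverse_mult_distrib by simp
  qed
  have opS: "open S"
  proof -
    have "closed (descending (left_tops a n))"
      by (intro closed_if_locally_finite finite_descending_cball) (simp add: left_tops_def)
    moreover have "closed B'" by (intro finite_imp_closed) (simp add: B'_def)
    ultimately show ?thesis unfolding S_def by (intro open_Compl closed_Un)
  qed
  have pB: "p \<notin> B'" by (auto simp: p_def B'_def)
  have pS: "p \<in> S" using np pB by (simp add: S_def p_def)
  have Q0: "Q s \<noteq> 0" if "s \<notin> B'" for s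
  proof
    assume "Q s = 0"
    then obtain i where "i \<in> {..<n} - {k}" "1 - of_nat n - s + of_nat i = 0" by (auto simp: Q_def)
    hence "i \<in> {..<n} - {k}" "s = 1 - of_nat n + of_nat i" by (auto simp: algebra_simps)
    thus False using that unfolding B'_def by blast
  qed
  have "g holomorphic_on S"
    unfolding g_def
  proof (intro holomorphic_intros)
    show "kernel_num a b n holomorphic_on S"
      by (rule holomorphic_on_subset[OF kernel_num_holomorphic]) (auto simp: S_def)
    show "Q holomorphic_on S" unfolding Q_def by (intro holomorphic_intros)
    show "Q s \<noteq> 0" if "s \<in> S" for s using Q0[of s] that by (auto simp: S_def)
  qed
  hence "residue (\<lambda>s. g s / (s - p)) p = g p" by (rule residue_simple[OF opS pS])
  also have "g p = - (Gamma_vec (shift_vec a (of_nat k)) / Gamma_vec (shift_vec b (of_nat k)) *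
        ((- 1) ^ k / (fact k * fact (n - 1 - k))) * of_real t ^ (n - 1 - k))"
  proof -
    have "Q p = (- 1) ^ k * fact k * fact (n - 1 - k)"
      unfolding prod_nonzero_shifts[OF k, symmetric] Q_def by (simp add: p_def algebra_simps)
    moreover have "of_nat n - 1 + p = of_nat k" by (simp add: p_def)
    hence "kernel_num a b n p = Gamma_vec (shift_vec a (of_nat k)) / Gamma_vec (shift_vec b (of_nat k))"
      by (simp add: kernel_num_eq)
    moreover have "- p = of_nat (n - 1 - k)" using k by (simp add: p_def of_nat_diff)
    hence "of_real t powr (- p) = (of_real t ^ (n - 1 - k) :: complex)"
      using t by (simp add: powr_nat)
    moreover have "x / ((- 1) ^ k * u * v) = x * ((- 1) ^ k / (u * v))" for x u v :: complex
      by (cases "even k") auto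
    ultimately show ?thesis unfolding g_def by simp
  qed
  finally show ?thesis unfolding eq p_def .
qed

lemma G_hat_representation:
  fixes a b :: "complex list" and n :: nat
  assumes len: "length a = length b" and a: "\<forall>x\<in>set a. - x \<notin> \<nat>"
    and n: "\<forall>x\<in>set a. - real n < Re x" "- real n < Re (sum_list b - sum_list a)"
  obtains V where "\<And>q. set_integrable lborel {0<..<1} (\<lambda>t. V t * of_real t ^ q)"
    "\<And>q. (LINT t:{0<..<1}|lborel. V t * of_real t ^ q) = G_kernel a b n (of_nat (Suc q))"
    "\<And>t. t \<in> {0<..<1} \<Longrightarrow> G_hat a b n t = V t +
      (\<Sum>k<n. Gamma_vec (shift_vec a (of_nat k)) / Gamma_vec (shift_vec b (of_nat k)) *
        ((- 1) ^ k / (fact k * fact (n - 1 - k))) * of_real t ^ (n - 1 - k))"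
proof -
  obtain x0 where x0: "0 < x0" "x0 < 1" "\<And>p. p \<in> left_tops a n \<union> right_poles n \<Longrightarrow> Re p < x0"
    "\<And>p. p \<in> left_tops a n \<union> right_poles n \<Longrightarrow> Re p - x0 \<notin> \<int>"
    using G_kernel_line_exists[of a n] n(1) by blast
  define T where "T = Max (insert 1 ((\<lambda>p. \<bar>Im p\<bar> + 1) ` (left_tops a n \<union> right_poles n)))"
  have fin: "finite (left_tops a n)" "finite (right_poles n)"
    by (auto simp: left_tops_def right_poles_def)
  have T1: "T \<ge> 1" unfolding T_def using fin by (intro Max_ge) auto
  have TI: "\<bar>Im p\<bar> < T" if "p \<in> left_tops a n \<union> right_poles n" for p
  proof -
    have "\<bar>Im p\<bar> + 1 \<le> T" unfolding T_def using fin that by (intro Max_ge) auto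
    thus ?thesis by simp
  qed
  interpret decaying_meromorphic "G_kernel a b n" "left_tops a n" "right_poles n"
    "Re (sum_list b - sum_list a) + real n" x0 T
  proof
    show "\<exists>C. \<forall>s. (\<forall>p\<in>descending (left_tops a n) \<union> right_poles n. \<delta> \<le> dist s p) \<longrightarrow>
         norm (G_kernel a b n s) \<le> C * (1 + norm s) powr (- (Re (sum_list b - sum_list a) + real n))"
      if "\<delta> > 0" for \<delta> using G_kernel_decay[OF len that] .
  qed (use fin G_kernel_holomorphic x0 T1 TI n(2) in auto)
  define R :: "complex set" where "R = {1 - of_nat n + of_nat k | k. True}"
  have L_eq: "{1 - x - of_nat n - of_nat l | x l. x \<in> set a} = descending (left_tops a n)"
    unfolding descending_def left_tops_def by blast
  have BR: "right_poles n \<subseteq> R" by (auto simp: R_def right_poles_def)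
  have disj: "descending (left_tops a n) \<inter> R = {}"
  proof (rule ccontr)
    assume "descending (left_tops a n) \<inter> R \<noteq> {}"
    then obtain x l k where "x \<in> set a" "1 - x - of_nat n - of_nat l = 1 - of_nat n + (of_nat k :: complex)"
      unfolding L_eq[symmetric] R_def by blast
    hence "x \<in> set a" "- x = of_nat (k + l)" by (auto simp: algebra_simps add_eq_0_iff)
    thus False using a by (metis of_nat_in_Nats)
  qed
  have R_Im: "Im w = 0" "Re w \<in> \<int>" if "w \<in> R" for w using that by (auto simp: R_def)
  have "\<exists>g. left_loop g (descending (left_tops a n)) R"
  proof (rule left_loop_exists[where T = T])
    show "countable (descending (left_tops a n) \<union> R)"
    proof -
      have "descending (left_tops a n) = (\<lambda>(x, l). x - of_nat l) ` (left_tops a n \<times> UNIV)"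
        by (auto simp: descending_def)
      hence "countable (descending (left_tops a n))"
        using fin by (simp add: countable_finite)
      moreover have "R = range (\<lambda>k. 1 - of_nat n + of_nat k)" by (auto simp: R_def)
      hence "countable R" by simp
      ultimately show ?thesis by simp
    qed
    show "closed (descending (left_tops a n) \<union> R - {w})" for w
    proof (rule closed_if_locally_finite)
      fix r
      show "finite ((descending (left_tops a n) \<union> R - {w}) \<inter> cball 0 r)"
        by (rule finite_subset[of _ "(descending (left_tops a n) \<inter> cball 0 r) \<union> (R \<inter> cball 0 r)"])
           (use finite_descending_cball[OF fin(1)] finite_ascending_cball in \<open>auto simp: R_def\<close>)
    qed
    show "\<bar>Im w\<bar> < T" if "w \<in> descending (left_tops a n) \<union> R" for w
      using that Im_less_T[of w] R_Im(1)[of w] T1 by (auto simp: poles_def)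
    show "Re w < x0" if "w \<in> descending (left_tops a n)" for w
      using that Re_less_x0[of w] by (auto simp: poles_def)
    show "Re w \<noteq> x0" if w: "w \<in> R" for w
    proof
      assume "Re w = x0"
      then obtain k where "x0 = of_int k" using R_Im(2)[OF w] by (metis Ints_cases)
      thus False using x0(1,2) by simp
    qed
    show "finite {w \<in> R. Re w < x0}"
    proof (rule finite_subset)
      show "{w \<in> R. Re w < x0} \<subseteq> (\<lambda>k. 1 - of_nat n + of_nat k) ` {..n}"
      proof
        fix w assume "w \<in> {w \<in> R. Re w < x0}"
        then obtain k where k: "w = 1 - of_nat n + of_nat k" "Re w < x0" by (auto simp: R_def)
        hence "k \<le> n" using x0 by simp
        thus "w \<in> (\<lambda>k. 1 - of_nat n + of_nat k) ` {..n}" using k by auto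
      qed
    qed auto
  qed (use disj T1 in auto)
  hence loop: "left_loop (SOME g. left_loop g (descending (left_tops a n)) R) (descending (left_tops a n)) R"
    by (rule someI_ex)
  show thesis
  proof
    show "set_integrable lborel {0<..<1} (\<lambda>t. mellin_density t * of_real t ^ q)" for q
      by (rule mellin_density_moment_sums)
    show "(LINT t:{0<..<1}|lborel. mellin_density t * of_real t ^ q) = G_kernel a b n (of_nat (Suc q))" for q
      by (rule mellin_density_moment)
    fix t :: real assume t: "t \<in> {0<..<1}"
    have kernel: "Gamma_vec (shift_vec a (of_nat n - 1 + s)) * Gamma (1 - of_nat n - s) /
            (Gamma_vec (shift_vec b (of_nat n - 1 + s)) * Gamma (1 - s)) * of_real t powr (- s)
        = G_kernel a b n s * of_real t powr (- s)" if s: "s \<notin> descending (left_tops a n) \<union> R" for s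
    proof -
      have "1 - of_nat n - s \<notin> \<int>\<^sub>\<le>\<^sub>0"
      proof
        assume "1 - of_nat n - s \<in> \<int>\<^sub>\<le>\<^sub>0"
        then obtain k where "1 - of_nat n - s = - of_nat k" by (elim nonpos_Ints_cases') auto
        hence "s = 1 - of_nat n + of_nat k" by (simp add: algebra_simps)
        thus False using s by (auto simp: R_def)
      qed
      hence "pochhammer (1 - of_nat n - s) n = Gamma (1 - s) / Gamma (1 - of_nat n - s)"
        by (simp add: pochhammer_Gamma)
      thus ?thesis by (simp add: G_kernel_def kernel_num_eq)
    qed
    have "G_hat a b n t = mellin_density t -
       (\<Sum>p\<in>right_poles n. residue (\<lambda>s. G_kernel a b n s * of_real t powr (- s)) p)"
      unfolding G_hat_def L_eq R_def[symmetric]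
      by (subst loop_integral_left_loop[OF t loop BR kernel]) auto
    also have "(\<Sum>p\<in>right_poles n. residue (\<lambda>s. G_kernel a b n s * of_real t powr (- s)) p) =
       (\<Sum>k<n. residue (\<lambda>s. G_kernel a b n s * of_real t powr (- s)) (1 - of_nat n + of_nat k))"
      unfolding right_poles_def by (subst sum.reindex) (auto intro!: inj_onI)
    also have "\<dots> = (\<Sum>k<n. - (Gamma_vec (shift_vec a (of_nat k)) / Gamma_vec (shift_vec b (of_nat k)) *
        ((- 1) ^ k / (fact k * fact (n - 1 - k))) * of_real t ^ (n - 1 - k)))"
    proof (intro sum.cong refl residue_right_pole)
      fix k assume "k \<in> {..<n}"
      show "1 - of_nat n + of_nat k \<notin> descending (left_tops a n)"
        using disj unfolding R_def by blast
    qed (use t in auto)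
    finally show "G_hat a b n t = mellin_density t +
      (\<Sum>k<n. Gamma_vec (shift_vec a (of_nat k)) / Gamma_vec (shift_vec b (of_nat k)) *
        ((- 1) ^ k / (fact k * fact (n - 1 - k))) * of_real t ^ (n - 1 - k))"
      by (simp add: sum_negf)
  qed
qed

lemma Gamma_vec_shift:
  assumes "\<forall>x\<in>set a. - x \<notin> \<nat>"
  shows "Gamma_vec (shift_vec a (of_nat m)) = Gamma_vec a * poch_vec a m" and "Gamma_vec a \<noteq> 0"
proof -
  have "Gamma_vec (shift_vec a (of_nat m)) = Gamma_vec a * poch_vec a m \<and> Gamma_vec a \<noteq> 0"
    using assms
  proof (induction a)
    case (Cons x a)
    have x: "x \<notin> \<int>\<^sub>\<le>\<^sub>0" using Cons.prems uminus_in_Nats_iff[of x] by auto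
    hence "Gamma (x + of_nat m) = Gamma x * pochhammer x m" "Gamma x \<noteq> 0"
      using pochhammer_Gamma[OF x, of m] by (auto simp: Gamma_eq_zero_iff)
    thus ?case using Cons by (auto simp: Gamma_vec_def shift_vec_def poch_vec_def)
  qed (auto simp: Gamma_vec_def shift_vec_def poch_vec_def)
  thus "Gamma_vec (shift_vec a (of_nat m)) = Gamma_vec a * poch_vec a m" "Gamma_vec a \<noteq> 0" by auto
qed

lemma poch_vec_nonzero:
  assumes "\<forall>x\<in>set b. - x \<notin> \<nat>"
  shows "poch_vec b m \<noteq> 0"
proof -
  have "pochhammer x m \<noteq> 0" if "- x \<notin> \<nat>" for x :: complex
    using that by (auto simp: pochhammer_eq_0_iff)
  thus ?thesis using assms by (induction b) (auto simp: poch_vec_def)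
qed

text \<open>Times \<Gamma>(a) / \<Gamma>(b), this is the contribution of the poles on the right of the loop to the Meijer
  function. If some parameter a is a nonpositive integer, it is by definition \<Gamma>(b) times the kernel.\<close>

definition taylor_part :: "complex list \<Rightarrow> complex list \<Rightarrow> nat \<Rightarrow> real \<Rightarrow> complex" where
  "taylor_part a b n t =
     (\<Sum>k<n. poch_vec a k / poch_vec b k * ((- 1) ^ k / (fact k * fact (n - 1 - k))) * of_real t ^ (n - 1 - k))"

lemma G_hat_Gamma_exceptional:
  assumes b: "\<forall>x\<in>set b. - x \<notin> \<nat>" and t: "t > 0"
  shows "(if n = 0 then 0
      else of_real t ^ (n - 1) / fact (n - 1) *
           (\<Sum>j<n. pochhammer (1 - of_nat n) j * poch_vec a j /
                   (Gamma_vec (shift_vec b (of_nat j)) * fact j) * inverse (of_real t) ^ j)) =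
     taylor_part a b n t / Gamma_vec b"
proof (cases "n = 0")
  case False
  have "of_real t ^ (n - 1) / fact (n - 1) * (pochhammer (1 - of_nat n) j * poch_vec a j /
                   (Gamma_vec (shift_vec b (of_nat j)) * fact j) * inverse (of_real t) ^ j) =
     poch_vec a j / poch_vec b j * ((- 1) ^ j / (fact j * fact (n - 1 - j))) * of_real t ^ (n - 1 - j) / Gamma_vec b"
    if j: "j < n" for j
  proof -
    have "1 - of_nat n = - (of_nat (n - 1) :: complex)" using False by (simp add: of_nat_diff)
    hence "pochhammer (1 - of_nat n :: complex) j = (- 1) ^ j * fact (n - 1) / fact (n - 1 - j)"
      using j pochhammer_neg_of_nat[of j "n - 1"] by simp
    moreover have "(of_real t :: complex) ^ (n - 1) = of_real t ^ (n - 1 - j) * of_real t ^ j"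
      using j by (simp flip: power_add)
    ultimately show ?thesis
      using t Gamma_vec_shift(1)[OF b, of j] Gamma_vec_shift(2)[OF b] poch_vec_nonzero[OF b, of j]
      by (simp add: field_simps)
  qed
  thus ?thesis using False
    by (simp add: taylor_part_def sum_distrib_left sum_divide_distrib)
qed (simp add: taylor_part_def)

text \<open>In the regular case \<open>v\<close> is the sum of the residues at all poles, times \<Gamma>(b) / \<Gamma>(a), and the
  integrand at q + 1 is \<Gamma>(a + n + q) / \<Gamma>(b + n + q) divided by (- n - q)_n. If some parameter is -N with
  a natural number N, then N < n since n > -a; thus (a)_(n+q) = 0, and \<open>v = 0\<close> has the required
  moments.\<close>

lemma G_hat_Gamma_decomposition:
  fixes a b :: "complex list" and n :: nat
  assumes len: "length a = length b" and b: "\<forall>x\<in>set b. - x \<notin> \<nat>"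
    and n: "\<forall>x\<in>set a. - real n < Re x" "- real n < Re (sum_list b - sum_list a)"
  obtains v where "\<And>q. set_integrable lborel {0<..<1} (\<lambda>t. v t * of_real t ^ q)"
    "\<And>q. (LINT t:{0<..<1}|lborel. v t * of_real t ^ q) =
        (- 1) ^ n * poch_vec a (n + q) / poch_vec b (n + q) * fact q / fact (n + q)"
    "\<And>t. t \<in> {0<..<1} \<Longrightarrow> Gamma_vec b * G_hat_Gamma a b n t = taylor_part a b n t + v t"
proof (cases "\<forall>x\<in>set a. - x \<notin> \<nat>")
  case True
  obtain V where V: "\<And>q. set_integrable lborel {0<..<1} (\<lambda>t. V t * of_real t ^ q)"
    "\<And>q. (LINT t:{0<..<1}|lborel. V t * of_real t ^ q) = G_kernel a b n (of_nat (Suc q))"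
    "\<And>t. t \<in> {0<..<1} \<Longrightarrow> G_hat a b n t = V t +
      (\<Sum>k<n. Gamma_vec (shift_vec a (of_nat k)) / Gamma_vec (shift_vec b (of_nat k)) *
        ((- 1) ^ k / (fact k * fact (n - 1 - k))) * of_real t ^ (n - 1 - k))"
    using G_hat_representation[OF len True n] by blast
  note Ga = Gamma_vec_shift[OF True] and Gb = Gamma_vec_shift[OF b]
  define c where "c = Gamma_vec b / Gamma_vec a"
  show thesis
  proof
    show "set_integrable lborel {0<..<1} (\<lambda>t. c * V t * of_real t ^ q)" for q
      using V(1)[of q] by (simp add: mult.assoc)
    show "(LINT t:{0<..<1}|lborel. c * V t * of_real t ^ q) =
        (- 1) ^ n * poch_vec a (n + q) / poch_vec b (n + q) * fact q / fact (n + q)" for q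
    proof -
      have "of_nat n - 1 + of_nat (Suc q) = (of_nat (n + q) :: complex)" by simp
      hence 1: "kernel_num a b n (of_nat (Suc q)) = Gamma_vec (shift_vec a (of_nat (n + q))) / Gamma_vec (shift_vec b (of_nat (n + q)))"
        unfolding kernel_num_eq by (simp only:)
      have 2: "pochhammer (1 - of_nat n - of_nat (Suc q) :: complex) n = (- 1) ^ n * fact (n + q) / fact q"
        using pochhammer_neg_of_nat[of n "n + q"] by simp
      have "(LINT t:{0<..<1}|lborel. c * V t * of_real t ^ q) = c * G_kernel a b n (of_nat (Suc q))"
        using V(2)[of q] by (simp add: mult.assoc)
      also have "\<dots> = poch_vec a (n + q) / poch_vec b (n + q) / ((- 1) ^ n * fact (n + q) / fact q)"
        unfolding G_kernel_def 1 2 Ga(1) Gb(1) c_def using Ga(2) Gb(2) by simp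
      also have "\<dots> = (- 1) ^ n * poch_vec a (n + q) / poch_vec b (n + q) * fact q / fact (n + q)"
        by (cases "even n") auto
      finally show ?thesis .
    qed
    fix t :: real assume t: "t \<in> {0<..<1}"
    have "Gamma_vec b * G_hat_Gamma a b n t = c * G_hat a b n t"
      using True by (simp add: G_hat_Gamma_def c_def)
    also have "\<dots> = taylor_part a b n t + c * V t"
      unfolding V(3)[OF t] Ga(1) Gb(1) taylor_part_def c_def using Ga(2) Gb(2)
      by (simp add: distrib_left sum_distrib_left mult_ac)
    finally show "Gamma_vec b * G_hat_Gamma a b n t = taylor_part a b n t + c * V t" .
  qed
next
  case False
  then obtain x where x: "x \<in> set a" "- x \<in> \<nat>" by blast
  then obtain N where N: "- x = of_nat N" by (elim Nats_cases)
  have xN: "x = - of_nat N" by (metis N minus_minus)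
  have "N < n"
  proof -
    have "- real n < Re x" using n(1) x by blast
    thus ?thesis using xN by simp
  qed
  hence px: "pochhammer x (n + q) = 0" for q
    unfolding pochhammer_eq_0_iff xN by (intro exI[of _ N]) auto
  hence zero: "poch_vec a (n + q) = 0" for q
  proof -
    have "0 \<in> (\<lambda>x. pochhammer x (n + q)) ` set a" using x(1) px[of q] by (metis image_eqI)
    thus ?thesis by (simp add: poch_vec_def prod_list_zero_iff)
  qed
  show thesis
  proof
    show "set_integrable lborel {0<..<1} (\<lambda>t. 0 * of_real t ^ q :: complex)" for q
      by (simp add: set_integrable_def)
    show "(LINT t:{0<..<1}|lborel. 0 * of_real t ^ q) =
        (- 1) ^ n * poch_vec a (n + q) / poch_vec b (n + q) * fact q / fact (n + q)" for q
      unfolding zero by (simp add: set_lebesgue_integral_def)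
    fix t :: real assume t: "t \<in> {0<..<1}"
    have "G_hat_Gamma a b n t = taylor_part a b n t / Gamma_vec b"
      unfolding G_hat_Gamma_def if_not_P[OF False] using t by (intro G_hat_Gamma_exceptional b) auto
    thus "Gamma_vec b * G_hat_Gamma a b n t = taylor_part a b n t + 0"
      using Gamma_vec_shift(2)[OF b] by simp
  qed
qed

section \<open>Multiplying Taylor coefficients by moments\<close>

definition star_shaped :: "complex set \<Rightarrow> bool" where
  "star_shaped D \<longleftrightarrow> (\<forall>w\<in>D. \<forall>t\<in>{0..1::real}. w * of_real t \<in> D)"

lemma star_shapedD: "star_shaped D \<Longrightarrow> w \<in> D \<Longrightarrow> t \<in> {0..1} \<Longrightarrow> w * of_real t \<in> D"
  by (auto simp: star_shaped_def)

text \<open>Differentiation under the integral sign. The difference quotients are dominated by |v| times the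
  maximum of |K'| on the compact set of all w t with w in a small disc and t in [0,1].\<close>

lemma holomorphic_on_dilation_integral:
  fixes v :: "real \<Rightarrow> complex" and K :: "complex \<Rightarrow> complex"
  assumes v: "set_integrable lborel {0<..<1} v" and D: "open D"
    and star: "star_shaped D"
    and K: "K holomorphic_on D"
  shows "(\<lambda>w. LINT t:{0<..<1}|lborel. v t * K (w * of_real t)) holomorphic_on D"
    and "\<And>w. w \<in> D \<Longrightarrow> set_integrable lborel {0<..<1} (\<lambda>t. v t * K (w * of_real t))"
proof -
  define V where "V t = indicator {0<..<1} t *\<^sub>R v t" for t :: real
  have V: "integrable lborel V" using v unfolding set_integrable_def V_def .
  have Kcont: "continuous_on D K" using K by (rule holomorphic_on_imp_continuous_on)
  define k where "k w t = indicator {0..1} t *\<^sub>R K (w * of_real t)" for w and t :: real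
  have k_meas: "k w \<in> borel_measurable lborel" if w: "w \<in> D" for w
  proof -
    have "continuous_on {0..1} (\<lambda>t. K (w * of_real t))"
      by (intro continuous_on_compose2[OF Kcont] continuous_intros) (use star_shapedD[OF star w] in auto)
    hence "k w \<in> borel_measurable borel"
      unfolding k_def by (intro borel_measurable_continuous_on_indicator) auto
    thus ?thesis by simp
  qed
  have eqVk: "indicator {0<..<1} t *\<^sub>R (v t * K (w * of_real t)) = V t * k w t" for t w
    by (auto simp: V_def k_def indicator_def)
  have int: "integrable lborel (\<lambda>t. V t * k w t)" if w: "w \<in> D" for w
  proof -
    have seg: "compact ((\<lambda>t. w * complex_of_real t) ` {0..1})"
      by (intro compact_continuous_image continuous_intros) auto
    have "(\<lambda>t. w * complex_of_real t) ` {0..1} \<subseteq> D" using star_shapedD[OF star w] by auto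
    hence "bounded (K ` (\<lambda>t. w * complex_of_real t) ` {0..1})"
      by (rule compact_imp_bounded[OF compact_continuous_image[OF continuous_on_subset[OF Kcont] seg]])
    then obtain M where "\<forall>x\<in>K ` (\<lambda>t. w * complex_of_real t) ` {0..1}. norm x \<le> M"
      unfolding bounded_iff by blast
    hence M: "norm (K (w * of_real t)) \<le> M" if "t \<in> {0..1}" for t using that by blast
    show ?thesis
    proof (rule Bochner_Integration.integrable_bound)
      show "integrable lborel (\<lambda>t. M * norm (V t))" using V by auto
      show "(\<lambda>t. V t * k w t) \<in> borel_measurable lborel"
        using V k_meas[OF w] by (intro borel_measurable_times) auto
      have "norm (V t * k w t) \<le> norm (M * norm (V t))" for t
      proof (cases "t \<in> {0<..<1}")
        case True
        hence "norm (k w t) \<le> M" using M[of t] by (simp add: k_def)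
        hence "norm (V t) * norm (k w t) \<le> norm (V t) * M" by (intro mult_left_mono) auto
        also have "\<dots> \<le> norm (M * norm (V t))" by (metis abs_ge_self mult.commute real_norm_def)
        finally show ?thesis by (simp add: norm_mult)
      qed (simp add: V_def)
      thus "AE t in lborel. norm (V t * k w t) \<le> norm (M * norm (V t))" by simp
    qed
  qed
  show "set_integrable lborel {0<..<1} (\<lambda>t. v t * K (w * of_real t))" if "w \<in> D" for w
    using int[OF that] unfolding set_integrable_def eqVk .
  define \<Phi> where "\<Phi> w = (\<integral>t. V t * k w t \<partial>lborel)" for w
  have \<Phi>: "(\<lambda>w. LINT t:{0<..<1}|lborel. v t * K (w * of_real t)) = \<Phi>"
    unfolding \<Phi>_def set_lebesgue_integral_def eqVk ..
  have "\<Phi> field_differentiable (at w0)" if w0: "w0 \<in> D" for w0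
  proof -
    obtain r where r: "r > 0" "cball w0 r \<subseteq> D" using D w0 open_contains_cball by blast
    define C where "C = (\<lambda>(w, t). w * complex_of_real t) ` (cball w0 r \<times> {0..1})"
    have C: "compact C" "C \<subseteq> D"
      unfolding C_def using r(2) star_shapedD[OF star]
      by (auto intro!: compact_continuous_image continuous_intros compact_Times simp: case_prod_beta)
    have dK: "deriv K holomorphic_on D" using K D by (rule holomorphic_deriv)
    have "bounded (deriv K ` C)"
      using C by (intro compact_imp_bounded compact_continuous_image continuous_on_subset[OF holomorphic_on_imp_continuous_on[OF dK]])
    then obtain M where M: "\<And>x. x \<in> C \<Longrightarrow> norm (deriv K x) \<le> M" unfolding bounded_iff by auto
    define k' where "k' t = indicator {0..1} t *\<^sub>R (deriv K (w0 * of_real t) * of_real t)" for t :: real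
    have der: "((\<lambda>w. K (w * of_real t)) has_field_derivative deriv K (w * of_real t) * of_real t) (at w)"
      if "w \<in> D" "t \<in> {0..1}" for w and t :: real
    proof -
      have "(K has_field_derivative deriv K (w * of_real t)) (at (w * of_real t))"
        using K D star_shapedD[OF star that] by (rule holomorphic_derivI)
      moreover have "((\<lambda>w. w * of_real t) has_field_derivative of_real t) (at w)"
        by (auto intro!: derivative_eq_intros)
      ultimately show ?thesis by (rule DERIV_chain2[where g = "\<lambda>w. w * of_real t"])
    qed
    have "((\<lambda>w. (\<Phi> w - \<Phi> w0) / (w - w0)) \<longlongrightarrow> (\<integral>t. V t * k' t \<partial>lborel)) (at w0 within ball w0 r)"
      unfolding tendsto_at_iff_sequentially
    proof (intro allI impI)
      fix X assume X: "\<forall>i. X i \<in> ball w0 r - {w0}" "X \<longlonglongrightarrow> w0"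
      have XD: "X i \<in> D" "X i \<noteq> w0" "X i \<in> cball w0 r" for i
        using X(1)[rule_format, of i] r(2) by auto
      define q where "q i t = (k (X i) t - k w0 t) / (X i - w0)" for i t
      have eq: "(\<Phi> (X i) - \<Phi> w0) / (X i - w0) = (\<integral>t. V t * q i t \<partial>lborel)" for i
      proof -
        have "(\<Phi> (X i) - \<Phi> w0) / (X i - w0) = (\<integral>t. V t * k (X i) t - V t * k w0 t \<partial>lborel) / (X i - w0)"
          unfolding \<Phi>_def using int XD(1) w0 by (subst Bochner_Integration.integral_diff) auto
        also have "\<dots> = (\<integral>t. (V t * k (X i) t - V t * k w0 t) / (X i - w0) \<partial>lborel)"
          by simp
        also have "\<dots> = (\<integral>t. V t * q i t \<partial>lborel)"
          by (intro Bochner_Integration.integral_cong) (auto simp: q_def algebra_simps)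
        finally show ?thesis .
      qed
      have q_lim: "(\<lambda>i. V t * q i t) \<longlonglongrightarrow> V t * k' t" for t
      proof (cases "t \<in> {0..1}")
        case True
        have "((\<lambda>w. (K (w * of_real t) - K (w0 * of_real t)) / (w - w0)) \<longlongrightarrow> deriv K (w0 * of_real t) * of_real t) (at w0)"
          using der[OF w0 True] by (simp add: has_field_derivative_iff)
        hence "(\<lambda>i. (K (X i * of_real t) - K (w0 * of_real t)) / (X i - w0)) \<longlonglongrightarrow> deriv K (w0 * of_real t) * of_real t"
          using X(2) XD(2) unfolding tendsto_at_iff_sequentially by (auto simp: o_def)
        thus ?thesis using True by (intro tendsto_intros) (simp add: q_def k_def k'_def)
      next
        case False
        hence "V t = 0" by (auto simp: V_def)
        thus ?thesis by simp
      qed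
      have q_bound: "norm (V t * q i t) \<le> M * norm (V t)" for i t
      proof (cases "t \<in> {0<..<1}")
        case True
        have "norm (K (X i * of_real t) - K (w0 * of_real t)) \<le> M * norm (X i - w0)"
        proof (rule field_differentiable_bound[of "cball w0 r"])
          show "((\<lambda>w. K (w * of_real t)) has_field_derivative deriv K (w * of_real t) * of_real t) (at w within cball w0 r)"
            if "w \<in> cball w0 r" for w
          proof -
            have "w \<in> D" "t \<in> {0..1}" using that r(2) True by auto
            from der[OF this] show ?thesis by (rule has_field_derivative_at_within)
          qed
          show "norm (deriv K (w * of_real t) * of_real t) \<le> M" if "w \<in> cball w0 r" for w
          proof -
            have "(w, t) \<in> cball w0 r \<times> {0..1}" using that True by auto
            hence "w * of_real t \<in> C" unfolding C_def by (metis (mono_tags, lifting) case_prod_conv image_eqI)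
            hence "norm (deriv K (w * of_real t)) \<le> M" by (rule M)
            moreover have "norm (deriv K (w * of_real t)) * t \<le> norm (deriv K (w * of_real t)) * 1"
              using True by (intro mult_left_mono) auto
            ultimately show ?thesis using True by (simp add: norm_mult)
          qed
        qed (use XD r in auto)
        hence "norm (q i t) \<le> M" using XD(2)[of i] True
          by (simp add: q_def k_def norm_divide field_simps)
        hence "norm (V t) * norm (q i t) \<le> norm (V t) * M" by (intro mult_left_mono) auto
        thus ?thesis by (simp add: norm_mult mult.commute)
      qed (simp add: V_def)
      have "(\<lambda>i. \<integral>t. V t * q i t \<partial>lborel) \<longlonglongrightarrow> (\<integral>t. V t * k' t \<partial>lborel)"
      proof (rule integral_dominated_convergence)
        show "integrable lborel (\<lambda>t. M * norm (V t))" using V by auto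
        show "(\<lambda>t. V t * q i t) \<in> borel_measurable lborel" for i
          unfolding q_def using V k_meas[OF XD(1)[of i]] k_meas[OF w0]
          by (intro borel_measurable_times borel_measurable_divide borel_measurable_diff) auto
        show "(\<lambda>t. V t * k' t) \<in> borel_measurable lborel"
        proof -
          have "continuous_on {0..1} (\<lambda>t. deriv K (w0 * of_real t) * of_real t)"
            by (intro continuous_intros continuous_on_compose2[OF holomorphic_on_imp_continuous_on[OF dK]])
               (use star_shapedD[OF star w0] in auto)
          hence "k' \<in> borel_measurable borel"
            unfolding k'_def by (intro borel_measurable_continuous_on_indicator) auto
          thus ?thesis using V by (intro borel_measurable_times) auto
        qed
      qed (use q_lim q_bound in auto)
      thus "((\<lambda>w. (\<Phi> w - \<Phi> w0) / (w - w0)) \<circ> X) \<longlonglongrightarrow> (\<integral>t. V t * k' t \<partial>lborel)"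
        by (simp add: o_def eq)
    qed
    hence "(\<Phi> has_field_derivative (\<integral>t. V t * k' t \<partial>lborel)) (at w0)"
      using r(1) by (simp add: has_field_derivative_iff at_within_open[of w0 "ball w0 r"])
    thus ?thesis using field_differentiable_def by blast
  qed
  hence "\<Phi> holomorphic_on D" using D holomorphic_on_open field_differentiable_def by blast
  thus "(\<lambda>w. LINT t:{0<..<1}|lborel. v t * K (w * of_real t)) holomorphic_on D" unfolding \<Phi> .
qed

text \<open>If the moments of v are (-1)^n f(n + q) q! / (n + q)!, this multiplies the m-th Taylor coefficient
  of H by f(m): explicitly for m < n, and through the integral for m \<ge> n.\<close>

definition coeff_transform ::
  "(nat \<Rightarrow> complex) \<Rightarrow> (real \<Rightarrow> complex) \<Rightarrow> nat \<Rightarrow> (complex \<Rightarrow> complex) \<Rightarrow> complex \<Rightarrow> complex" where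
  "coeff_transform f v n H w =
     (\<Sum>j<n. f j * (deriv ^^ j) H 0 / fact j * w ^ j) +
     (- 1) ^ n * w ^ n * (LINT t:{0<..<1}|lborel. v t * (deriv ^^ n) H (w * of_real t))"

lemma coeff_transform_holomorphic:
  assumes v: "set_integrable lborel {0<..<1} v" and D: "open D"
    and star: "star_shaped D"
    and H: "H holomorphic_on D"
  shows "coeff_transform f v n H holomorphic_on D"
  unfolding coeff_transform_def
  by (intro holomorphic_intros holomorphic_on_dilation_integral(1)[OF v D star] holomorphic_higher_deriv H D)

text \<open>Near 0 the n-th derivative of H is expanded in its power series and integrated termwise against v.
  Its coefficient at x^q contains the factor (n + q)! / q!, which the moments of v cancel.\<close>

lemma coeff_transform_sums:
  fixes v :: "real \<Rightarrow> complex"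
  assumes v: "\<And>q. set_integrable lborel {0<..<1} (\<lambda>t. v t * of_real t ^ q)"
    and moments: "\<And>q. (LINT t:{0<..<1}|lborel. v t * of_real t ^ q) =
        (- 1) ^ n * f (n + q) * fact q / fact (n + q)"
    and H: "H holomorphic_on ball 0 r" and w: "w \<in> ball 0 r"
  shows "(\<lambda>m. f m * ((deriv ^^ m) H 0 / fact m) * w ^ m) sums coeff_transform f v n H w"
proof -
  define c where "c q = (deriv ^^ (n + q)) H 0 / fact q" for q
  have Kn: "(\<lambda>q. c q * x ^ q) sums (deriv ^^ n) H x" if x: "x \<in> ball 0 r" for x
  proof -
    have "(deriv ^^ n) H holomorphic_on ball 0 r" using H by (intro holomorphic_higher_deriv) auto
    from holomorphic_power_series[OF this x]
    have "(\<lambda>q. (deriv ^^ q) ((deriv ^^ n) H) 0 / fact q * (x - 0) ^ q) sums (deriv ^^ n) H x" .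
    moreover have "(deriv ^^ q) ((deriv ^^ n) H) = (deriv ^^ (n + q)) H" for q
      by (simp add: funpow_add add.commute[of n q])
    ultimately show ?thesis by (simp add: c_def)
  qed
  obtain r' where r': "norm w < r'" "r' < r" using w dense by (auto simp: dist_norm)
  have r'0: "r' > 0" using r' norm_ge_zero[of w] by linarith
  have "summable (\<lambda>q. c q * of_real r' ^ q)"
    using Kn[of "of_real r'"] r' r'0 by (auto simp: sums_iff)
  hence abs: "summable (\<lambda>q. norm (c q * w ^ q))"
    by (rule powser_insidea) (use r' r'0 in auto)
  define g where "g q t = indicator {0<..<1} t *\<^sub>R (v t * (c q * w ^ q * of_real t ^ q))" for q and t :: real
  define I where "I = (\<integral>t. norm (indicator {0<..<1} t *\<^sub>R v t) \<partial>lborel)"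
  have v0: "integrable lborel (\<lambda>t. indicator {0<..<1} t *\<^sub>R v t)"
    using v[of 0] by (simp add: set_integrable_def)
  have g_alt: "g q = (\<lambda>t. (c q * w ^ q) * (indicator {0<..<1} t *\<^sub>R (v t * of_real t ^ q)))" for q
    by (auto simp: g_def indicator_def fun_eq_iff)
  have g_int: "integrable lborel (g q)" for q
    unfolding g_alt using v[of q] unfolding set_integrable_def by (rule integrable_mult_right)
  have g_val: "(\<integral>t. g q t \<partial>lborel) = (c q * w ^ q) * (LINT t:{0<..<1}|lborel. v t * of_real t ^ q)" for q
    unfolding g_alt set_lebesgue_integral_def by (rule integral_mult_right_zero)
  have g_norm: "norm (g q t) \<le> norm (c q * w ^ q) * norm (indicator {0<..<1} t *\<^sub>R v t)" for q t
  proof (cases "t \<in> {0<..<1}")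
    case True
    have "norm (c q * w ^ q) * norm (v t) * t ^ q \<le> norm (c q * w ^ q) * norm (v t) * 1"
      using True by (intro mult_left_mono power_le_one) auto
    thus ?thesis using True by (simp add: g_def norm_mult norm_power mult_ac)
  qed (simp add: g_def)
  have "(\<lambda>q. \<integral>t. g q t \<partial>lborel) sums (\<integral>t. (\<Sum>q. g q t) \<partial>lborel)"
  proof (rule sums_integral)
    show "AE t in lborel. summable (\<lambda>q. norm (g q t))"
    proof (rule AE_I2)
      fix t show "summable (\<lambda>q. norm (g q t))"
        by (rule summable_comparison_test'[OF summable_mult2[OF abs]]) (use g_norm in simp)
    qed
    have "(\<integral>t. norm (g q t) \<partial>lborel) \<le> norm (c q * w ^ q) * I" for q
    proof -
      have "(\<integral>t. norm (g q t) \<partial>lborel) \<le> (\<integral>t. norm (c q * w ^ q) * norm (indicator {0<..<1} t *\<^sub>R v t) \<partial>lborel)"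
        by (intro integral_mono integrable_norm integrable_mult_right g_int v0 g_norm)
      thus ?thesis unfolding I_def by simp
    qed
    thus "summable (\<lambda>q. \<integral>t. norm (g q t) \<partial>lborel)"
      by (intro summable_comparison_test'[OF summable_mult2[OF abs, of I]]) auto
  qed (rule g_int)
  moreover have "(\<Sum>q. g q t) = indicator {0<..<1} t *\<^sub>R (v t * (deriv ^^ n) H (w * of_real t))" for t
  proof (cases "t \<in> {0<..<1}")
    case True
    have "norm (w * of_real t) \<le> norm w * 1" using True mult_left_mono[of t 1 "norm w"] by (simp add: norm_mult)
    hence "w * of_real t \<in> ball 0 r" using w by (simp add: dist_norm)
    from sums_mult[OF Kn[OF this], of "v t"] show ?thesis
      using True by (simp add: g_def power_mult_distrib sums_iff mult_ac)
  qed (simp add: g_def)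
  ultimately have "(\<lambda>q. (c q * w ^ q) * (LINT t:{0<..<1}|lborel. v t * of_real t ^ q)) sums
      (LINT t:{0<..<1}|lborel. v t * (deriv ^^ n) H (w * of_real t))"
    unfolding g_val set_lebesgue_integral_def by simp
  from sums_mult[OF this, of "(- 1) ^ n * w ^ n"]
  have "(\<lambda>q. f (n + q) * ((deriv ^^ (n + q)) H 0 / fact (n + q)) * w ^ (n + q)) sums
      ((- 1) ^ n * w ^ n * (LINT t:{0<..<1}|lborel. v t * (deriv ^^ n) H (w * of_real t)))"
    unfolding moments
  proof (rule sums_cong[THEN iffD1, rotated])
    fix q
    show "(- 1) ^ n * w ^ n * (c q * w ^ q * ((- 1) ^ n * f (n + q) * fact q / fact (n + q))) =
       f (n + q) * ((deriv ^^ (n + q)) H 0 / fact (n + q)) * w ^ (n + q)"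
      by (simp add: c_def power_add mult_ac minus_one_power_cancel)
  qed
  hence "(\<lambda>q. f (q + n) * ((deriv ^^ (q + n)) H 0 / fact (q + n)) * w ^ (q + n)) sums
      ((- 1) ^ n * w ^ n * (LINT t:{0<..<1}|lborel. v t * (deriv ^^ n) H (w * of_real t)))"
    by (simp only: add.commute[of n])
  hence "(\<lambda>m. f m * ((deriv ^^ m) H 0 / fact m) * w ^ m) sums
     ((- 1) ^ n * w ^ n * (LINT t:{0<..<1}|lborel. v t * (deriv ^^ n) H (w * of_real t)) +
      (\<Sum>m<n. f m * ((deriv ^^ m) H 0 / fact m) * w ^ m))"
    unfolding sums_iff_shift[of "\<lambda>m. f m * ((deriv ^^ m) H 0 / fact m) * w ^ m" n] .
  thus ?thesis by (simp add: coeff_transform_def add.commute)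
qed

lemma higher_deriv_of_power_series:
  assumes "r > 0" "\<And>w. w \<in> ball 0 r \<Longrightarrow> (\<lambda>m. h m * w ^ m) sums H w"
  shows "(deriv ^^ m) H (0::complex) / fact m = h m"
proof -
  have "H has_fps_expansion Abs_fps h"
  proof (rule has_fps_expansionI)
    have "eventually (\<lambda>u. u \<in> ball 0 r) (nhds (0::complex))"
      using assms(1) by (intro eventually_nhds_in_open) auto
    thus "\<forall>\<^sub>F u in nhds 0. (\<lambda>n. fps_nth (Abs_fps h) n * u ^ n) sums H u"
      by eventually_elim (simp add: assms(2))
  qed
  from fps_nth_fps_expansion[OF this, of m] show ?thesis by simp
qed

lemma coeff_transform_eqI:
  fixes v :: "real \<Rightarrow> complex"
  assumes v: "\<And>q. set_integrable lborel {0<..<1} (\<lambda>t. v t * of_real t ^ q)"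
    and moments: "\<And>q. (LINT t:{0<..<1}|lborel. v t * of_real t ^ q) =
        (- 1) ^ n * f (n + q) * fact q / fact (n + q)"
    and D: "open D" "connected D" "ball 0 1 \<subseteq> D"
    and star: "star_shaped D"
    and H: "H holomorphic_on D" "\<And>w. w \<in> ball 0 1 \<Longrightarrow> (\<lambda>m. h m * w ^ m) sums H w"
    and K: "K holomorphic_on D" "\<And>w. w \<in> ball 0 1 \<Longrightarrow> (\<lambda>m. f m * h m * w ^ m) sums K w"
    and w: "w \<in> D"
  shows "coeff_transform f v n H w = K w"
proof (rule analytic_continuation_open[where s = "ball 0 1" and s' = D and f = "coeff_transform f v n H" and g = K])
  show "coeff_transform f v n H holomorphic_on D"
    using v[of 0] by (intro coeff_transform_holomorphic D star H) auto
  fix w :: complex assume w: "w \<in> ball 0 1"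
  have "H holomorphic_on ball 0 1" using H(1) D(3) by (rule holomorphic_on_subset)
  note sums = coeff_transform_sums[of v n f H, OF v moments this w]
  have "(deriv ^^ m) H 0 / fact m = h m" for m
    by (rule higher_deriv_of_power_series[of 1]) (use H(2) in auto)
  hence "(\<lambda>m. f m * h m * w ^ m) sums coeff_transform f v n H w"
    using sums by (simp only:)
  thus "coeff_transform f v n H w = K w" using K(2)[OF w] sums_unique2 by blast
qed (use D K w in auto)

section \<open>Analytic continuation of hypergeometric series\<close>

lemma cut_plane_iff: "w \<in> cut_plane \<longleftrightarrow> \<not> (Im w = 0 \<and> 1 \<le> Re w)"
  by (auto simp: cut_plane_def complex_eq_iff image_iff intro: exI[of _ "Re w"])

lemma open_cut_plane: "open cut_plane"
proof -
  have "cut_plane = - ({w. Im w = 0} \<inter> {w. 1 \<le> Re w})" by (auto simp: cut_plane_iff)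
  moreover have "closed ({w. Im w = 0} \<inter> {w. 1 \<le> Re w})"
    by (intro closed_Int closed_Collect_eq closed_Collect_le continuous_intros)
  ultimately show ?thesis by (metis open_Compl)
qed

lemma cut_plane_star: "star_shaped cut_plane"
  unfolding star_shaped_def
proof (intro ballI, rule ccontr)
  fix w :: complex and t :: real
  assume assms: "w \<in> cut_plane" "t \<in> {0..1}"
  assume "w * of_real t \<notin> cut_plane"
  hence *: "Im w * t = 0" "1 \<le> Re w * t" by (auto simp: cut_plane_iff)
  hence "t \<noteq> 0" "Im w = 0" by auto
  moreover have "Re w \<ge> 1"
  proof (rule ccontr)
    assume "\<not> Re w \<ge> 1"
    moreover have "Re w > 0" using *(2) assms(2) by (smt (verit) atLeastAtMost_iff mult_nonpos_nonneg)
    ultimately have "Re w * t \<le> Re w * 1" using assms(2) by (intro mult_left_mono) auto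
    thus False using *(2) \<open>\<not> Re w \<ge> 1\<close> by simp
  qed
  ultimately show False using assms(1) by (auto simp: cut_plane_iff)
qed

lemma ball_subset_cut_plane: "ball 0 1 \<subseteq> cut_plane"
proof
  fix w :: complex assume "w \<in> ball 0 1"
  hence "Re w < 1" using complex_Re_le_cmod[of w] by simp
  thus "w \<in> cut_plane" by (simp add: cut_plane_iff)
qed

lemma connected_if_star_shaped:
  fixes D :: "complex set"
  assumes "0 \<in> D" "star_shaped D"
  shows "connected D"
proof (rule starlike_imp_connected)
  have "closed_segment 0 w \<subseteq> D" if "w \<in> D" for w
    using star_shapedD[OF assms(2) that] by (auto simp: closed_segment_def scaleR_conv_of_real mult.commute)
  thus "starlike D" unfolding starlike_def using assms(1) by blast
qed

definition hypergeom_coeff :: "complex list \<Rightarrow> complex list \<Rightarrow> nat \<Rightarrow> complex" where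
  "hypergeom_coeff c d m = poch_vec c m / poch_vec d m / fact m"

lemma hypergeom_series_eq: "hypergeom_series c d w = (\<Sum>m. hypergeom_coeff c d m * w ^ m)"
  by (simp add: hypergeom_series_def hypergeom_coeff_def)

text \<open>Induction on the number of lower parameters. The function (1 - w)^(-c) continues the binomial
  series, and a further pair of parameters c1, d1 multiplies the coefficients by (c1)_m / (d1)_m.
  This is done by the coefficient transform with the kernel for p = 1, which preserves holomorphy on
  the cut plane.\<close>

lemma hypergeom_continuation_exists:
  assumes "length c = length d + 1" "\<forall>x\<in>set d. - x \<notin> \<nat>"
  shows "\<exists>H. H holomorphic_on cut_plane \<and> (\<forall>w\<in>ball 0 1. (\<lambda>m. hypergeom_coeff c d m * w ^ m) sums H w)"
  using assms
proof (induction d arbitrary: c)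
  case Nil
  then obtain c0 where c: "c = [c0]" by (auto simp: length_Suc_conv)
  define H where "H w = (1 - w) powr (- c0)" for w :: complex
  have "H holomorphic_on cut_plane" unfolding H_def
    by (intro holomorphic_intros) (auto simp: cut_plane_iff complex_nonpos_Reals_iff)
  moreover have "(\<lambda>m. hypergeom_coeff c [] m * w ^ m) sums H w" if "w \<in> ball 0 1" for w
  proof -
    have "(\<lambda>m. ((- c0) gchoose m) * (- w) ^ m) sums (1 + - w) powr (- c0)"
      using that by (intro gen_binomial_complex) auto
    moreover have "((- c0) gchoose m) * (- w) ^ m = hypergeom_coeff c [] m * w ^ m" for m
    proof -
      have "(- w) ^ m = (- 1) ^ m * w ^ m" by (rule power_minus)
      thus ?thesis
        by (simp add: gbinomial_pochhammer hypergeom_coeff_def c poch_vec_def mult_ac minus_one_power_cancel)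
    qed
    ultimately show ?thesis by (simp add: H_def)
  qed
  ultimately show ?case by blast
next
  case (Cons d1 d)
  then obtain c1 c' where c: "c = c1 # c'" "length c' = length d + 1"
    by (auto simp: length_Suc_conv)
  obtain H where H: "H holomorphic_on cut_plane"
    "\<And>w. w \<in> ball 0 1 \<Longrightarrow> (\<lambda>m. hypergeom_coeff c' d m * w ^ m) sums H w"
    using Cons.IH[OF c(2)] Cons.prems by auto
  obtain n where n: "max (- Re c1) (- Re (d1 - c1)) < real n" using reals_Archimedean2 by blast
  have pre: "length [c1] = length [d1]" "\<forall>x\<in>set [d1]. - x \<notin> \<nat>" "\<forall>x\<in>set [c1]. - real n < Re x"
    "- real n < Re (sum_list [d1] - sum_list [c1])"
    using n Cons.prems by auto
  have "\<exists>v. (\<forall>q. set_integrable lborel {0<..<1} (\<lambda>t. v t * of_real t ^ q)) \<and>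
      (\<forall>q. (LINT t:{0<..<1}|lborel. v t * of_real t ^ q) =
        (- 1) ^ n * poch_vec [c1] (n + q) / poch_vec [d1] (n + q) * fact q / fact (n + q))"
    by (rule G_hat_Gamma_decomposition[OF pre]) blast
  then obtain v where v: "\<And>q. set_integrable lborel {0<..<1} (\<lambda>t. v t * of_real t ^ q)"
    "\<And>q. (LINT t:{0<..<1}|lborel. v t * of_real t ^ q) =
        (- 1) ^ n * poch_vec [c1] (n + q) / poch_vec [d1] (n + q) * fact q / fact (n + q)"
    by blast
  define f where "f m = poch_vec [c1] m / poch_vec [d1] m" for m
  have moments: "(LINT t:{0<..<1}|lborel. v t * of_real t ^ q) =
      (- 1) ^ n * f (n + q) * fact q / fact (n + q)" for q
    unfolding v(2) f_def by simp
  define K where "K = coeff_transform f v n H"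
  have "K holomorphic_on cut_plane" unfolding K_def
    using v(1)[of 0] by (intro coeff_transform_holomorphic open_cut_plane cut_plane_star H) auto
  moreover have "(\<lambda>m. hypergeom_coeff c (d1 # d) m * w ^ m) sums K w" if w: "w \<in> ball 0 1" for w
  proof -
    have "H holomorphic_on ball 0 1" using H(1) ball_subset_cut_plane by (rule holomorphic_on_subset)
    note sums = coeff_transform_sums[of v n f H, OF v(1) moments this w]
    have "(deriv ^^ m) H 0 / fact m = hypergeom_coeff c' d m" for m
      by (rule higher_deriv_of_power_series[of 1]) (use H(2) in auto)
    hence "(\<lambda>m. f m * hypergeom_coeff c' d m * w ^ m) sums K w"
      using sums by (simp only: K_def)
    moreover have "f m * hypergeom_coeff c' d m = hypergeom_coeff c (d1 # d) m" for m
      by (simp add: f_def hypergeom_coeff_def c poch_vec_def)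
    ultimately show ?thesis by simp
  qed
  ultimately show ?case by blast
qed

lemma poch_vec_append: "poch_vec (a @ c) m = poch_vec a m * poch_vec c m"
  by (simp add: poch_vec_def)

text \<open>Since a continuation exists, the one chosen in the definition has the two properties
  by which it was chosen.\<close>

lemma hypergeom_analytic_cut_plane:
  assumes "length c = length d + 1" "\<forall>x\<in>set d. - x \<notin> \<nat>"
  shows "hypergeom c d holomorphic_on cut_plane"
    and "\<And>w. w \<in> ball 0 1 \<Longrightarrow> (\<lambda>m. hypergeom_coeff c d m * w ^ m) sums hypergeom c d w"
proof -
  define P where "P f \<longleftrightarrow> f holomorphic_on cut_plane \<and> (\<forall>w\<in>ball 0 1. f w = hypergeom_series c d w)" for f
  obtain H where H: "H holomorphic_on cut_plane"
    "\<And>w. w \<in> ball 0 1 \<Longrightarrow> (\<lambda>m. hypergeom_coeff c d m * w ^ m) sums H w"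
    using hypergeom_continuation_exists[OF assms] by blast
  have "P H" unfolding P_def hypergeom_series_eq using H by (auto simp: sums_iff)
  hence P: "P (SOME f. P f)" by (rule someI[of P H])
  have eq: "hypergeom c d w = (SOME f. P f) w" if "w \<in> cut_plane" for w
    using that assms(1) by (simp add: hypergeom_def P_def)
  show "hypergeom c d holomorphic_on cut_plane"
    using P eq unfolding P_def by (metis (no_types, lifting) holomorphic_transform)
  fix w :: complex assume w: "w \<in> ball 0 1"
  hence "hypergeom c d w = hypergeom_series c d w"
    using eq[of w] P ball_subset_cut_plane unfolding P_def by auto
  thus "(\<lambda>m. hypergeom_coeff c d m * w ^ m) sums hypergeom c d w"
    using H(2)[OF w] unfolding hypergeom_series_eq by (auto simp: sums_iff)
qed

text \<open>With upper parameters 1 added until there is one more of them than of the lower ones, the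
  coefficients belong to a series that converges in the unit disc, so they are O(2^m). Each of the
  added parameters has multiplied them by m!, and at least one was added.\<close>

lemma hypergeom_entire:
  assumes "length c \<le> length d" "\<forall>x\<in>set d. - x \<notin> \<nat>"
  shows "(\<lambda>m. hypergeom_coeff c d m * w ^ m) sums hypergeom c d w"
    and "hypergeom c d holomorphic_on UNIV"
proof -
  define j where "j = length d - length c"
  define c' where "c' = c @ replicate (Suc j) 1"
  have len: "length c' = length d + 1" using assms(1) by (simp add: c'_def j_def)
  have pv: "poch_vec c' m = poch_vec c m * fact m ^ Suc j" for m
  proof -
    have "poch_vec (replicate k 1) m = fact m ^ k" for k
      by (induction k) (auto simp: poch_vec_def pochhammer_fact)
    from this[of "Suc j"] show ?thesis unfolding c'_def poch_vec_append by (simp only:)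
  qed
  have "summable (\<lambda>m. hypergeom_coeff c' d m * (1 / 2) ^ m)"
    using hypergeom_analytic_cut_plane(2)[OF len assms(2), of "1 / 2"] by (auto simp: sums_iff)
  hence "Bseq (\<lambda>m. hypergeom_coeff c' d m * (1 / 2) ^ m)"
    by (intro convergent_imp_Bseq) (auto simp: convergent_def dest: summable_LIMSEQ_zero)
  then obtain C where C: "\<And>m. norm (hypergeom_coeff c' d m * (1 / 2) ^ m) \<le> C" unfolding Bseq_def by blast
  have bound: "norm (hypergeom_coeff c d m) \<le> C * 2 ^ m / fact m" for m
  proof -
    have "norm (hypergeom_coeff c' d m) \<le> C * 2 ^ m"
      using C[of m] by (simp add: norm_mult norm_power norm_divide power_divide field_simps)
    moreover have "norm (hypergeom_coeff c' d m) = norm (hypergeom_coeff c d m) * fact m ^ Suc j"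
      by (simp add: hypergeom_coeff_def pv norm_mult norm_divide norm_power)
    moreover have "norm (hypergeom_coeff c d m) * fact m ^ 1 \<le> norm (hypergeom_coeff c d m) * fact m ^ Suc j"
      by (intro mult_left_mono power_increasing) auto
    ultimately have "norm (hypergeom_coeff c d m) * fact m \<le> C * 2 ^ m" by simp
    thus ?thesis by (simp add: field_simps)
  qed
  have sums: "(\<lambda>m. hypergeom_coeff c d m * w ^ m) sums hypergeom c d w" for w
  proof -
    have "summable (\<lambda>m. C * (inverse (fact m) * (2 * norm w) ^ m))"
      by (intro summable_mult summable_exp)
    hence "summable (\<lambda>m. hypergeom_coeff c d m * w ^ m)"
    proof (rule summable_comparison_test')
      fix m :: nat
      have "norm (hypergeom_coeff c d m) * norm w ^ m \<le> C * 2 ^ m / fact m * norm w ^ m"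
        using bound[of m] by (intro mult_right_mono) auto
      thus "norm (hypergeom_coeff c d m * w ^ m) \<le> C * (inverse (fact m) * (2 * norm w) ^ m)"
        by (simp add: norm_mult norm_power power_mult_distrib divide_inverse mult_ac)
    qed
    moreover have "hypergeom c d w = hypergeom_series c d w"
      using assms(1) by (simp add: hypergeom_def)
    ultimately show ?thesis by (simp add: hypergeom_series_eq summable_sums)
  qed
  show "(\<lambda>m. hypergeom_coeff c d m * w ^ m) sums hypergeom c d w" by (rule sums)
  have "hypergeom c d holomorphic_on ball 0 r" for r
    by (rule power_series_holomorphic[of 0 r "hypergeom_coeff c d"]) (use sums in simp)
  hence "hypergeom c d field_differentiable (at w)" for w
    by (rule holomorphic_on_imp_differentiable_at[of _ "ball 0 (norm w + 1)"]) auto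
  thus "hypergeom c d holomorphic_on UNIV" unfolding holomorphic_on_def
    using field_differentiable_at_within by blast
qed

section \<open>The functional on dilations of a holomorphic function\<close>

lemma deriv01_dilation:
  assumes H: "H holomorphic_on D" and D: "open D" and w: "\<forall>t\<in>{0..1}. w * of_real t \<in> D"
  defines "g \<equiv> \<lambda>k t. w ^ k * (deriv ^^ k) H (w * of_real t)"
  shows "\<And>k t. t \<in> {0..1} \<Longrightarrow> (g k has_vector_derivative g (Suc k) t) (at t within {0..1})"
    and "\<And>k t. t \<in> {0..1} \<Longrightarrow> deriv01 k (\<lambda>t. H (w * of_real t)) t = g k t"
proof -
  show der: "(g k has_vector_derivative g (Suc k) t) (at t within {0..1})" if t: "t \<in> {0..1}" for k t
  proof -
    have "(deriv ^^ k) H holomorphic_on D" using H D by (rule holomorphic_higher_deriv)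
    from holomorphic_derivI[OF this D w[rule_format, OF t]]
    have "((deriv ^^ k) H has_field_derivative (deriv ^^ Suc k) H (w * of_real t)) (at (w * of_real t))" by simp
    moreover have "((\<lambda>x. w * x) has_field_derivative w) (at (of_real t))"
      by (auto intro!: derivative_eq_intros)
    ultimately have "((\<lambda>x. (deriv ^^ k) H (w * x)) has_field_derivative (deriv ^^ Suc k) H (w * of_real t) * w) (at (of_real t))"
      using DERIV_chain2 by blast
    hence "((\<lambda>x. w ^ k * (deriv ^^ k) H (w * x)) has_field_derivative w ^ k * ((deriv ^^ Suc k) H (w * of_real t) * w)) (at (of_real t))"
      by (rule DERIV_cmult)
    hence "((\<lambda>x. w ^ k * (deriv ^^ k) H (w * x)) has_field_derivative g (Suc k) t) (at (of_real t))"
      by (simp add: g_def mult_ac)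
    from has_vector_derivative_real_field[OF this] show ?thesis by (simp add: g_def)
  qed
  show "deriv01 k (\<lambda>t. H (w * of_real t)) t = g k t" if "t \<in> {0..1}" for k t
    using that
  proof (induction k arbitrary: t)
    case 0
    thus ?case by (simp add: deriv01_def g_def)
  next
    case (Suc k)
    have "(deriv01 k (\<lambda>t. H (w * of_real t)) has_vector_derivative g (Suc k) t) (at t within {0..1})"
      using has_vector_derivative_transform[OF Suc.prems _ der[OF Suc.prems]] Suc.IH by blast
    hence "vector_derivative (deriv01 k (\<lambda>t. H (w * of_real t))) (at t within {0..1}) = g (Suc k) t"
      using vector_derivative_within_cbox[of 0 1 t] Suc.prems by simp
    thus ?case by (simp add: deriv01_def)
  qed
qed

lemma dilation_in_CB_inf:
  assumes H: "H holomorphic_on D" and D: "open D" and w: "\<forall>t\<in>{0..1}. w * of_real t \<in> D"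
  shows "(\<lambda>t. H (w * of_real t)) \<in> CB_inf"
proof -
  define \<phi> where "\<phi> t = H (w * of_real t)" for t :: real
  define g where "g k t = w ^ k * (deriv ^^ k) H (w * of_real t)" for k and t :: real
  note der = deriv01_dilation[OF H D w, folded \<phi>_def g_def]
  have vd: "(deriv01 k \<phi> has_vector_derivative g (Suc k) t) (at t within {0..1})" if "t \<in> {0..1}" for k t
    using has_vector_derivative_transform[OF that _ der(1)[OF that]] der(2) by blast
  hence diff: "deriv01 k \<phi> differentiable_on {0..1}" for k
    unfolding differentiable_on_def by (metis differentiableI_vector)
  hence "bounded (deriv01 k \<phi> ` {0..1})" for k
    by (intro compact_imp_bounded compact_continuous_image differentiable_imp_continuous_on) auto
  thus ?thesis using diff unfolding CB_inf_def \<phi>_def by blast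
qed

lemma continuous_imp_set_integrable_unit:
  fixes f :: "real \<Rightarrow> complex"
  assumes "continuous_on {0..1} f"
  shows "set_integrable lborel {0<..<1} f"
  by (rule set_integrable_subset[OF borel_integrable_atLeastAtMost'[OF assms]]) auto

text \<open>Taylor's formula at 1 for the j-th function, evaluated at 0 and solved for the integral.\<close>

lemma taylor_integral_remainder:
  fixes g :: "nat \<Rightarrow> real \<Rightarrow> complex"
  assumes der: "\<And>k t. t \<in> {0..1} \<Longrightarrow> (g k has_vector_derivative g (Suc k) t) (at t within {0..1})"
  shows "(LINT t:{0<..<1}|lborel. of_real t ^ p * g (j + Suc p) t) =
     (- 1) ^ p * fact p * ((\<Sum>i\<le>p. (- 1) ^ i * g (j + i) 1 / fact i) - g j 0)"
proof -
  (* the antiderivative: its derivative telescopes *)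
  define U where "U p t = (\<Sum>i\<le>p. (- 1) ^ i / fact i * (of_real t ^ i * g (j + i) t))" for p and t :: real
  have tp: "((\<lambda>t. of_real t ^ i :: complex) has_vector_derivative of_nat i * of_real t ^ (i - 1)) (at t within {0..1})"
    for i and t :: real
    by (rule has_vector_derivative_real_field) (auto intro!: derivative_eq_intros)
  have U': "(U p has_vector_derivative (- 1) ^ p / fact p * (of_real t ^ p * g (j + Suc p) t)) (at t within {0..1})"
    if t: "t \<in> {0..1}" for p t
  proof (induction p)
    case 0
    thus ?case using der[OF t, of j] by (simp add: U_def)
  next
    case (Suc p)
    have "((\<lambda>t. of_real t ^ Suc p * g (j + Suc p) t) has_vector_derivative
        of_real t ^ Suc p * g (Suc (j + Suc p)) t + of_nat (Suc p) * of_real t ^ (Suc p - 1) * g (j + Suc p) t) (at t within {0..1})"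
      by (rule has_vector_derivative_mult[OF tp der[OF t]])
    hence "((\<lambda>t. (- 1) ^ Suc p / fact (Suc p) * (of_real t ^ Suc p * g (j + Suc p) t)) has_vector_derivative
        (- 1) ^ Suc p / fact (Suc p) * (of_real t ^ Suc p * g (Suc (j + Suc p)) t + of_nat (Suc p) * of_real t ^ (Suc p - 1) * g (j + Suc p) t)) (at t within {0..1})"
      by (rule has_vector_derivative_mult_right)
    from has_vector_derivative_add[OF Suc.IH this]
    have "(U (Suc p) has_vector_derivative
        (- 1) ^ p / fact p * (of_real t ^ p * g (j + Suc p) t) +
        (- 1) ^ Suc p / fact (Suc p) * (of_real t ^ Suc p * g (Suc (j + Suc p)) t + of_nat (Suc p) * of_real t ^ (Suc p - 1) * g (j + Suc p) t))
        (at t within {0..1})"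
      by (simp add: U_def[abs_def])
    moreover have "(- 1) ^ p / fact p * (of_real t ^ p * g (j + Suc p) t) +
        (- 1) ^ Suc p / fact (Suc p) * (of_real t ^ Suc p * g (Suc (j + Suc p)) t + of_nat (Suc p) * of_real t ^ (Suc p - 1) * g (j + Suc p) t)
        = (- 1) ^ Suc p / fact (Suc p) * (of_real t ^ Suc p * g (j + Suc (Suc p)) t)"
    proof -
      have "fact (Suc p) = of_nat (Suc p) * (fact p :: complex)" by (rule fact_Suc)
      hence "of_nat (Suc p) / fact (Suc p) = (1 / fact p :: complex)"
        by (simp add: divide_simps del: of_nat_Suc)
      moreover have "(- 1) ^ Suc p / fact (Suc p) * (of_nat (Suc p) * x) =
          - ((- 1) ^ p * (of_nat (Suc p) / fact (Suc p)) * (x :: complex))" for x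
        by (simp del: of_nat_Suc fact_Suc)
      ultimately have "(- 1) ^ Suc p / fact (Suc p) * (of_nat (Suc p) * x) =
          - ((- 1) ^ p / fact p * (x :: complex))" for x
        by (simp del: of_nat_Suc fact_Suc)
      from this[of "of_real t ^ p * g (j + Suc p) t"] show ?thesis
        by (simp add: distrib_left mult.assoc del: of_nat_Suc fact_Suc)
    qed
    ultimately show ?case by simp
  qed
  have gcont: "continuous_on {0..1} (g k)" for k
    using der by (intro continuous_on_vector_derivative)
  have "((\<lambda>t. (- 1) ^ p / fact p * (of_real t ^ p * g (j + Suc p) t)) has_integral (U p 1 - U p 0)) {0..1}"
    by (rule fundamental_theorem_of_calculus) (use U' in auto)
  hence "((\<lambda>t. (- 1) ^ p / fact p * (of_real t ^ p * g (j + Suc p) t)) has_integral (U p 1 - U p 0)) {0<..<1}"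
    by (simp add: has_integral_Icc_iff_Ioo)
  moreover have int: "set_integrable lborel {0<..<1} (\<lambda>t. (- 1) ^ p / fact p * (of_real t ^ p * g (j + Suc p) t))"
    by (intro continuous_imp_set_integrable_unit continuous_intros gcont)
  ultimately have "(LINT t:{0<..<1}|lborel. (- 1) ^ p / fact p * (of_real t ^ p * g (j + Suc p) t)) = U p 1 - U p 0"
    using set_borel_integral_eq_integral(2)[OF int] integral_unique by (metis (no_types, lifting))
  moreover have "(LINT t:{0<..<1}|lborel. (- 1) ^ p / fact p * (of_real t ^ p * g (j + Suc p) t)) =
     (- 1) ^ p / fact p * (LINT t:{0<..<1}|lborel. of_real t ^ p * g (j + Suc p) t)"
    by (rule set_integral_mult_right)
  ultimately have "(- 1) ^ p / fact p * (LINT t:{0<..<1}|lborel. of_real t ^ p * g (j + Suc p) t) = U p 1 - U p 0"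
    by (rule subst[rotated, where P = "\<lambda>x. x = U p 1 - U p 0"])
  moreover have "U p 0 = g j 0"
  proof -
    have "U p 0 = (\<Sum>i\<le>p. if i = 0 then g j 0 else 0)"
      unfolding U_def by (intro sum.cong) auto
    thus ?thesis by simp
  qed
  moreover have "U p 1 = (\<Sum>i\<le>p. (- 1) ^ i * g (j + i) 1 / fact i)" by (simp add: U_def)
  ultimately have "(- 1) ^ p / fact p * (LINT t:{0<..<1}|lborel. of_real t ^ p * g (j + Suc p) t) =
     (\<Sum>i\<le>p. (- 1) ^ i * g (j + i) 1 / fact i) - g j 0" by simp
  hence "(- 1) ^ p * fact p * ((- 1) ^ p / fact p * (LINT t:{0<..<1}|lborel. of_real t ^ p * g (j + Suc p) t)) =
     (- 1) ^ p * fact p * ((\<Sum>i\<le>p. (- 1) ^ i * g (j + i) 1 / fact i) - g j 0)" by simp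
  moreover have "(- 1) ^ p * fact p * ((- 1) ^ p / fact p * x) = (x :: complex)" for x
    by (cases "even p") auto
  ultimately show ?thesis by simp
qed

lemma hypergeom_terminating_at_1:
  assumes "length a = length b"
  shows "hypergeom (a @ [- of_nat k]) b 1 =
    (\<Sum>j\<le>k. poch_vec a j / poch_vec b j * ((- 1) ^ j * fact k / (fact j * fact (k - j))))"
proof -
  have "1 \<notin> cut_plane" by (simp add: cut_plane_iff)
  hence "hypergeom (a @ [- of_nat k]) b 1 = (\<Sum>j. hypergeom_coeff (a @ [- of_nat k]) b j)"
    by (simp add: hypergeom_def hypergeom_series_eq)
  also have "\<dots> = (\<Sum>j\<le>k. hypergeom_coeff (a @ [- of_nat k]) b j)"
  proof (rule suminf_finite)
    show "hypergeom_coeff (a @ [- of_nat k]) b j = 0" if "j \<notin> {..k}" for j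
      using that by (simp add: hypergeom_coeff_def poch_vec_append poch_vec_def pochhammer_of_nat_eq_0_lemma)
  qed auto
  also have "\<dots> = (\<Sum>j\<le>k. poch_vec a j / poch_vec b j * ((- 1) ^ j * fact k / (fact j * fact (k - j))))"
  proof (intro sum.cong refl)
    fix j assume "j \<in> {..k}"
    hence "pochhammer (- of_nat k :: complex) j = (- 1) ^ j * fact k / fact (k - j)"
      by (intro pochhammer_neg_of_nat) auto
    thus "hypergeom_coeff (a @ [- of_nat k]) b j = poch_vec a j / poch_vec b j * ((- 1) ^ j * fact k / (fact j * fact (k - j)))"
      by (simp add: hypergeom_coeff_def poch_vec_append) (simp add: poch_vec_def)
  qed
  finally show ?thesis .
qed

text \<open>The terminating series at 1 are differences of the sequence f(j) = (a)_j / (b)_j. Reordering the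
  finite sum by j leaves, for each j < n, the Taylor polynomial at 1 of the j-th derivative,
  evaluated at 0; the j-th term of the polynomial part of the kernel supplies its remainder.\<close>

lemma taylor_functional:
  fixes g :: "nat \<Rightarrow> real \<Rightarrow> complex"
  assumes len: "length a = length b"
    and der: "\<And>k t. t \<in> {0..1} \<Longrightarrow> (g k has_vector_derivative g (Suc k) t) (at t within {0..1})"
  shows "(\<Sum>k<n. (- 1) ^ k * g k 1 / fact k * hypergeom (a @ [- of_nat k]) b 1) +
      (- 1) ^ n * (LINT t:{0<..<1}|lborel. taylor_part a b n t * g n t) =
      (\<Sum>j<n. poch_vec a j / poch_vec b j * g j 0 / fact j)"
proof -
  define f where "f j = poch_vec a j / poch_vec b j" for j
  have gcont: "continuous_on {0..1} (g k)" for k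
    using der by (intro continuous_on_vector_derivative)
  have 1: "(\<Sum>k<n. (- 1) ^ k * g k 1 / fact k * hypergeom (a @ [- of_nat k]) b 1) =
     (\<Sum>j<n. \<Sum>i<n - j. f j / fact j * ((- 1) ^ i * g (j + i) 1 / fact i))"
  proof -
    have "(- 1) ^ k * g k 1 / fact k * hypergeom (a @ [- of_nat k]) b 1 =
       (\<Sum>j\<le>k. f j / fact j * ((- 1) ^ (k - j) * g (j + (k - j)) 1 / fact (k - j)))" for k
      unfolding hypergeom_terminating_at_1[OF len] sum_distrib_left
    proof (intro sum.cong refl)
      fix j assume j: "j \<in> {..k}"
      have "(- 1) ^ k = (- 1) ^ j * ((- 1) ^ (k - j) :: complex)" using j by (simp flip: power_add)
      hence "(- 1) ^ k * (- 1) ^ j = ((- 1) ^ (k - j) :: complex)" by (cases "even j") auto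
      hence e: "(- 1) ^ k * ((- 1) ^ j * x) = (- 1) ^ (k - j) * (x :: complex)" for x
        by (metis mult.assoc)
      have "(- 1) ^ k * g k 1 / fact k * (poch_vec a j / poch_vec b j * ((- 1) ^ j * fact k / (fact j * fact (k - j))))
         = (- 1) ^ k * ((- 1) ^ j * (g k 1 * f j / (fact j * fact (k - j))))"
        by (simp add: f_def)
      also have "\<dots> = f j / fact j * ((- 1) ^ (k - j) * g (j + (k - j)) 1 / fact (k - j))"
        unfolding e using j by simp
      finally show "(- 1) ^ k * g k 1 / fact k * (poch_vec a j / poch_vec b j * ((- 1) ^ j * fact k / (fact j * fact (k - j))))
         = f j / fact j * ((- 1) ^ (k - j) * g (j + (k - j)) 1 / fact (k - j))" .
    qed
    hence "(\<Sum>k<n. (- 1) ^ k * g k 1 / fact k * hypergeom (a @ [- of_nat k]) b 1) =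
       (\<Sum>k<n. \<Sum>j\<le>k. f j / fact j * ((- 1) ^ (k - j) * g (j + (k - j)) 1 / fact (k - j)))" by simp
    also have "\<dots> = (\<Sum>(j, i)\<in>{(j, i). j + i < n}. f j / fact j * ((- 1) ^ i * g (j + i) 1 / fact i))"
      by (rule sum.triangle_reindex[symmetric])
    also have "{(j, i). j + i < n} = (SIGMA j:{..<n}. {..<n - j})" by auto
    also have "(\<Sum>(j, i)\<in>(SIGMA j:{..<n}. {..<n - j}). f j / fact j * ((- 1) ^ i * g (j + i) 1 / fact i)) =
       (\<Sum>j<n. \<Sum>i<n - j. f j / fact j * ((- 1) ^ i * g (j + i) 1 / fact i))"
      by (rule sum.Sigma[symmetric]) auto
    finally show ?thesis .
  qed
  have 2: "(- 1) ^ n * (LINT t:{0<..<1}|lborel. taylor_part a b n t * g n t) =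
     (\<Sum>j<n. f j / fact j * (g j 0 - (\<Sum>i<n - j. (- 1) ^ i * g (j + i) 1 / fact i)))"
  proof -
    define e where "e j = f j * ((- 1) ^ j / (fact j * fact (n - 1 - j)))" for j
    have "(LINT t:{0<..<1}|lborel. taylor_part a b n t * g n t) =
       (LINT t:{0<..<1}|lborel. (\<Sum>j<n. e j * (of_real t ^ (n - 1 - j) * g n t)))"
      by (simp add: taylor_part_def e_def f_def sum_distrib_right mult.assoc)
    also have "\<dots> = (\<Sum>j<n. LINT t:{0<..<1}|lborel. e j * (of_real t ^ (n - 1 - j) * g n t))"
    proof -
      have "continuous_on {0..1} (\<lambda>t. e j * (of_real t ^ (n - 1 - j) * g n t))" for j
        by (intro continuous_intros gcont)
      hence "integrable lborel (\<lambda>t. indicator {0<..<1} t *\<^sub>R (e j * (of_real t ^ (n - 1 - j) * g n t)))" for j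
        using continuous_imp_set_integrable_unit unfolding set_integrable_def by blast
      thus ?thesis unfolding set_lebesgue_integral_def scaleR_sum_right by (rule Bochner_Integration.integral_sum)
    qed
    also have "\<dots> = (\<Sum>j<n. e j * (LINT t:{0<..<1}|lborel. of_real t ^ (n - 1 - j) * g n t))" by simp
    also have "(- 1) ^ n * \<dots> = (\<Sum>j<n. f j / fact j * (g j 0 - (\<Sum>i<n - j. (- 1) ^ i * g (j + i) 1 / fact i)))"
      unfolding sum_distrib_left
    proof (intro sum.cong refl)
      fix j assume j: "j \<in> {..<n}"
      define p where "p = n - 1 - j"
      have n: "n = j + Suc p" "n - j = Suc p" using j by (auto simp: p_def)
      have I: "(LINT t:{0<..<1}|lborel. of_real t ^ (n - 1 - j) * g n t) =
         (- 1) ^ p * fact p * ((\<Sum>i\<le>p. (- 1) ^ i * g (j + i) 1 / fact i) - g j 0)"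
        using taylor_integral_remainder[of g p j, OF der] unfolding p_def[symmetric] n(1)[symmetric] by simp
      have sgn: "(- 1) ^ n * ((- 1) ^ j * ((- 1) ^ p * x)) = - (x :: complex)" for x
      proof -
        have "(- 1) ^ n * ((- 1) ^ j * ((- 1) ^ p * x)) = (- 1) ^ (n + j + p) * x"
          by (simp only: power_add mult.assoc)
        also have "odd (n + j + p)" using n(1) by presburger
        hence "(- 1) ^ (n + j + p) = (- 1 :: complex)" by simp
        finally show ?thesis by simp
      qed
      have "(- 1) ^ n * (e j * (LINT t:{0<..<1}|lborel. of_real t ^ (n - 1 - j) * g n t)) =
         (- 1) ^ n * ((- 1) ^ j * ((- 1) ^ p * (f j / fact j * ((\<Sum>i\<le>p. (- 1) ^ i * g (j + i) 1 / fact i) - g j 0))))"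
        unfolding I unfolding e_def p_def[symmetric] by simp
      also have "\<dots> = f j / fact j * (g j 0 - (\<Sum>i\<le>p. (- 1) ^ i * g (j + i) 1 / fact i))"
        unfolding sgn by (simp only: minus_mult_right minus_diff_eq)
      also have "{..p} = {..<n - j}" unfolding n(2) by auto
      finally show "(- 1) ^ n * (e j * (LINT t:{0<..<1}|lborel. of_real t ^ (n - 1 - j) * g n t)) =
         f j / fact j * (g j 0 - (\<Sum>i<n - j. (- 1) ^ i * g (j + i) 1 / fact i))" .
    qed
    finally show ?thesis .
  qed
  show ?thesis unfolding 1 2 sum.distrib[symmetric]
    by (intro sum.cong refl, simp only: sum_distrib_left[symmetric] right_diff_distrib)
       (simp add: f_def)
qed

text \<open>Once Taylor's formula has absorbed the polynomial part of the kernel, the functional is the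
  coefficient transform with f(m) = (a)_m / (b)_m. Both this transform and \<open>K\<close> are holomorphic on \<open>D\<close>
  and have the same power series at 0.\<close>

lemma G1_dilation:
  fixes a b :: "complex list"
  assumes len: "length a = length b" and b: "\<forall>x\<in>set b. - x \<notin> \<nat>"
    and n: "\<forall>x\<in>set a. - real n < Re x" "- real n < Re (sum_list b - sum_list a)"
    and D: "open D" "ball 0 1 \<subseteq> D"
    and star: "star_shaped D"
    and H: "H holomorphic_on D" "\<And>w. w \<in> ball 0 1 \<Longrightarrow> (\<lambda>m. h m * w ^ m) sums H w"
    and K: "K holomorphic_on D"
      "\<And>w. w \<in> ball 0 1 \<Longrightarrow> (\<lambda>m. poch_vec a m / poch_vec b m * h m * w ^ m) sums K w"
    and w: "w \<in> D"
  shows "G1 a b n (\<lambda>t. H (w * of_real t)) = K w"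
proof -
  obtain v where v: "\<And>q. set_integrable lborel {0<..<1} (\<lambda>t. v t * of_real t ^ q)"
    "\<And>q. (LINT t:{0<..<1}|lborel. v t * of_real t ^ q) =
        (- 1) ^ n * poch_vec a (n + q) / poch_vec b (n + q) * fact q / fact (n + q)"
    "\<And>t. t \<in> {0<..<1} \<Longrightarrow> Gamma_vec b * G_hat_Gamma a b n t = taylor_part a b n t + v t"
    using G_hat_Gamma_decomposition[OF len b n] by blast
  define f where "f m = poch_vec a m / poch_vec b m" for m
  define g where "g k t = w ^ k * (deriv ^^ k) H (w * of_real t)" for k and t :: real
  have seg: "\<forall>t\<in>{0..1}. w * of_real t \<in> D" using star w by (auto simp: star_shaped_def)
  note der = deriv01_dilation[OF H(1) D(1) seg, folded g_def]
  have v0: "set_integrable lborel {0<..<1} v" using v(1)[of 0] by simp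
  have gcont: "continuous_on {0..1} (g k)" for k
    using der(1) by (intro continuous_on_vector_derivative)
  have int_T: "set_integrable lborel {0<..<1} (\<lambda>t. taylor_part a b n t * g n t)"
    unfolding taylor_part_def by (intro continuous_imp_set_integrable_unit continuous_intros gcont)
  have nH: "(deriv ^^ n) H holomorphic_on D" using H(1) D(1) by (rule holomorphic_higher_deriv)
  have "set_integrable lborel {0<..<1} (\<lambda>t. w ^ n * (v t * (deriv ^^ n) H (w * of_real t)))"
    using holomorphic_on_dilation_integral(2)[OF v0 D(1) star nH w] by simp
  hence int_v: "set_integrable lborel {0<..<1} (\<lambda>t. v t * g n t)" by (simp add: g_def mult_ac)
  have "Gamma_vec b * (LINT t:{0<..<1}|lborel. G_hat_Gamma a b n t * deriv01 n (\<lambda>t. H (w * of_real t)) t) =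
     (LINT t:{0<..<1}|lborel. Gamma_vec b * (G_hat_Gamma a b n t * deriv01 n (\<lambda>t. H (w * of_real t)) t))"
    by simp
  also have "\<dots> = (LINT t:{0<..<1}|lborel. taylor_part a b n t * g n t + v t * g n t)"
    by (intro set_lebesgue_integral_cong) (auto simp: der(2) v(3) distrib_right simp flip: mult.assoc)
  also have "\<dots> = (LINT t:{0<..<1}|lborel. taylor_part a b n t * g n t) + (LINT t:{0<..<1}|lborel. v t * g n t)"
    using int_T int_v by (rule set_integral_add)
  finally have I: "Gamma_vec b * (LINT t:{0<..<1}|lborel. G_hat_Gamma a b n t * deriv01 n (\<lambda>t. H (w * of_real t)) t) =
     (LINT t:{0<..<1}|lborel. taylor_part a b n t * g n t) + (LINT t:{0<..<1}|lborel. v t * g n t)" .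
  have "G1 a b n (\<lambda>t. H (w * of_real t)) =
     ((\<Sum>k<n. (- 1) ^ k * g k 1 / fact k * hypergeom (a @ [- of_nat k]) b 1) +
      (- 1) ^ n * (LINT t:{0<..<1}|lborel. taylor_part a b n t * g n t)) +
      (- 1) ^ n * (LINT t:{0<..<1}|lborel. v t * g n t)"
    unfolding G1_def mult.assoc[of "(- 1) ^ n" "Gamma_vec b"] I distrib_left by (simp add: der(2))
  also have "\<dots> = (\<Sum>j<n. f j * g j 0 / fact j) + (- 1) ^ n * (LINT t:{0<..<1}|lborel. v t * g n t)"
    using taylor_functional[of a b g n, OF len der(1)] unfolding f_def by (simp only:)
  also have "(LINT t:{0<..<1}|lborel. v t * g n t) =
      w ^ n * (LINT t:{0<..<1}|lborel. v t * (deriv ^^ n) H (w * of_real t))"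
    unfolding g_def by (subst set_integral_mult_right[symmetric]) (simp add: mult_ac)
  also have "(\<Sum>j<n. f j * g j 0 / fact j) + (- 1) ^ n * (w ^ n * (LINT t:{0<..<1}|lborel. v t * (deriv ^^ n) H (w * of_real t)))
      = coeff_transform f v n H w"
    by (simp add: coeff_transform_def g_def mult_ac)
  also have "\<dots> = K w"
  proof (rule coeff_transform_eqI[where D = D and h = h])
    show "(LINT t:{0<..<1}|lborel. v t * of_real t ^ q) =
        (- 1) ^ n * f (n + q) * fact q / fact (n + q)" for q
      unfolding v(2) f_def by simp
    show "connected D" using D(2) star by (intro connected_if_star_shaped) auto
  qed (use v(1) D star H K w in \<open>auto simp: f_def\<close>)
  finally show ?thesis .
qed

section \<open>The theorem\<close>

theorem theorem2:
  fixes a b c d :: "complex list" and p u s n :: nat and z :: complex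
  assumes "p \<ge> 1" and "u \<le> s + 1"
    and "length a = p" and "length b = p" and "length c = u" and "length d = s"
    and "\<forall>x\<in>set b. - x \<notin> \<nat>" and "\<forall>x\<in>set d. - x \<notin> \<nat>"
    and "real n > - min (Min (Re ` set a)) (Re (\<Sum>k<p. b ! k - a ! k))"
    and "u = s + 1 \<Longrightarrow> z \<notin> complex_of_real ` {..-1}"
  shows "(\<lambda>t. hypergeom c d (- z * of_real t)) \<in> CB_inf \<and>
         G1 a b n (\<lambda>t. hypergeom c d (- z * of_real t)) = hypergeom (a @ c) (b @ d) (- z)"
proof -
  have len: "length a = length b" using assms by simp
  have ne: "set a \<noteq> {}" using assms by auto
  have psi: "(\<Sum>k<p. b ! k - a ! k) = sum_list b - sum_list a"
    using assms by (simp add: sum_subtractf sum_list_sum_nth atLeast0LessThan)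
  have n2: "- real n < Re (sum_list b - sum_list a)" using assms(9) unfolding psi by linarith
  have n1: "\<forall>x\<in>set a. - real n < Re x"
  proof
    fix x assume "x \<in> set a"
    hence "Min (Re ` set a) \<le> Re x" by (intro Min_le) auto
    thus "- real n < Re x" using assms(9) by linarith
  qed
  have bd: "\<forall>x\<in>set (b @ d). - x \<notin> \<nat>" using assms by auto
  define D where "D = (if u = s + 1 then cut_plane else UNIV)"
  have D: "open D" "ball 0 1 \<subseteq> D" "star_shaped D"
    using open_cut_plane ball_subset_cut_plane cut_plane_star by (auto simp: D_def star_shaped_def)
  have zD: "- z \<in> D"
  proof (cases "u = s + 1")
    case True
    have "\<not> (Im z = 0 \<and> Re z \<le> - 1)"
    proof
      assume "Im z = 0 \<and> Re z \<le> - 1"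
      hence "z = complex_of_real (Re z)" "Re z \<in> {..-1}" by (auto simp: complex_eq_iff)
      thus False using assms(10)[OF True] by blast
    qed
    thus ?thesis using True by (auto simp: D_def cut_plane_iff)
  qed (simp add: D_def)
  have analytic: "hypergeom c' d' holomorphic_on D \<and>
      (\<forall>w\<in>ball 0 1. (\<lambda>m. hypergeom_coeff c' d' m * w ^ m) sums hypergeom c' d' w)"
    if "length c' + s = length d' + u" "\<forall>x\<in>set d'. - x \<notin> \<nat>" for c' d'
    using that assms(2) hypergeom_analytic_cut_plane[of c' d'] hypergeom_entire[of c' d']
    by (cases "u = s + 1") (auto simp: D_def)
  have H: "hypergeom c d holomorphic_on D"
    "\<And>w. w \<in> ball 0 1 \<Longrightarrow> (\<lambda>m. hypergeom_coeff c d m * w ^ m) sums hypergeom c d w"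
    using analytic[of c d] assms by auto
  have K: "hypergeom (a @ c) (b @ d) holomorphic_on D"
    "\<And>w. w \<in> ball 0 1 \<Longrightarrow> (\<lambda>m. hypergeom_coeff (a @ c) (b @ d) m * w ^ m) sums hypergeom (a @ c) (b @ d) w"
    using analytic[of "a @ c" "b @ d"] assms bd by auto
  have "hypergeom_coeff (a @ c) (b @ d) m = poch_vec a m / poch_vec b m * hypergeom_coeff c d m" for m
    by (simp add: hypergeom_coeff_def poch_vec_append)
  note K = K[unfolded this]
  have seg: "\<forall>t\<in>{0..1}. - z * of_real t \<in> D" using D(3) zD by (auto simp: star_shaped_def)
  show ?thesis
    using dilation_in_CB_inf[OF H(1) D(1) seg]
      G1_dilation[OF len assms(7) n1 n2 D H K zD] by simp
qed

end
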